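(* Let $(\mathbf u,p)$ solve the Stokes interface problem $$\begin{cases} -\nabla\cdot\boldsymbol\sigma(\mathbf u,p;\mu)=\mathbf f & \text{in } \Omega_B\cup\Omega_F,\\ \nabla\cdot\mathbf u=0 & \text{in } \Omega_B\cup\Omega_F,\\ [\![\mathbf u]\!]=\mathbf 0 & \text{on } \Gamma,\\ [\![\boldsymbol\sigma(\mathbf u,p;\mu)\mathbf n]\!]=\gamma\kappa\mathbf n & \text{on } \Gamma,\\ \mathbf u=\mathbf g_D & \text{on } \Gamma_D,\\ \boldsymbol\sigma(\mathbf u,p;\mu)\mathbf n=\mathbf g_N & \text{on } \Gamma_N, \end{cases}$$ where $\Omega_B=\bigcup_{i=1}^M\Omega_B^i$ is a union of $M$ balls $\Omega_B^i=B(\mathbf x_i;r_i)$ with pairwise disjoint closures contained in $\Omega$. For any integer $j\ge0$, let $(\mathbf u_j,p_j)$ denote the $j$-th approximation produced by the alternating correction algorithm described in the context, with associated fields $\mathbf v_{j-1,i}$ ($i=1,\dots,M$) and $\mathbf v_{j-1/2}$. Define the errors $\mathbf v^{(j)}=\mathbf u-\mathbf u_j$ and $q^{(j)}=p-p_j$. Then $$\begin{cases} -\nabla\cdot\boldsymbol\sigma(\mathbf v^{(j)},q^{(j)};\mu)=2(\mu-\mu_F)\nabla\cdot\boldsymbol\varepsilon(\boldsymbol\phi_{j-1/2}) & \text{in }\Omega_B\cup\Omega_F,\\ \nabla\cdot\mathbf v^{(j)}=0 & \text{in }\Omega_B\cup\Omega_F,\\ [\![\mathbf v^{(j)}]\!]=\mathbf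 0 & \text{on }\Gamma,\\ [\![\boldsymbol\sigma(\mathbf v^{(j)},q^{(j)};\mu)\mathbf n]\!]=-2[\![\mu]\!]\,\boldsymbol\varepsilon(\boldsymbol\phi_{j-1/2})|_{\Omega_B}\mathbf n & \text{on }\Gamma,\\ \mathbf v^{(j)}=\mathbf 0 & \text{on }\Gamma_D,\\ \boldsymbol\sigma(\mathbf v^{(j)},q^{(j)};\mu)\mathbf n=\mathbf 0 & \text{on }\Gamma_N, \end{cases}$$ where $$\boldsymbol\phi_{j-1/2}=\sum_{i=1}^M\sum_{i'\neq i}\mathbf v_{j-1,i'}\,\chi_{\Omega_B^i}+\mathbf v_{j-1/2}.$$
   Context: Geometry: $\Omega\subset\mathbb R^d$, $d\in\{2,3\}$, is a bounded Lipschitz domain. The droplets are the open balls $\Omega_B^i=B(\mathbf x_i;r_i)$, $i=1,\dots,M$, $M\ge1$, whose closures are pairwise disjoint and contained in $\Omega$. Put $\Omega_B=\bigcup_i\Omega_B^i$, $\Omega_F=\Omega\setminus\overline{\Omega_B}$, $\Gamma=\partial\Omega_B$. The outer boundary is split as $\Gamma_D\subset\partial\Omega$ and $\Gamma_N=\partial\Omega\setminus\Gamma_D$. The unit normal $\mathbf n$ on $\Gamma$ points towards $\Omega_F$, and on $\partial\Omega$ it points outwards. Coefficients: $\mu|_{\Omega_F}\equiv\mu_F>0$ and $\mu|_{\Omega_B^i}\equiv\mu_i>0$ are constants. The surface tension coefficient is $\gamma|_{\partial\Omega_B^i}\equiv\gamma_i\in\mathbb R$. The mean curvature is $\kappa\equiv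 r_i^{-1}$ on $\partial\Omega_B^i$. Notation: $\boldsymbol\varepsilon(\mathbf u)=\frac12(\nabla\mathbf u+\nabla\mathbf u^\top)$; $\mathrm I$ is the identity tensor; $\boldsymbol\sigma(\mathbf u,p;\mu)=2\mu\,\boldsymbol\varepsilon(\mathbf u)-p\,\mathrm I$; $\chi_A$ is the indicator function of $A$. The jump is $[\![w]\!]:=w|_{\Omega_F}-w|_{\Omega_B}$ on $\Gamma$ (exterior trace minus interior trace); in particular $[\![\mu]\!]=\mu_F-\mu_i$ on $\partial\Omega_B^i$. The symbol $\cdot|_{\Omega_B}$ on $\Gamma$ denotes the trace from the $\Omega_B$ side. Data: $\mathbf f\in[H^{-1}(\Omega)]^d$, $\mathbf g_D\in[H^{1/2}(\Gamma_D)]^d$, $\mathbf g_N\in[H^{-1/2}(\Gamma_N)]^d$. Equations are understood in the sense of distributions on the indicated open sets and boundary/interface conditions in the sense of traces (normal-stress traces are assumed to be meaningful). Boundary solver: $\mathrm{S\_boundary}(\widetilde{\mathbf f},\widetilde{\mathbf g}_D,\widetilde{\mathbf g}_N)$ returns an exact solution $(\mathbf w,s)\in[H^1(\Omega)]^d\times L^2(\Omega)$ of the uniform-viscosity problem $$-\nabla\cdot\boldsymbol\sigma(\mathbf w,s;\mu_F)=\widetilde{\mathbf f}\ \text{and}\ \nabla\cdot\mathbf w=0\ \text{in }\Omega,\qquad \mathbf w=\widetilde{\mathbf g}_D\ \text{on }\Gamma_D,\qquad \boldsymbol\sigma(\mathbf w,s;\mu_F)\mathbf n=\widetilde{\mathbf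 g}_N\ \text{on }\Gamma_N.$$ Such solutions satisfy $[\![\mathbf w]\!]=\mathbf 0$ and $[\![\boldsymbol\sigma(\mathbf w,s;\mu_F)\mathbf n]\!]=\mathbf 0$ on $\Gamma$ (standing fact). Single-droplet solver: $\mathrm{S\_droplet}(\mu_i,0,\boldsymbol\phi,\Omega_B^i)$, for a flow field $\boldsymbol\phi$ on $\overline{\Omega_B^i}$, returns an exact solution $(\mathbf v,q)$ of the free-space single-droplet problem with zero surface tension $$\begin{cases} -\nabla\cdot\boldsymbol\sigma(\mathbf v,q;\mu_i)=2(\mu_i-\mu_F)\nabla\cdot\boldsymbol\varepsilon(\boldsymbol\phi) & \text{in }\Omega_B^i,\\ -\nabla\cdot\boldsymbol\sigma(\mathbf v,q;\mu_F)=\mathbf 0 & \text{in }\mathbb R^d\setminus\overline{\Omega_B^i},\\ \nabla\cdot\mathbf v=0 & \text{in }\mathbb R^d\setminus\partial\Omega_B^i,\\ [\![\mathbf v]\!]=\mathbf 0 & \text{on }\partial\Omega_B^i,\\ [\![\boldsymbol\sigma(\mathbf v,q;\mu^{[i]})\mathbf n]\!]=-2(\mu_F-\mu_i)\,\boldsymbol\varepsilon(\boldsymbol\phi)\mathbf n & \text{on }\partial\Omega_B^i,\\ \lim_{\|\mathbf x\|\to\infty}\mathbf v(\mathbf x)=\mathbf 0, \end{cases}$$ where $\mu^{[i]}=\mu_F+(\mu_i-\mu_F)\chi_{\Omega_B^i}$ and $\boldsymbol\varepsilon(\boldsymbol\phi)$ on $\partial\Omega_B^i$ is the trace from inside $\Omega_B^i$.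 In particular, away from $\overline{\Omega_B^i}$ (e.g. across $\partial\Omega_B^{i'}$, $i'\ne i$) $\mathbf v$ and $\boldsymbol\sigma(\mathbf v,q;\mu_F)\mathbf n$ have no jumps. Alternating correction algorithm (all solves exact and assumed to exist): 1. Compute $(\mathbf u_0,p_0)\gets\mathrm{S\_boundary}(\mathbf f,\mathbf g_D,\mathbf g_N)$. 2. Update $p_0\gets p_0+\sum_{i=1}^M\frac{\gamma_i}{r_i}\chi_{\Omega_B^i}$. 3. Initialize $\mathbf v_{-1,i}=\mathbf 0$ for all $i$, $\mathbf v_{-1}=\mathbf 0$, and $\mathbf v_{-1/2}=\mathbf u_0$. 4. For $j=0,1,2,\dots$: (a) for each $i=1,\dots,M$, set $\boldsymbol\phi_{j-1/2,i}=\mathbf v_{j-1}+\mathbf v_{j-1/2}-\mathbf v_{j-1,i}$ (restricted to $\Omega_B^i$) and $(\mathbf v_{j,i},q_{j,i})=\mathrm{S\_droplet}(\mu_i,0,\boldsymbol\phi_{j-1/2,i},\Omega_B^i)$; (b) set $\mathbf v_j=\sum_{i=1}^M\mathbf v_{j,i}$ and $q_j=\sum_{i=1}^Mq_{j,i}$; (c) set $\mathbf u_{j+1/2}=\mathbf u_j+\mathbf v_j$ and $p_{j+1/2}=p_j+q_j$; (d) set $(\mathbf v_{j+1/2},q_{j+1/2})=\mathrm{S\_boundary}\big(\mathbf 0,\,-\mathbf v_j|_{\Gamma_D},\,-(\boldsymbol\sigma(\mathbf v_j,q_j;\mu)\mathbf n)|_{\Gamma_N}\big)$; (e) set $\mathbf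 u_{j+1}=\mathbf u_{j+1/2}+\mathbf v_{j+1/2}$ and $p_{j+1}=p_{j+1/2}+q_{j+1/2}$. The $p_0$ used in the claim for $j=0$ is the one after the update in step 2. *)

theory Defs
  imports "HOL-Analysis.Analysis"
begin

section \<open>Test functions and distributions\<close>

text \<open>In finite dimension, \<open>f\<close> is \<open>C\<^sup>k\<^sup>+\<^sup>1\<close> iff it is differentiable and all its directional
  derivatives are \<open>C\<^sup>k\<close>.\<close>

primrec C_k :: "nat \<Rightarrow> ('a::real_normed_vector \<Rightarrow> 'b::real_normed_vector) \<Rightarrow> bool" where
  "C_k 0 f = continuous_on UNIV f"
| "C_k (Suc k) f = ((\<forall>x. f differentiable (at x)) \<and>
      (\<forall>v. C_k k (\<lambda>x. frechet_derivative f (at x) v)))"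

definition smooth :: "('a::real_normed_vector \<Rightarrow> 'b::real_normed_vector) \<Rightarrow> bool" where
  "smooth f \<longleftrightarrow> (\<forall>k. C_k k f)"

text \<open>\<open>A\<close> need not be open: for \<open>A = N - (frontier \<Omega> - S)\<close> these are the smooth functions on the
  whole space whose compact support lies in \<open>N\<close> and meets \<open>frontier \<Omega>\<close> only inside \<open>S\<close>.\<close>

definition test_functions ::
    "'a::real_normed_vector set \<Rightarrow> ('a \<Rightarrow> 'b::real_normed_vector) set" where
  "test_functions A = {\<psi>. smooth \<psi> \<and> compact (closure {x. \<psi> x \<noteq> 0}) \<and> closure {x. \<psi> x \<noteq> 0} \<subseteq> A}"

abbreviation grad :: "(real^'n \<Rightarrow> real^'n) \<Rightarrow> real^'n \<Rightarrow> real^'n^'n" where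
  "grad \<psi> x \<equiv> jacobian \<psi> (at x)"

text \<open>The distribution \<open>\<nabla>\<cdot>T\<close> on \<open>U\<close>; the inner product of matrices is the Frobenius product.\<close>

definition div_dist ::
    "(real^'n) set \<Rightarrow> (real^'n \<Rightarrow> real^'n^'n) \<Rightarrow> (real^'n \<Rightarrow> real^'n) \<Rightarrow> real" where
  "div_dist U T \<psi> = - (\<integral>x. T x \<bullet> grad \<psi> x \<partial>lebesgue_on U)"

definition divergence_free :: "(real^'n) set \<Rightarrow> (real^'n \<Rightarrow> real^'n) \<Rightarrow> bool" where
  "divergence_free U w \<longleftrightarrow>
     (\<forall>\<phi> \<in> test_functions U.
        (\<integral>x. (\<Sum>j\<in>UNIV. w x $ j * frechet_derivative \<phi> (at x) (axis j (1::real))) \<partial>lebesgue_on U)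
          = (0::real))"


section \<open>Sobolev spaces\<close>

definition L2 :: "(real^'n) set \<Rightarrow> (real^'n \<Rightarrow> 'b::euclidean_space) set" where
  "L2 U = {w. w \<in> borel_measurable (lebesgue_on U) \<and>
              integrable (lebesgue_on U) (\<lambda>x. (norm (w x))\<^sup>2)}"

text \<open>Square integrable on every bounded part of \<open>U\<close> (up to the boundary of \<open>U\<close>).\<close>

definition L2_bdd :: "(real^'n) set \<Rightarrow> (real^'n \<Rightarrow> 'b::euclidean_space) set" where
  "L2_bdd U = {w. \<forall>R. w \<in> L2 (U \<inter> ball 0 R)}"

definition is_weak_grad ::
    "(real^'n) set \<Rightarrow> (real^'n \<Rightarrow> real^'n) \<Rightarrow> (real^'n \<Rightarrow> real^'n^'n) \<Rightarrow> bool" where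
  "is_weak_grad U w G \<longleftrightarrow>
     (\<forall>K. compact K \<and> K \<subseteq> U \<longrightarrow> integrable (lebesgue_on K) w \<and> integrable (lebesgue_on K) G) \<and>
     (\<forall>\<phi> \<in> test_functions U. \<forall>i j.
        (\<integral>x. w x $ i * frechet_derivative \<phi> (at x) (axis j 1) \<partial>lebesgue_on U)
          = - (\<integral>x. G x $ i $ j * \<phi> x \<partial>lebesgue_on U))"

text \<open>Unique up to null sets.\<close>

definition weak_grad :: "(real^'n) set \<Rightarrow> (real^'n \<Rightarrow> real^'n) \<Rightarrow> real^'n \<Rightarrow> real^'n^'n" where
  "weak_grad U w = (SOME G. is_weak_grad U w G)"

definition H1 :: "(real^'n) set \<Rightarrow> (real^'n \<Rightarrow> real^'n) set" where
  "H1 U = {w \<in> L2 U. \<exists>G \<in> L2 U. is_weak_grad U w G}"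

definition H1_bdd :: "(real^'n) set \<Rightarrow> (real^'n \<Rightarrow> real^'n) set" where
  "H1_bdd U = {w \<in> L2_bdd U. \<exists>G \<in> L2_bdd U. is_weak_grad U w G}"

definition H1_norm :: "(real^'n) set \<Rightarrow> (real^'n \<Rightarrow> real^'n) \<Rightarrow> real" where
  "H1_norm U \<psi> = sqrt (\<integral>x. (norm (\<psi> x))\<^sup>2 + (norm (grad \<psi> x))\<^sup>2 \<partial>lebesgue_on U)"

definition linear_functional_on ::
    "(real^'n \<Rightarrow> real^'n) set \<Rightarrow> ((real^'n \<Rightarrow> real^'n) \<Rightarrow> real) \<Rightarrow> bool" where
  "linear_functional_on X F \<longleftrightarrow>
     (\<forall>\<psi>\<in>X. \<forall>\<psi>'\<in>X. \<forall>a b. F (\<lambda>x. a *\<^sub>R \<psi> x + b *\<^sub>R \<psi>' x) = a * F \<psi> + b * F \<psi>')"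

text \<open>\<open>[H\<^sup>-\<^sup>1(\<Omega>)]\<^sup>d\<close>, the dual of \<open>[H\<^sup>1\<^sub>0(\<Omega>)]\<^sup>d\<close>, as functionals on the dense set of test functions.\<close>

definition H_minus_1 :: "(real^'n) set \<Rightarrow> ((real^'n \<Rightarrow> real^'n) \<Rightarrow> real) set" where
  "H_minus_1 \<Omega> = {F. linear_functional_on (test_functions \<Omega>) F \<and>
      (\<exists>C. \<forall>\<psi> \<in> test_functions \<Omega>. \<bar>F \<psi>\<bar> \<le> C * H1_norm \<Omega> \<psi>)}"


section \<open>Boundaries and traces\<close>

text \<open>Open, connected and bounded, and near each boundary point, in suitable orthogonal
  coordinates with vertical direction \<open>e\<close>, the region strictly above a Lipschitz graph.\<close>

definition bounded_Lipschitz_domain :: "(real^'n) set \<Rightarrow> bool" where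
  "bounded_Lipschitz_domain \<Omega> \<longleftrightarrow>
     \<Omega> \<noteq> {} \<and> open \<Omega> \<and> connected \<Omega> \<and> bounded \<Omega> \<and>
     (\<forall>x \<in> frontier \<Omega>. \<exists>e \<rho> L h. norm e = 1 \<and> \<rho> > 0 \<and> L-lipschitz_on {z. e \<bullet> z = 0} h \<and>
        (\<forall>y \<in> ball x \<rho>. y \<in> \<Omega> \<longleftrightarrow> h ((y - x) - (e \<bullet> (y - x)) *\<^sub>R e) < e \<bullet> (y - x)))"

text \<open>Vanishing \<open>s\<close>-dimensional Hausdorff measure (\<open>s \<ge> 1\<close>); the diameters of the covering sets
  are automatically small.\<close>

definition hausdorff_null :: "nat \<Rightarrow> 'a::metric_space set \<Rightarrow> bool" where
  "hausdorff_null s A \<longleftrightarrow>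
     (\<forall>e>0. \<exists>C :: nat \<Rightarrow> 'a set. A \<subseteq> (\<Union>k. C k) \<and> (\<forall>k. bounded (C k)) \<and>
        summable (\<lambda>k. diameter (C k) ^ s) \<and> (\<Sum>k. diameter (C k) ^ s) < e)"

text \<open>\<open>g\<close> is the trace of \<open>w\<close>, taken from \<open>U\<close>, on \<open>S \<subseteq> frontier U\<close>: at almost every \<open>x \<in> S\<close> with
  respect to surface measure, the means of \<open>norm (w - g x)\<close> over \<open>U \<inter> ball x \<rho>\<close> tend to 0.
  For Lipschitz \<open>U\<close> the volume of \<open>U \<inter> ball x \<rho>\<close> is comparable to \<open>\<rho>\<close> to the power of the
  dimension, so that dividing by the latter amounts to taking means.\<close>

definition has_trace ::
    "(real^'n) set \<Rightarrow> (real^'n) set \<Rightarrow> (real^'n \<Rightarrow> real^'n) \<Rightarrow> (real^'n \<Rightarrow> real^'n) \<Rightarrow> bool" where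
  "has_trace U S w g \<longleftrightarrow>
     (\<exists>Z. hausdorff_null (CARD('n) - 1) Z \<and>
        (\<forall>x \<in> S - Z.
           (\<forall>\<^sub>F \<rho> in at_right 0. integrable (lebesgue_on (U \<inter> ball x \<rho>)) w) \<and>
           ((\<lambda>\<rho>. (\<integral>y. norm (w y - g x) \<partial>lebesgue_on (U \<inter> ball x \<rho>)) / \<rho> ^ CARD('n)) \<longlongrightarrow> 0)
             (at_right 0)))"

definition trace_jump ::
    "(real^'n) set \<Rightarrow> (real^'n) set \<Rightarrow> (real^'n) set \<Rightarrow> (real^'n \<Rightarrow> real^'n) \<Rightarrow>
     (real^'n \<Rightarrow> real^'n) \<Rightarrow> bool" where
  "trace_jump E I S w g \<longleftrightarrow>
     (\<exists>a b. has_trace E S w a \<and> has_trace I S w b \<and> (\<forall>x\<in>S. a x - b x = g x))"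

text \<open>\<open>[H\<^sup>1\<^sup>/\<^sup>2(S)]\<^sup>d\<close> as the space of traces on \<open>S \<subseteq> frontier \<Omega>\<close>.\<close>

definition H_half :: "(real^'n) set \<Rightarrow> (real^'n) set \<Rightarrow> (real^'n \<Rightarrow> real^'n) set" where
  "H_half \<Omega> S = {g. \<exists>w \<in> H1 \<Omega>. has_trace \<Omega> S w g}"

text \<open>\<open>[H\<^sup>-\<^sup>1\<^sup>/\<^sup>2(S)]\<^sup>d\<close> for \<open>S \<subseteq> frontier \<Omega>\<close>, as functionals on the traces of smooth functions vanishing
  near \<open>frontier \<Omega> - S\<close>, bounded in the quotient norm of \<open>H\<^sup>1\<^sup>/\<^sup>2\<close> (the infimum of \<open>H1_norm \<Omega>\<close> over all
  extensions \<open>\<psi>'\<close>). In particular \<open>g \<psi>\<close> depends only on the values of \<open>\<psi>\<close> on \<open>S\<close>.\<close>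

definition H_minus_half :: "(real^'n) set \<Rightarrow> (real^'n) set \<Rightarrow> ((real^'n \<Rightarrow> real^'n) \<Rightarrow> real) set" where
  "H_minus_half \<Omega> S = {g. linear_functional_on (test_functions (UNIV - (frontier \<Omega> - S))) g \<and>
     (\<exists>C. \<forall>\<psi> \<in> test_functions (UNIV - (frontier \<Omega> - S)).
           \<forall>\<psi>' \<in> test_functions (UNIV - (frontier \<Omega> - S)).
             (\<forall>x\<in>S. \<psi> x = \<psi>' x) \<longrightarrow> \<bar>g \<psi>\<bar> \<le> C * H1_norm \<Omega> \<psi>')}"

text \<open>The weak normal trace of \<open>H(div)\<close> theory: \<open>T n = g\<close> on \<open>S \<subseteq> frontier U\<close>, with \<open>T\<close> taken from \<open>U\<close>
  and \<open>n\<close> the unit normal pointing out of \<open>U\<close>. It is meaningful if \<open>T\<close> and its distributional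
  divergence \<open>d\<close> are square integrable near \<open>S\<close>, and is then given by Green's formula.
  Traces are tested only against functions supported near \<open>S\<close>, which is all that matters for
  functionals of boundary values.\<close>

definition has_normal_trace ::
    "(real^'n) set \<Rightarrow> (real^'n) set \<Rightarrow> (real^'n \<Rightarrow> real^'n^'n) \<Rightarrow>
     ((real^'n \<Rightarrow> real^'n) \<Rightarrow> real) \<Rightarrow> bool" where
  "has_normal_trace U S T g \<longleftrightarrow>
     (\<exists>N d. open N \<and> S \<subseteq> N \<and> T \<in> L2 (U \<inter> N) \<and> d \<in> L2 (U \<inter> N) \<and>
        (\<forall>\<psi> \<in> test_functions (U \<inter> N).
           div_dist (U \<inter> N) T \<psi> = (\<integral>x. d x \<bullet> \<psi> x \<partial>lebesgue_on (U \<inter> N))) \<and>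
        (\<forall>\<psi> \<in> test_functions (N - (frontier U - S)).
           g \<psi> = (\<integral>x. T x \<bullet> grad \<psi> x + d x \<bullet> \<psi> x \<partial>lebesgue_on (U \<inter> N))))"

text \<open>The jump of \<open>T n\<close>, exterior minus interior, where \<open>n\<close> points from \<open>I\<close> to \<open>E\<close>. The outward
  normal of \<open>E\<close> is \<open>-n\<close>, whence the sign of \<open>a\<close>.\<close>

definition normal_jump ::
    "(real^'n) set \<Rightarrow> (real^'n) set \<Rightarrow> (real^'n) set \<Rightarrow> (real^'n \<Rightarrow> real^'n^'n) \<Rightarrow>
     ((real^'n \<Rightarrow> real^'n) \<Rightarrow> real) \<Rightarrow> bool" where
  "normal_jump E I S T g \<longleftrightarrow>
     (\<exists>a b N. has_normal_trace E S T a \<and> has_normal_trace I S T b \<and> open N \<and> S \<subseteq> N \<and>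
        (\<forall>\<psi> \<in> test_functions N. - a \<psi> - b \<psi> = g \<psi>))"

text \<open>Surface measure of \<open>sphere a \<rho>\<close>: with \<open>d = CARD('n)\<close>, the area of a piece of the sphere is
  \<open>d / \<rho>\<close> times the volume of the cone over it with apex \<open>a\<close>.\<close>

definition sphere_measure :: "real^'n \<Rightarrow> real \<Rightarrow> (real^'n) measure" where
  "sphere_measure a \<rho> =
     scale_measure (ennreal (real CARD('n) / \<rho>))
       (distr (lebesgue_on (ball a \<rho>)) borel (\<lambda>x. a + (\<rho> / norm (x - a)) *\<^sub>R (x - a)))"


section \<open>The flow problems\<close>

definition strain :: "(real^'n) set \<Rightarrow> (real^'n \<Rightarrow> real^'n) \<Rightarrow> real^'n \<Rightarrow> real^'n^'n" where
  "strain U w x = (1/2) *\<^sub>R (weak_grad U w x + transpose (weak_grad U w x))"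

definition stress ::
    "(real^'n) set \<Rightarrow> (real^'n \<Rightarrow> real) \<Rightarrow> (real^'n \<Rightarrow> real^'n) \<Rightarrow> (real^'n \<Rightarrow> real) \<Rightarrow>
     real^'n \<Rightarrow> real^'n^'n" where
  "stress U \<mu> w s x = (2 * \<mu> x) *\<^sub>R strain U w x - s x *\<^sub>R mat 1"

definition droplets :: "nat \<Rightarrow> (nat \<Rightarrow> real^'n) \<Rightarrow> (nat \<Rightarrow> real) \<Rightarrow> (real^'n) set" where
  "droplets M c r = (\<Union>i\<in>{1..M}. ball (c i) (r i))"

definition fluid ::
    "(real^'n) set \<Rightarrow> nat \<Rightarrow> (nat \<Rightarrow> real^'n) \<Rightarrow> (nat \<Rightarrow> real) \<Rightarrow> (real^'n) set" where
  "fluid \<Omega> M c r = \<Omega> - closure (droplets M c r)"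

text \<open>The interface problem with viscosity \<open>\<mu>\<close>, force \<open>f\<close> on \<open>\<Omega>\<^sub>B \<union> \<Omega>\<^sub>F\<close>, normal stress jump \<open>G i\<close> on the
  boundary of droplet \<open>i\<close> and boundary data \<open>g\<^sub>D\<close>, \<open>g\<^sub>N\<close>.\<close>

definition interface_solution ::
    "(real^'n) set \<Rightarrow> (real^'n) set \<Rightarrow> (real^'n) set \<Rightarrow> nat \<Rightarrow> (nat \<Rightarrow> real^'n) \<Rightarrow> (nat \<Rightarrow> real) \<Rightarrow>
     (real^'n \<Rightarrow> real) \<Rightarrow> ((real^'n \<Rightarrow> real^'n) \<Rightarrow> real) \<Rightarrow> (nat \<Rightarrow> (real^'n \<Rightarrow> real^'n) \<Rightarrow> real) \<Rightarrow>
     (real^'n \<Rightarrow> real^'n) \<Rightarrow> ((real^'n \<Rightarrow> real^'n) \<Rightarrow> real) \<Rightarrow>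
     (real^'n \<Rightarrow> real^'n) \<Rightarrow> (real^'n \<Rightarrow> real) \<Rightarrow> bool" where
  "interface_solution \<Omega> \<Gamma>\<^sub>D \<Gamma>\<^sub>N M c r \<mu> f G g\<^sub>D g\<^sub>N u p \<longleftrightarrow>
     (let \<Omega>\<^sub>F = fluid \<Omega> M c r; U = droplets M c r \<union> \<Omega>\<^sub>F; T = stress U \<mu> u p in
      u \<in> H1 U \<and> p \<in> L2 \<Omega> \<and>
      (\<forall>\<psi> \<in> test_functions U. - div_dist U T \<psi> = f \<psi>) \<and>
      divergence_free U u \<and>
      (\<forall>i\<in>{1..M}. trace_jump \<Omega>\<^sub>F (ball (c i) (r i)) (sphere (c i) (r i)) u (\<lambda>x. 0)) \<and>
      (\<forall>i\<in>{1..M}. normal_jump \<Omega>\<^sub>F (ball (c i) (r i)) (sphere (c i) (r i)) T (G i)) \<and>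
      has_trace \<Omega> \<Gamma>\<^sub>D u g\<^sub>D \<and>
      has_normal_trace \<Omega> \<Gamma>\<^sub>N T g\<^sub>N)"

text \<open>\<open>(w, s)\<close> is a possible result of the boundary solver.\<close>

definition boundary_solution ::
    "(real^'n) set \<Rightarrow> (real^'n) set \<Rightarrow> (real^'n) set \<Rightarrow> real \<Rightarrow> ((real^'n \<Rightarrow> real^'n) \<Rightarrow> real) \<Rightarrow>
     (real^'n \<Rightarrow> real^'n) \<Rightarrow> ((real^'n \<Rightarrow> real^'n) \<Rightarrow> real) \<Rightarrow>
     (real^'n \<Rightarrow> real^'n) \<Rightarrow> (real^'n \<Rightarrow> real) \<Rightarrow> bool" where
  "boundary_solution \<Omega> \<Gamma>\<^sub>D \<Gamma>\<^sub>N \<mu>\<^sub>F f g\<^sub>D g\<^sub>N w s \<longleftrightarrow>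
     (let T = stress \<Omega> (\<lambda>x. \<mu>\<^sub>F) w s in
      w \<in> H1 \<Omega> \<and> s \<in> L2 \<Omega> \<and>
      (\<forall>\<psi> \<in> test_functions \<Omega>. - div_dist \<Omega> T \<psi> = f \<psi>) \<and>
      divergence_free \<Omega> w \<and>
      has_trace \<Omega> \<Gamma>\<^sub>D w g\<^sub>D \<and>
      has_normal_trace \<Omega> \<Gamma>\<^sub>N T g\<^sub>N)"

text \<open>\<open>(v, q)\<close> is a possible result of the single-droplet solver with zero surface tension for the
  droplet \<open>ball a \<rho>\<close> of viscosity \<open>\<mu>\<^sub>i\<close> and the flow field \<open>\<phi>\<close>. Outside the closed droplet, where \<open>v\<close> is
  a homogeneous Stokes flow, \<open>v\<close> is its continuous representative, so that the limit at infinity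
  is pointwise. \<open>\<tau>\<close> is the interior normal trace of \<open>\<epsilon>(\<phi>)\<close>.\<close>

definition droplet_solution ::
    "real \<Rightarrow> real \<Rightarrow> real^'n \<Rightarrow> real \<Rightarrow> (real^'n \<Rightarrow> real^'n) \<Rightarrow>
     (real^'n \<Rightarrow> real^'n) \<Rightarrow> (real^'n \<Rightarrow> real) \<Rightarrow> bool" where
  "droplet_solution \<mu>\<^sub>F \<mu>\<^sub>i a \<rho> \<phi> v q \<longleftrightarrow>
     (let B = ball a \<rho>; S = sphere a \<rho>; Ext = - cball a \<rho>; U = - S;
          \<mu> = (\<lambda>x. \<mu>\<^sub>F + (\<mu>\<^sub>i - \<mu>\<^sub>F) * indicator B x) in
      v \<in> H1_bdd U \<and> q \<in> L2_bdd UNIV \<and> continuous_on Ext v \<and>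
      (\<forall>\<psi> \<in> test_functions B.
         - div_dist B (stress U (\<lambda>x. \<mu>\<^sub>i) v q) \<psi> = 2 * (\<mu>\<^sub>i - \<mu>\<^sub>F) * div_dist B (strain B \<phi>) \<psi>) \<and>
      (\<forall>\<psi> \<in> test_functions Ext. - div_dist Ext (stress U (\<lambda>x. \<mu>\<^sub>F) v q) \<psi> = 0) \<and>
      divergence_free U v \<and>
      trace_jump Ext B S v (\<lambda>x. 0) \<and>
      (\<exists>\<tau>. has_normal_trace B S (strain B \<phi>) \<tau> \<and>
           normal_jump Ext B S (stress U \<mu> v q) (\<lambda>\<psi>. - 2 * (\<mu>\<^sub>F - \<mu>\<^sub>i) * \<tau> \<psi>)) \<and>
      (v \<longlongrightarrow> 0) at_infinity)"

text \<open>A run of the alternating correction algorithm. Indices of corrections are shifted to be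
  natural numbers:
  \<open>V k i\<close>, \<open>Q k i\<close> stand for \<open>v\<close>, \<open>q\<close> with index \<open>k-1, i\<close>;
  \<open>W k\<close>, \<open>S k\<close> stand for \<open>v\<close>, \<open>q\<close> with index \<open>k-1/2\<close>,
  where \<open>S 0\<close> is the initial pressure before the surface tension update; \<open>us j\<close>, \<open>ps j\<close> are the
  approximations \<open>u\<^sub>j\<close>, \<open>p\<^sub>j\<close>, with \<open>ps 0\<close> the updated pressure.\<close>

definition alternating_correction ::
    "(real^'n) set \<Rightarrow> (real^'n) set \<Rightarrow> (real^'n) set \<Rightarrow> nat \<Rightarrow> (nat \<Rightarrow> real^'n) \<Rightarrow> (nat \<Rightarrow> real) \<Rightarrow>
     (real^'n \<Rightarrow> real) \<Rightarrow> real \<Rightarrow> (nat \<Rightarrow> real) \<Rightarrow> (nat \<Rightarrow> real) \<Rightarrow>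
     ((real^'n \<Rightarrow> real^'n) \<Rightarrow> real) \<Rightarrow> (real^'n \<Rightarrow> real^'n) \<Rightarrow> ((real^'n \<Rightarrow> real^'n) \<Rightarrow> real) \<Rightarrow>
     (nat \<Rightarrow> nat \<Rightarrow> real^'n \<Rightarrow> real^'n) \<Rightarrow> (nat \<Rightarrow> nat \<Rightarrow> real^'n \<Rightarrow> real) \<Rightarrow>
     (nat \<Rightarrow> real^'n \<Rightarrow> real^'n) \<Rightarrow> (nat \<Rightarrow> real^'n \<Rightarrow> real) \<Rightarrow>
     (nat \<Rightarrow> real^'n \<Rightarrow> real^'n) \<Rightarrow> (nat \<Rightarrow> real^'n \<Rightarrow> real) \<Rightarrow> bool" where
  "alternating_correction \<Omega> \<Gamma>\<^sub>D \<Gamma>\<^sub>N M c r \<mu> \<mu>\<^sub>F \<mu>\<^sub>B \<gamma> f g\<^sub>D g\<^sub>N V Q W S us ps \<longleftrightarrow>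
     (let U = droplets M c r \<union> fluid \<Omega> M c r;
          Vsum = (\<lambda>k x. \<Sum>i=1..M. V k i x);
          Qsum = (\<lambda>k x. \<Sum>i=1..M. Q k i x) in
      boundary_solution \<Omega> \<Gamma>\<^sub>D \<Gamma>\<^sub>N \<mu>\<^sub>F f g\<^sub>D g\<^sub>N (W 0) (S 0) \<and>
      us 0 = W 0 \<and>
      ps 0 = (\<lambda>x. S 0 x + (\<Sum>i=1..M. \<gamma> i / r i * indicator (ball (c i) (r i)) x)) \<and>
      (\<forall>i\<in>{1..M}. V 0 i = (\<lambda>x. 0)) \<and>
      (\<forall>j.
        (\<forall>i\<in>{1..M}.
           droplet_solution \<mu>\<^sub>F (\<mu>\<^sub>B i) (c i) (r i) (\<lambda>x. Vsum j x + W j x - V j i x)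
             (V (Suc j) i) (Q (Suc j) i)) \<and>
        (\<exists>b t. has_trace \<Omega> \<Gamma>\<^sub>D (Vsum (Suc j)) b \<and>
           has_normal_trace \<Omega> \<Gamma>\<^sub>N (stress U \<mu> (Vsum (Suc j)) (Qsum (Suc j))) t \<and>
           boundary_solution \<Omega> \<Gamma>\<^sub>D \<Gamma>\<^sub>N \<mu>\<^sub>F (\<lambda>\<psi>. 0) (\<lambda>x. - b x) (\<lambda>\<psi>. - t \<psi>)
             (W (Suc j)) (S (Suc j))) \<and>
        us (Suc j) = (\<lambda>x. us j x + Vsum (Suc j) x + W (Suc j) x) \<and>
        ps (Suc j) = (\<lambda>x. ps j x + Qsum (Suc j) x + S (Suc j) x)))"

text \<open>With the same index shift, the field \<open>\<phi>\<close> with index \<open>j-1/2\<close>.\<close>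

definition phi_half ::
    "nat \<Rightarrow> (nat \<Rightarrow> real^'n) \<Rightarrow> (nat \<Rightarrow> real) \<Rightarrow> (nat \<Rightarrow> nat \<Rightarrow> real^'n \<Rightarrow> real^'n) \<Rightarrow>
     (nat \<Rightarrow> real^'n \<Rightarrow> real^'n) \<Rightarrow> nat \<Rightarrow> real^'n \<Rightarrow> real^'n" where
  "phi_half M c r V W j x =
     (\<Sum>i=1..M. \<Sum>i'\<in>{1..M} - {i}. indicator (ball (c i) (r i)) x *\<^sub>R V j i' x) + W j x"

end

theory Submission
  imports Defs
begin

text \<open>
  All the problems are linear, so the error is governed by how far the stress of each computed
  field, taken with the true viscosity \<open>\<mu>\<close>, is from the stress for which its
  problem was solved. A flow \<open>w\<close> computed with the viscosity
  \<open>\<mu>\<^sub>F\<close> has the true stress \<open>\<sigma>(w, s; \<mu>\<^sub>F) + 2 (\<mu>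
  - \<mu>\<^sub>F) \<epsilon>(w)\<close>: it is off by an excess stress inside the droplets. The
  flow computed for one droplet has the right stress in that droplet and an excess stress in all
  the others. Adding up, the field \<open>\<phi>\<close> with index \<open>j - 1/2\<close>
  (\<open>phi_half\<close>) collects in each droplet exactly those parts of the latest correction
  that were computed with the wrong viscosity there, and the true stress of the correction is the
  sum of the stresses of the solved problems and of the excess stress \<open>2 (\<mu> -
  \<mu>\<^sub>F) \<epsilon>(\<phi>)\<close> (\<open>stress_decomposition\<close>).

  The droplet problems, on the other hand, are driven by the excess stress of the previous
  \<open>\<phi>\<close>, in the droplet and in the jump on its boundary, and the boundary problem
  has no sources and restores the homogeneous boundary data. Hence a correction solves the
  interface problem whose data are the excess stress of the previous \<open>\<phi>\<close> minus
  that of the next one (\<open>correction_step\<close>). Subtracting it from the error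
  (\<open>interface_solution_diff\<close>) replaces the previous \<open>\<phi>\<close> by the next
  one, which is the induction step. The induction starts from
  \<open>initial_approximation\<close>: the boundary solution sees neither the viscosity contrast
  nor the surface tension; the former is the excess stress of the first \<open>\<phi>\<close>, and
  the latter is carried by the piecewise constant pressure update. That its normal jump is the
  surface tension functional is the divergence theorem on a ball
  (\<open>divergence_theorem_ball\<close>), with surface measure given by cones.

  Two points need care. The weak gradient is an arbitrary choice, so all identities between
  strains hold almost everywhere only; they rest on the uniqueness of weak gradients and thus on
  the fundamental lemma of the calculus of variations. And normal traces of strains on the
  interfaces are given only for \<open>\<phi>\<close>, by the droplet problem of the following
  step, but not for the single flows that \<open>\<phi>\<close> consists of. The excess stress is
  therefore never split into its summands.
\<close>

section \<open>Smooth functions\<close>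

lemma C_k_SucI:
  assumes "\<And>x. (f has_derivative D x) (at x)" "\<And>v. C_k k (\<lambda>x. D x v)"
  shows "C_k (Suc k) f"
proof -
  have "frechet_derivative f (at x) = D x" for x
    using frechet_derivative_at[OF assms(1)[of x]] by simp
  then show ?thesis
    using assms by (auto simp: differentiable_def)
qed

lemma C_k_Suc_imp: "C_k (Suc k) f \<Longrightarrow> C_k k f"
proof (induction k arbitrary: f)
  case 0
  then show ?case
    by (auto simp: continuous_on_eq_continuous_within intro!: differentiable_imp_continuous_within)
next
  case (Suc k)
  then show ?case by simp
qed

lemma C_k_const: "C_k k (\<lambda>x. a)"
proof (induction k arbitrary: a)
  case 0
  then show ?case by simp
next
  case (Suc k)
  show ?case
    by (rule C_k_SucI[where D = "\<lambda>x v. 0"]) (auto intro: Suc)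
qed

lemma has_frechet_derivative:
  "f differentiable (at x) \<Longrightarrow> (f has_derivative frechet_derivative f (at x)) (at x)"
  using frechet_derivative_works by blast

lemma C_k_lincomb:
  "C_k k f \<Longrightarrow> C_k k g \<Longrightarrow> C_k k (\<lambda>x. a *\<^sub>R f x + b *\<^sub>R g x)"
proof (induction k arbitrary: f g)
  case 0
  then show ?case by (auto intro!: continuous_intros)
next
  case (Suc k)
  show ?case
  proof (rule C_k_SucI)
    fix x
    show "((\<lambda>x. a *\<^sub>R f x + b *\<^sub>R g x) has_derivative
        (\<lambda>v. a *\<^sub>R frechet_derivative f (at x) v + b *\<^sub>R frechet_derivative g (at x) v)) (at x)"
      using Suc.prems by (intro derivative_intros has_frechet_derivative) auto
  qed (use Suc in auto)
qed

lemma C_k_mult: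
  fixes f g :: "'a::real_normed_vector \<Rightarrow> real"
  shows "C_k k f \<Longrightarrow> C_k k g \<Longrightarrow> C_k k (\<lambda>x. f x * g x)"
proof (induction k arbitrary: f g)
  case 0
  then show ?case by (auto intro!: continuous_intros)
next
  case (Suc k)
  note low = C_k_Suc_imp[OF Suc.prems(1)] C_k_Suc_imp[OF Suc.prems(2)]
  show ?case
  proof (rule C_k_SucI)
    fix x
    show "((\<lambda>x. f x * g x) has_derivative
        (\<lambda>v. f x * frechet_derivative g (at x) v + frechet_derivative f (at x) v * g x)) (at x)"
      using Suc.prems by (intro derivative_intros has_frechet_derivative) auto
  next
    fix v
    have "C_k k (\<lambda>x. 1 *\<^sub>R (f x * frechet_derivative g (at x) v)
        + 1 *\<^sub>R (frechet_derivative f (at x) v * g x))"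
      using Suc low by (intro C_k_lincomb) auto
    then show "C_k k (\<lambda>x. f x * frechet_derivative g (at x) v + frechet_derivative f (at x) v * g x)"
      by simp
  qed
qed

lemma C_k_prod:
  fixes f :: "'i \<Rightarrow> 'a::real_normed_vector \<Rightarrow> real"
  assumes "finite I" "\<And>i. i \<in> I \<Longrightarrow> C_k k (f i)"
  shows "C_k k (\<lambda>x. \<Prod>i\<in>I. f i x)"
  using assms by (induction I) (auto intro: C_k_const C_k_mult)

text \<open>For \<open>m = 0\<close> this is the classical smooth function that is flat at 0. The
  derivatives of one member are combinations of others, so smoothness of the whole family follows
  by one induction.\<close>

definition flat_exp :: "nat \<Rightarrow> real \<Rightarrow> real" where
  "flat_exp m t = (if t > 0 then (1 / t) ^ m * exp (- (1 / t)) else 0)"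

lemma flat_exp_tendsto_0: "(flat_exp m \<longlongrightarrow> 0) (at 0)"
proof -
  have "((\<lambda>y::real. y ^ m / exp y) \<longlongrightarrow> 0) at_top"
    by (rule tendsto_power_div_exp_0)
  moreover have "filterlim (\<lambda>t::real. inverse t) at_top (at_right 0)"
    by (rule filterlim_inverse_at_top_right)
  ultimately have "((\<lambda>t::real. inverse t ^ m / exp (inverse t)) \<longlongrightarrow> 0) (at_right 0)"
    by (rule filterlim_compose)
  moreover have "\<forall>\<^sub>F t in at_right (0::real). inverse t ^ m / exp (inverse t) = flat_exp m t"
    by (auto simp: eventually_at_right_field flat_exp_def exp_minus field_simps intro!: exI[of _ 1])
  ultimately have r: "(flat_exp m \<longlongrightarrow> 0) (at_right 0)"
    by (blast intro: Lim_transform_eventually)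
  have "\<forall>\<^sub>F t in at_left (0::real). 0 = flat_exp m t"
    by (auto simp: eventually_at_left_field flat_exp_def intro!: exI[of _ "-1"])
  then have l: "(flat_exp m \<longlongrightarrow> 0) (at_left 0)"
    by (blast intro: Lim_transform_eventually tendsto_const)
  show ?thesis using filterlim_split_at[OF l r] .
qed

lemma flat_exp_deriv:
  "(flat_exp m has_real_derivative flat_exp (m + 2) t - m * flat_exp (m + 1) t) (at t)"
proof (cases "t = 0")
  case False
  show ?thesis
  proof (cases "t > 0")
    case True
    have "((\<lambda>y. y ^ m * exp (- y)) has_real_derivative
        m * y ^ (m - 1) * exp (- y) - y ^ m * exp (- y)) (at y)" for y :: real
      by (auto intro!: derivative_eq_intros)
    moreover have "((\<lambda>t. 1 / t) has_real_derivative - ((1 / t) * (1 / t))) (at t)"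
      using True by (auto intro!: derivative_eq_intros simp: power2_eq_square)
    ultimately have "((\<lambda>t. (1 / t) ^ m * exp (- (1 / t))) has_real_derivative
        (m * (1 / t) ^ (m - 1) * exp (- (1 / t)) - (1 / t) ^ m * exp (- (1 / t)))
          * (- ((1 / t) * (1 / t)))) (at t)"
      by (rule DERIV_chain2)
    moreover have "(m * (1 / t) ^ (m - 1) * exp (- (1 / t)) - (1 / t) ^ m * exp (- (1 / t)))
          * (- ((1 / t) * (1 / t))) = flat_exp (m + 2) t - m * flat_exp (m + 1) t"
      using True by (cases m) (simp_all add: flat_exp_def algebra_simps add_divide_distrib)
    ultimately have "((\<lambda>t. (1 / t) ^ m * exp (- (1 / t))) has_real_derivative
        flat_exp (m + 2) t - m * flat_exp (m + 1) t) (at t)"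
      by simp
    then show ?thesis
      by (rule has_field_derivative_transform_within_open[where S = "{0<..}"])
        (use True in \<open>auto simp: flat_exp_def\<close>)
  next
    case nt: False
    have "((\<lambda>t. 0) has_real_derivative flat_exp (m + 2) t - m * flat_exp (m + 1) t) (at t)"
      using nt by (auto simp: flat_exp_def)
    then show ?thesis
      by (rule has_field_derivative_transform_within_open[where S = "{..<0}"])
        (use nt False in \<open>auto simp: flat_exp_def\<close>)
  qed
next
  case True
  have "(\<lambda>h. (flat_exp m (0 + h) - flat_exp m 0) / h) = flat_exp (m + 1)"
    by (auto simp: flat_exp_def fun_eq_iff field_simps)
  then have "(flat_exp m has_real_derivative 0) (at 0)"
    unfolding DERIV_def using flat_exp_tendsto_0 by simp
  then show ?thesis using True by (simp add: flat_exp_def)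
qed

lemma C_k_flat_exp_affine:
  fixes l :: "'a::real_normed_vector \<Rightarrow> real"
  assumes "bounded_linear l"
  shows "C_k k (\<lambda>x. flat_exp m (l x + b))"
proof (induction k arbitrary: m)
  have deriv: "((\<lambda>x. flat_exp m (l x + b)) has_derivative
      (\<lambda>v. (flat_exp (m + 2) (l x + b) - m * flat_exp (m + 1) (l x + b)) * l v)) (at x)" for x m
    by (rule has_derivative_eq_rhs[OF has_derivative_compose[OF _ flat_exp_deriv[unfolded has_field_derivative_def]]])
      (auto intro!: derivative_eq_intros bounded_linear_imp_has_derivative[OF assms])
  {
    case 0
    show ?case
      using deriv[THEN has_derivative_continuous]
      by (auto simp: continuous_on_eq_continuous_within)
  next
    case (Suc k)
    show ?case
    proof (rule C_k_SucI[OF deriv])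
      fix v
      show "C_k k (\<lambda>x. (flat_exp (m + 2) (l x + b) - m * flat_exp (m + 1) (l x + b)) * l v)"
        using C_k_lincomb[OF Suc[of "m + 2"] Suc[of "m + 1"], of "l v" "- m * l v"]
        by (simp add: algebra_simps)
    qed
  }
qed

text \<open>Cutting off along a set whose frontier avoids the support does not destroy smoothness,
  because the product is locally either \<open>f\<close> or 0. This separates test functions on
  \<open>\<Omega>\<^sub>B \<union> \<Omega>\<^sub>F\<close> into their parts in the single
  droplets and outside.\<close>

lemma indicator_locally_constant:
  fixes f :: "'a::real_normed_vector \<Rightarrow> 'b::real_normed_vector"
  assumes "closure {x. f x \<noteq> 0} \<inter> frontier A = {}"
  obtains N where "open N" "x \<in> N" "\<And>y. y \<in> N \<Longrightarrow> indicator A y *\<^sub>R f y = indicator A x *\<^sub>R f y"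
proof -
  define K where "K = closure {x. f x \<noteq> 0}"
  have f0: "f y = 0" if "y \<notin> K" for y
    using that subsetD[OF closure_subset, of y "{x. f x \<noteq> 0}"] unfolding K_def by auto
  have "closed K"
    by (simp add: K_def)
  consider "x \<in> - K" | "x \<in> interior A" | "x \<in> - closure A"
    using assms unfolding frontier_def K_def by blast
  then show thesis
  proof cases
    case 1
    then show thesis
      using \<open>closed K\<close> by (intro that[of "- K"]) (auto simp: f0)
  next
    case 2
    then show thesis
      using interior_subset by (intro that[of "interior A"]) (auto simp: indicator_def)
  next
    case 3
    then show thesis
      using closure_subset by (intro that[of "- closure A"]) (auto simp: indicator_def)
  qed
qed

lemma has_derivative_indicator_scaleR:
  fixes f :: "'a::real_normed_vector \<Rightarrow> 'b::real_normed_vector"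
  assumes supp: "closure {x. f x \<noteq> 0} \<inter> frontier A = {}"
    and "(f has_derivative f') (at x)"
  shows "((\<lambda>y. indicator A y *\<^sub>R f y) has_derivative (\<lambda>v. indicator A x *\<^sub>R f' v)) (at x)"
proof -
  obtain N where N: "open N" "x \<in> N" "\<And>y. y \<in> N \<Longrightarrow> indicator A y *\<^sub>R f y = indicator A x *\<^sub>R f y"
    using indicator_locally_constant[OF supp, of x] by blast
  have "((\<lambda>y. indicator A x *\<^sub>R f y) has_derivative (\<lambda>v. indicator A x *\<^sub>R f' v)) (at x)"
    using assms by (intro derivative_intros)
  then show ?thesis
    by (rule has_derivative_transform_within_open[OF _ N(1,2)]) (simp add: N(3))
qed

lemma derivative_outside_support:
  fixes f :: "'a::real_normed_vector \<Rightarrow> 'b::real_normed_vector"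
  assumes "x \<notin> closure {x. f x \<noteq> 0}"
  shows "frechet_derivative f (at x) v = 0"
proof -
  define K where "K = closure {x. f x \<noteq> 0}"
  have f0: "f y = 0" if "y \<notin> K" for y
    using that subsetD[OF closure_subset, of y "{x. f x \<noteq> 0}"] unfolding K_def by auto
  have "(f has_derivative (\<lambda>v. 0)) (at x)"
    using assms
    by (intro has_derivative_transform_within_open[OF has_derivative_const, of "- K" x 0])
      (auto simp: f0, auto simp: K_def)
  then show ?thesis using frechet_derivative_at by metis
qed

lemma closure_support_derivative:
  fixes f :: "'a::real_normed_vector \<Rightarrow> 'b::real_normed_vector"
  shows "closure {x. frechet_derivative f (at x) v \<noteq> 0} \<subseteq> closure {x. f x \<noteq> 0}"
  using derivative_outside_support by (intro closure_minimal) auto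

lemma C_k_indicator_scaleR:
  fixes f :: "'a::real_normed_vector \<Rightarrow> 'b::real_normed_vector"
  shows "C_k k f \<Longrightarrow> closure {x. f x \<noteq> 0} \<inter> frontier A = {} \<Longrightarrow> C_k k (\<lambda>x. indicator A x *\<^sub>R f x)"
proof (induction k arbitrary: f)
  case 0
  have "isCont (\<lambda>x. indicator A x *\<^sub>R f x) x" for x
  proof -
    obtain N where N: "open N" "x \<in> N" "\<And>y. y \<in> N \<Longrightarrow> indicator A y *\<^sub>R f y = indicator A x *\<^sub>R f y"
      using indicator_locally_constant[OF 0(2), of x] by blast
    have "isCont (\<lambda>y. indicator A x *\<^sub>R f y) x"
      using 0 by (auto simp: continuous_on_eq_continuous_at intro!: continuous_intros)
    then show ?thesis
      using N isCont_cong[of "\<lambda>y. indicator A y *\<^sub>R f y" "\<lambda>y. indicator A x *\<^sub>R f y" x]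
      unfolding eventually_nhds by blast
  qed
  then show ?case by (simp add: continuous_on_eq_continuous_within)
next
  case (Suc k)
  show ?case
  proof (rule C_k_SucI)
    fix x
    show "((\<lambda>x. indicator A x *\<^sub>R f x) has_derivative
        (\<lambda>v. indicator A x *\<^sub>R frechet_derivative f (at x) v)) (at x)"
      using Suc.prems by (intro has_derivative_indicator_scaleR has_frechet_derivative) auto
  next
    fix v
    show "C_k k (\<lambda>x. indicator A x *\<^sub>R frechet_derivative f (at x) v)"
      using Suc closure_support_derivative[of f v] by (intro Suc.IH) auto
  qed
qed

section \<open>Test functions\<close>

lemma test_functions_mono: "A \<subseteq> B \<Longrightarrow> test_functions A \<subseteq> test_functions B"
  by (auto simp: test_functions_def)

lemma test_functions_differentiable: "\<psi> \<in> test_functions A \<Longrightarrow> \<psi> differentiable (at x)"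
  unfolding test_functions_def smooth_def by (auto dest: spec[of _ "Suc 0"])

lemma test_functions_continuous: "\<psi> \<in> test_functions A \<Longrightarrow> continuous_on UNIV \<psi>"
  unfolding test_functions_def smooth_def by (auto dest: spec[of _ 0])

lemma test_functions_derivative_continuous:
  "\<psi> \<in> test_functions A \<Longrightarrow> continuous_on UNIV (\<lambda>x. frechet_derivative \<psi> (at x) v)"
  unfolding test_functions_def smooth_def by (auto dest: spec[of _ "Suc 0"])

lemma test_functions_support:
  assumes "\<psi> \<in> test_functions A"
  obtains K where "compact K" "K \<subseteq> A" "\<And>x. x \<notin> K \<Longrightarrow> \<psi> x = 0"
    "\<And>x. x \<notin> K \<Longrightarrow> frechet_derivative \<psi> (at x) = (\<lambda>v. 0)"
proof -
  define K where "K = closure {x. \<psi> x \<noteq> 0}"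
  have f0: "\<psi> x = 0" if "x \<notin> K" for x
    using that subsetD[OF closure_subset, of x "{x. \<psi> x \<noteq> 0}"] unfolding K_def by auto
  have d0: "frechet_derivative \<psi> (at x) = (\<lambda>v. 0)" if "x \<notin> K" for x
    using that derivative_outside_support[of x \<psi>] unfolding K_def by (intro ext) metis
  have "compact K" "K \<subseteq> A"
    using assms unfolding test_functions_def K_def by blast+
  then show thesis
    using f0 d0 by (rule that)
qed

lemma test_functions_indicator:
  assumes \<psi>: "\<psi> \<in> test_functions U" and A: "U \<inter> frontier A = {}"
  shows "(\<lambda>x. indicator A x *\<^sub>R \<psi> x) \<in> test_functions (U \<inter> A)"
proof -
  let ?K = "closure {x. \<psi> x \<noteq> 0}" and ?K' = "closure {x. indicator A x *\<^sub>R \<psi> x \<noteq> 0}"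
  have K: "compact ?K" "?K \<subseteq> U" and sm: "smooth \<psi>"
    using \<psi> by (auto simp: test_functions_def)
  have K': "?K' \<subseteq> ?K" "?K' \<subseteq> closure A"
    by (auto intro!: closure_mono simp: indicator_def)
  have "?K \<inter> ?K' = ?K'"
    using K'(1) by (rule Int_absorb1)
  moreover have "compact (?K \<inter> ?K')"
    by (intro compact_Int_closed K(1) closed_closure)
  ultimately have "compact ?K'"
    by (simp only:)
  moreover have "?K' \<subseteq> U \<inter> A"
  proof
    fix x assume "x \<in> ?K'"
    then have "x \<in> U" "x \<in> closure A" using K(2) K' by blast+
    moreover have "x \<notin> frontier A" using \<open>x \<in> U\<close> A by blast
    ultimately show "x \<in> U \<inter> A"
      using interior_subset[of A] unfolding frontier_def by blast
  qed
  moreover have "smooth (\<lambda>x. indicator A x *\<^sub>R \<psi> x)"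
    unfolding smooth_def
  proof (intro allI C_k_indicator_scaleR)
    show "C_k k \<psi>" for k using sm by (simp add: smooth_def)
    show "?K \<inter> frontier A = {}" using K(2) A by blast
  qed
  ultimately show ?thesis by (auto simp: test_functions_def)
qed

lemma frechet_derivative_indicator:
  assumes \<psi>: "\<psi> \<in> test_functions U" and A: "U \<inter> frontier A = {}"
  shows "frechet_derivative (\<lambda>x. indicator A x *\<^sub>R \<psi> x) (at x) =
    (\<lambda>v. indicator A x *\<^sub>R frechet_derivative \<psi> (at x) v)"
proof (rule frechet_derivative_at[symmetric], rule has_derivative_indicator_scaleR)
  show "closure {x. \<psi> x \<noteq> 0} \<inter> frontier A = {}"
    using \<psi> A by (auto simp: test_functions_def)
qed (rule has_frechet_derivative[OF test_functions_differentiable[OF \<psi>]])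

lemma grad_component: "grad \<psi> x $ i $ j = frechet_derivative \<psi> (at x) (axis j 1) $ i"
  by (simp add: jacobian_def matrix_def)

lemma grad_indicator:
  assumes \<psi>: "\<psi> \<in> test_functions U" and A: "U \<inter> frontier A = {}"
  shows "grad (\<lambda>x. indicator A x *\<^sub>R \<psi> x) x = indicator A x *\<^sub>R grad \<psi> x"
  by (simp add: vec_eq_iff grad_component frechet_derivative_indicator[OF assms])

lemma grad_continuous:
  assumes "\<psi> \<in> test_functions U"
  shows "continuous_on UNIV (grad \<psi>)"
proof -
  have "continuous_on UNIV (\<lambda>x. \<chi> i j. frechet_derivative \<psi> (at x) (axis j 1) $ i)"
    by (intro continuous_intros test_functions_derivative_continuous[OF assms])
  then show ?thesis
    by (simp add: jacobian_def matrix_def)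
qed

lemma grad_support:
  assumes "\<psi> \<in> test_functions A"
  obtains K where "compact K" "K \<subseteq> A" "\<And>x. x \<notin> K \<Longrightarrow> \<psi> x = 0" "\<And>x. x \<notin> K \<Longrightarrow> grad \<psi> x = 0"
proof -
  obtain K where K: "compact K" "K \<subseteq> A" "\<And>x. x \<notin> K \<Longrightarrow> \<psi> x = 0"
    "\<And>x. x \<notin> K \<Longrightarrow> frechet_derivative \<psi> (at x) = (\<lambda>v. 0)"
    using test_functions_support[OF assms] by blast
  show thesis
    using K by (intro that[of K]) (auto simp: vec_eq_iff grad_component)
qed

section \<open>Integration on subsets\<close>

text \<open>Completeness of Lebesgue measure.\<close>

lemma borel_measurable_lebesgue_on_cong_AE:
  fixes f g :: "'a::euclidean_space \<Rightarrow> 'b::euclidean_space"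
  assumes U: "U \<in> sets lebesgue" and f: "f \<in> borel_measurable (lebesgue_on U)"
    and AE: "AE x in lebesgue_on U. f x = g x"
  shows "g \<in> borel_measurable (lebesgue_on U)"
proof -
  let ?f = "\<lambda>x. indicator U x *\<^sub>R f x" and ?g = "\<lambda>x. indicator U x *\<^sub>R g x"
  have f': "?f \<in> borel_measurable lebesgue"
    using f U by (subst (asm) borel_measurable_restrict_space_iff) auto
  have AE': "AE x in lebesgue. ?f x = ?g x"
    using AE U by (subst (asm) AE_restrict_space_iff) (auto simp: indicator_def)
  have "?g \<in> borel_measurable lebesgue"
  proof (rule measurableI)
    fix A :: "'b set" assume A: "A \<in> sets borel"
    have meas: "?f -` A \<inter> space lebesgue \<in> sets lebesgue"
      by (rule measurable_sets[OF f' A])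
    have "AE x in lebesgue. x \<in> ?f -` A \<inter> space lebesgue \<longleftrightarrow> x \<in> ?g -` A \<inter> space lebesgue"
      using AE' by eventually_elim (simp only: vimage_eq Int_iff)
    then show "?g -` A \<inter> space lebesgue \<in> sets lebesgue"
      by (rule completion.in_sets_AE[OF _ meas]) simp
  qed simp
  then show ?thesis
    using U by (subst borel_measurable_restrict_space_iff) auto
qed

lemma AE_lebesgue_on_subset:
  assumes "AE x in lebesgue_on U. P x" "V \<subseteq> U" "U \<in> sets lebesgue" "V \<in> sets lebesgue"
  shows "AE x in lebesgue_on V. P x"
proof -
  have "AE x in lebesgue. x \<in> U \<longrightarrow> P x"
    using assms by (subst (asm) AE_restrict_space_iff) auto
  then have "AE x in lebesgue. x \<in> V \<longrightarrow> P x"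
    by eventually_elim (use assms in auto)
  then show ?thesis
    using assms by (subst AE_restrict_space_iff) auto
qed

lemma integrable_lebesgue_on_subset:
  fixes f :: "'a::euclidean_space \<Rightarrow> 'b::euclidean_space"
  assumes "integrable (lebesgue_on U) f" "V \<subseteq> U" "U \<in> sets lebesgue" "V \<in> sets lebesgue"
  shows "integrable (lebesgue_on V) f"
proof -
  have "integrable lebesgue (\<lambda>x. indicator V x *\<^sub>R (indicator U x *\<^sub>R f x))"
    using assms by (intro integrable_mult_indicator[of V]) (simp_all add: integrable_restrict_space)
  also have "(\<lambda>x. indicator V x *\<^sub>R (indicator U x *\<^sub>R f x)) = (\<lambda>x. indicator V x *\<^sub>R f x)"
    using assms(2) by (auto simp: indicator_def fun_eq_iff)
  finally show ?thesis
    using assms by (simp add: integrable_restrict_space)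
qed

lemma integral_lebesgue_on_subset:
  fixes f :: "'a::euclidean_space \<Rightarrow> 'b::euclidean_space"
  assumes "U \<in> sets lebesgue" "V \<in> sets lebesgue" "V \<subseteq> U" "\<And>x. x \<in> U - V \<Longrightarrow> f x = 0"
  shows "(\<integral>x. f x \<partial>lebesgue_on V) = (\<integral>x. f x \<partial>lebesgue_on U)"
proof -
  have "(\<lambda>x. indicator V x *\<^sub>R f x) = (\<lambda>x. indicator U x *\<^sub>R f x)"
    using assms(3,4) by (auto simp: indicator_def fun_eq_iff)
  then show ?thesis
    using assms(1,2) by (simp add: integral_restrict_space)
qed

lemma integral_lebesgue_on_indicator:
  fixes f :: "'a::euclidean_space \<Rightarrow> 'b::euclidean_space"
  assumes "U \<in> sets lebesgue" "A \<in> sets lebesgue"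
  shows "(\<integral>x. indicator A x *\<^sub>R f x \<partial>lebesgue_on U) = (\<integral>x. f x \<partial>lebesgue_on (U \<inter> A))"
proof -
  have "(\<lambda>x. indicator U x *\<^sub>R indicator A x *\<^sub>R f x) = (\<lambda>x. indicator (U \<inter> A) x *\<^sub>R f x)"
    by (auto simp: indicator_def fun_eq_iff)
  then show ?thesis
    using assms by (simp add: integral_restrict_space del: scaleR_scaleR)
qed

lemma integrable_times_compact_support:
  fixes g :: "'a::euclidean_space \<Rightarrow> 'b::euclidean_space" and h :: "'a \<Rightarrow> 'c::euclidean_space"
    and prod :: "'b \<Rightarrow> 'c \<Rightarrow> 'd::euclidean_space" (infixl "\<star>" 70)
  assumes prod: "bounded_bilinear prod"
    and U: "U \<in> sets lebesgue" and K: "compact K" "K \<subseteq> U"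
    and g: "integrable (lebesgue_on K) g"
    and h: "continuous_on UNIV h" "\<And>x. x \<notin> K \<Longrightarrow> h x = 0"
  shows "integrable (lebesgue_on U) (\<lambda>x. g x \<star> h x)"
proof -
  interpret bounded_bilinear "prod" by (rule prod)
  have K': "K \<in> sets lebesgue"
    using K by (simp add: borel_compact)
  obtain B where B: "\<And>x. x \<in> K \<Longrightarrow> norm (h x) \<le> B" "B > 0"
    using compact_imp_bounded[OF compact_continuous_image[OF continuous_on_subset[OF h(1)] K(1)]]
    unfolding bounded_pos by auto
  obtain C where C: "\<And>a b. norm (a \<star> b) \<le> norm a * norm b * C" "C > 0"
    using pos_bounded by blast
  have [measurable]: "h \<in> borel_measurable (lebesgue_on K)" "g \<in> borel_measurable (lebesgue_on K)"
    using h(1) K' g by (auto intro: continuous_imp_measurable_on_sets_lebesgue continuous_on_subset)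
  have "integrable (lebesgue_on K) (\<lambda>x. g x \<star> h x)"
  proof (rule Bochner_Integration.integrable_bound)
    show "integrable (lebesgue_on K) (\<lambda>x. (B * C) *\<^sub>R g x)"
      using g by simp
    show "(\<lambda>x. g x \<star> h x) \<in> borel_measurable (lebesgue_on K)"
      by (intro borel_measurable_continuous_Pair[of g _ h, where H = "prod"] continuous_on
          continuous_on_fst continuous_on_snd continuous_on_id) measurable
    show "AE x in lebesgue_on K. norm (g x \<star> h x) \<le> norm ((B * C) *\<^sub>R g x)"
    proof (intro AE_I2)
      fix x assume "x \<in> space (lebesgue_on K)"
      then have "norm (h x) \<le> B" using B by simp
      have "norm (g x \<star> h x) \<le> norm (g x) * norm (h x) * C" by (rule C)
      also have "\<dots> \<le> norm (g x) * B * C"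
        using \<open>norm (h x) \<le> B\<close> C by (intro mult_right_mono mult_left_mono) auto
      finally show "norm (g x \<star> h x) \<le> norm ((B * C) *\<^sub>R g x)"
        using B C by (simp add: abs_mult mult_ac)
    qed
  qed
  then have "integrable lebesgue (\<lambda>x. indicator K x *\<^sub>R (g x \<star> h x))"
    using K' by (simp add: integrable_restrict_space)
  also have "(\<lambda>x. indicator K x *\<^sub>R (g x \<star> h x)) = (\<lambda>x. indicator U x *\<^sub>R (g x \<star> h x))"
    using K(2) h(2) by (auto simp: indicator_def fun_eq_iff) (metis zero_right)
  finally show ?thesis
    using U by (simp add: integrable_restrict_space)
qed

section \<open>The fundamental lemma of the calculus of variations\<close>

text \<open>Boxes are stable under intersection and generate the Borel sets, so the vanishing of
  the integrals passes to all Borel sets, and by completion to all Lebesgue sets.\<close>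

lemma AE_zero_if_box_integrals_zero:
  fixes h :: "'a::euclidean_space \<Rightarrow> real"
  assumes h: "integrable lebesgue h"
    and box: "\<And>a b. (\<integral>x. indicator (box a b) x * h x \<partial>lebesgue) = 0"
  shows "AE x in lebesgue. h x = 0"
proof -
  let ?I = "\<lambda>A. \<integral>x. indicator A x * h x \<partial>lebesgue"
  have ih: "integrable lebesgue (\<lambda>x. indicator A x * h x)" if "A \<in> sets lebesgue" for A
    using integrable_mult_indicator[OF that h] by simp
  have whole: "integral\<^sup>L lebesgue h = 0"
  proof -
    let ?B = "\<lambda>i::nat. box (- (real i *\<^sub>R One)) (real i *\<^sub>R One) :: 'a set"
    have "(\<lambda>i. ?I (?B i)) \<longlonglongrightarrow> integral\<^sup>L lebesgue h"
    proof (rule integral_dominated_convergence)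
      show "integrable lebesgue (\<lambda>x. norm (h x))" using h by simp
      show "(\<lambda>x. indicator (?B i) x * h x) \<in> borel_measurable lebesgue" for i
        using ih[of "?B i"] by auto
      show "AE x in lebesgue. (\<lambda>i. indicator (?B i) x * h x) \<longlonglongrightarrow> h x"
      proof (intro AE_I2)
        fix x :: 'a
        obtain n where n: "x \<in> ?B n" using UN_box_eq_UNIV by blast
        have mem: "x \<in> ?B i \<longleftrightarrow> (\<forall>k\<in>Basis. - real i < x \<bullet> k \<and> x \<bullet> k < real i)" for i
          by (simp add: mem_box)
        have "x \<in> ?B i" if "i \<ge> n" for i
          using n that unfolding mem by (meson le_less_trans less_le_trans neg_le_iff_le of_nat_le_iff)
        then have "\<forall>\<^sub>F i in sequentially. h x = indicator (?B i) x * h x"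
          by (auto simp: eventually_sequentially intro!: exI[of _ n])
        then show "(\<lambda>i. indicator (?B i) x * h x) \<longlonglongrightarrow> h x"
          by (rule Lim_transform_eventually[rotated]) simp
      qed
    qed (use h in \<open>auto simp: indicator_def\<close>)
    then have "(\<lambda>i::nat. 0) \<longlonglongrightarrow> integral\<^sup>L lebesgue h"
      by (simp only: box)
    then show ?thesis
      using LIMSEQ_unique tendsto_const by blast
  qed
  have borel: "?I A = 0" if "A \<in> sets borel" for A
  proof -
    let ?G = "range (\<lambda>(a, b). box a b :: 'a set)"
    have sg: "sets borel = sigma_sets UNIV ?G"
      by (simp add: borel_eq_box)
    have "Int_stable ?G"
      by (auto simp: Int_stable_def box_Int_box)
    moreover have "?G \<subseteq> Pow UNIV" by simp
    moreover have "A \<in> sigma_sets UNIV ?G" using that sg by simp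
    ultimately show ?thesis
    proof (induction rule: sigma_sets_induct_disjoint)
      case (basic A)
      then show ?case using box by auto
    next
      case empty
      then show ?case by simp
    next
      case (compl A)
      then have A: "A \<in> sets lebesgue" using sg by auto
      have "?I (UNIV - A) = (\<integral>x. h x - indicator A x * h x \<partial>lebesgue)"
        by (intro Bochner_Integration.integral_cong) (auto simp: indicator_def)
      also have "\<dots> = 0"
        using compl h ih[OF A] whole by simp
      finally show ?case .
    next
      case (union A)
      then have "A i \<in> sets borel" for i using sg by blast
      then have A: "A i \<in> sets lebesgue" for i by auto
      have "(LINT x:(\<Union>i. A i)|lebesgue. h x) = (\<Sum>i. (LINT x:(A i)|lebesgue. h x))"
        using union(1) A ih
        by (intro lebesgue_integral_countable_add)
          (auto simp: disjoint_family_on_def set_integrable_def)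
      then show ?case using union(3) by (simp add: set_lebesgue_integral_def)
    qed
  qed
  have "AE x in lebesgue. h x = (\<lambda>x. 0) x"
  proof (rule density_unique_real[OF h])
    fix A :: "'a set" assume "A \<in> sets lebesgue"
    then obtain S N N' where A: "A = S \<union> N" "N \<subseteq> N'" "N' \<in> null_sets lborel" "S \<in> sets lborel"
      by (rule sets_completionE)
    have "AE x in lebesgue. x \<notin> N'"
      using A(3) by (intro AE_completion AE_not_in)
    then have "AE x in lebesgue. indicator A x * h x = indicator S x * h x"
      by eventually_elim (use A(1,2) in \<open>auto simp: indicator_def\<close>)
    then have "?I A = ?I S"
      using ih[of A] ih[of S] A(4) \<open>A \<in> sets lebesgue\<close>
      by (intro integral_cong_AE borel_measurable_integrable) auto
    then show "(LINT x:A|lebesgue. h x) = (LINT x:A|lebesgue. 0)"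
      using borel[of S] A(4) by (simp add: set_lebesgue_integral_def)
  qed simp
  then show ?thesis by simp
qed

text \<open>As \<open>n \<rightarrow> \<infinity>\<close>, these smooth functions increase to the
  indicator function of the box. Testing with them gives the integrals over boxes without any
  mollification.\<close>

definition box_bump :: "real^'n \<Rightarrow> real^'n \<Rightarrow> nat \<Rightarrow> real^'n \<Rightarrow> real" where
  "box_bump a b n x =
     (\<Prod>i\<in>UNIV. flat_exp 0 (n * (x $ i - a $ i)) * flat_exp 0 (n * (b $ i - x $ i)))"

lemma flat_exp_0_bounds: "0 \<le> flat_exp 0 t" "flat_exp 0 t \<le> 1"
  by (auto simp: flat_exp_def)

lemma box_bump_outside:
  fixes x :: "real^'n"
  assumes "x \<notin> box a b"
  shows "box_bump a b n x = 0"
proof -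
  obtain i where "x $ i - a $ i \<le> 0 \<or> b $ i - x $ i \<le> 0"
    using assms unfolding mem_box_cart by (metis diff_gt_0_iff_gt linorder_not_le)
  then have "flat_exp 0 (n * (x $ i - a $ i)) * flat_exp 0 (n * (b $ i - x $ i)) = 0"
    by (auto simp: flat_exp_def zero_less_mult_iff)
  then show ?thesis
    unfolding box_bump_def by (intro prod_zero) auto
qed

lemma box_bump_bounds: "\<bar>box_bump a b n x\<bar> \<le> 1"
proof -
  have "0 \<le> box_bump a b n x"
    unfolding box_bump_def by (intro prod_nonneg mult_nonneg_nonneg flat_exp_0_bounds)
  moreover have "box_bump a b n x \<le> 1"
    unfolding box_bump_def
    by (intro prod_le_1) (auto intro!: mult_le_one mult_nonneg_nonneg flat_exp_0_bounds)
  ultimately show ?thesis by simp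
qed

lemma flat_exp_0_tendsto_1:
  assumes "s > 0"
  shows "(\<lambda>n. flat_exp 0 (real n * s)) \<longlonglongrightarrow> 1"
proof -
  have "(\<lambda>n. exp (- (inverse (real n) * inverse s))) \<longlonglongrightarrow> exp (- (0 * inverse s))"
    by (intro tendsto_intros lim_inverse_n)
  moreover have "\<forall>\<^sub>F n in sequentially. exp (- (inverse (real n) * inverse s)) = flat_exp 0 (real n * s)"
    using assms by (auto simp: flat_exp_def eventually_sequentially field_simps intro!: exI[of _ 1])
  ultimately have "(\<lambda>n. flat_exp 0 (real n * s)) \<longlonglongrightarrow> exp (- (0 * inverse s))"
    by (rule Lim_transform_eventually)
  then show ?thesis by simp
qed

lemma box_bump_tendsto:
  fixes x :: "real^'n"
  shows "(\<lambda>n. box_bump a b n x) \<longlonglongrightarrow> indicator (box a b) x"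
proof (cases "x \<in> box a b")
  case True
  have "(\<lambda>n. box_bump a b n x) \<longlonglongrightarrow> (\<Prod>i\<in>(UNIV::'n set). 1 * 1)"
    unfolding box_bump_def using True
    by (intro tendsto_prod tendsto_mult flat_exp_0_tendsto_1) (auto simp: mem_box_cart)
  then show ?thesis using True by simp
next
  case False
  then show ?thesis by (simp add: box_bump_outside)
qed

lemma box_bump_test_function:
  fixes a b :: "real^'n"
  assumes "cbox a b \<subseteq> U"
  shows "box_bump a b n \<in> test_functions U"
proof -
  have "C_k k (\<lambda>x. flat_exp 0 (real n * (x $ i) + (- real n * a $ i))
      * flat_exp 0 (- real n * (x $ i) + real n * b $ i))"
    for k and i :: 'n
    by (intro C_k_mult C_k_flat_exp_affine bounded_linear_const_mult bounded_linear_vec_nth)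
  then have "C_k k (box_bump a b n)" for k
    unfolding box_bump_def by (intro C_k_prod) (auto simp: algebra_simps)
  moreover have supp: "closure {x. box_bump a b n x \<noteq> 0} \<subseteq> cbox a b"
    using box_bump_outside[of _ a b n] box_subset_cbox[of a b]
    by (intro closure_minimal closed_cbox) blast
  moreover have "compact (closure {x. box_bump a b n x \<noteq> 0})"
    using bounded_subset[OF bounded_cbox subset_trans[OF closure_subset supp]]
    by (simp only: compact_closure)
  ultimately show ?thesis
    using assms by (auto simp: test_functions_def smooth_def)
qed

text \<open>Testing with \<open>box_bump\<close> shows that the integrals over all boxes with
  closure in \<open>U\<close> vanish; countably many of these boxes cover
  \<open>U\<close>.\<close>

lemma fundamental_lemma_calculus_of_variations:
  fixes g :: "real^'n \<Rightarrow> real"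
  assumes U: "open U"
    and loc: "\<And>K. compact K \<Longrightarrow> K \<subseteq> U \<Longrightarrow> integrable (lebesgue_on K) g"
    and zero: "\<And>\<phi>. \<phi> \<in> test_functions U \<Longrightarrow> (\<integral>x. g x * \<phi> x \<partial>lebesgue_on U) = 0"
  shows "AE x in lebesgue_on U. g x = 0"
proof -
  have int: "integrable lebesgue (\<lambda>x. indicator (cbox a b) x * g x)" if "cbox a b \<subseteq> U" for a b
    using loc[of "cbox a b"] that by (simp add: integrable_restrict_space)
  have box: "(\<integral>x. indicator (box a b) x * g x \<partial>lebesgue) = 0" if ab: "cbox a b \<subseteq> U" for a b
  proof -
    have "(\<lambda>n. \<integral>x. box_bump a b n x * (indicator (cbox a b) x * g x) \<partial>lebesgue)
        \<longlonglongrightarrow> (\<integral>x. indicator (box a b) x * (indicator (cbox a b) x * g x) \<partial>lebesgue)"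
    proof (rule integral_dominated_convergence)
      show "integrable lebesgue (\<lambda>x. norm (indicator (cbox a b) x * g x))"
        using int[OF ab] by simp
      have [measurable]: "box_bump a b n \<in> borel_measurable lebesgue" for n
        using test_functions_continuous[OF box_bump_test_function[OF ab]]
        by (intro measurable_completion) (simp add: borel_measurable_continuous_onI)
      have [measurable]: "(\<lambda>x. indicator (cbox a b) x * g x) \<in> borel_measurable lebesgue"
        using int[OF ab] by auto
      show "(\<lambda>x. indicator (box a b) x * (indicator (cbox a b) x * g x)) \<in> borel_measurable lebesgue"
        by (rule borel_measurable_times[OF borel_measurable_indicator]) (simp, measurable)
      show "(\<lambda>x. box_bump a b n x * (indicator (cbox a b) x * g x)) \<in> borel_measurable lebesgue" for n
        by measurable
      show "AE x in lebesgue. norm (box_bump a b n x * (indicator (cbox a b) x * g x))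
          \<le> norm (indicator (cbox a b) x * g x)" for n
        using box_bump_bounds[of a b n] by (auto simp: abs_mult intro!: mult_left_le_one_le AE_I2)
      show "AE x in lebesgue. (\<lambda>n. box_bump a b n x * (indicator (cbox a b) x * g x))
          \<longlonglongrightarrow> indicator (box a b) x * (indicator (cbox a b) x * g x)"
        by (intro AE_I2 tendsto_intros box_bump_tendsto)
    qed
    moreover have "(\<integral>x. box_bump a b n x * (indicator (cbox a b) x * g x) \<partial>lebesgue) = 0" for n
    proof -
      have "(\<lambda>x. box_bump a b n x * (indicator (cbox a b) x * g x)) =
          (\<lambda>x. indicator U x *\<^sub>R (g x * box_bump a b n x))"
        using box_bump_outside[of _ a b n] box_subset_cbox[of a b] ab
        by (fastforce simp: indicator_def fun_eq_iff)
      then show ?thesis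
        using zero[OF box_bump_test_function[OF ab]] U by (simp add: integral_restrict_space)
    qed
    moreover have "(\<lambda>x. indicator (box a b) x * (indicator (cbox a b) x * g x)) = (\<lambda>x. indicator (box a b) x * g x)"
      using box_subset_cbox[of a b] by (auto simp: indicator_def fun_eq_iff)
    ultimately have "(\<lambda>n::nat. 0) \<longlonglongrightarrow> (\<integral>x. indicator (box a b) x * g x \<partial>lebesgue)"
      by (simp only:)
    then show ?thesis
      using LIMSEQ_unique tendsto_const by blast
  qed
  have AE_box: "AE x in lebesgue. x \<in> box a b \<longrightarrow> g x = 0" if ab: "cbox a b \<subseteq> U" for a b
  proof -
    have eq: "(\<lambda>x. indicator (box a b) x * (indicator (cbox a b) x * g x)) = (\<lambda>x. indicator (box a b) x * g x)"
      using box_subset_cbox[of a b] by (auto simp: indicator_def fun_eq_iff)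
    have "AE x in lebesgue. indicator (box a b) x * g x = 0"
    proof (rule AE_zero_if_box_integrals_zero)
      show "integrable lebesgue (\<lambda>x. indicator (box a b) x * g x)"
        using integrable_mult_indicator[OF _ int[OF ab], of "box a b"] by (simp add: eq)
      fix c d :: "real^'n"
      obtain c' d' where cd: "box c d \<inter> box a b = box c' d'"
        unfolding box_Int_box by blast
      show "(\<integral>x. indicator (box c d) x * (indicator (box a b) x * g x) \<partial>lebesgue) = 0"
      proof (cases "box c' d' = {}")
        case True
        then have "(\<lambda>x. indicator (box c d) x * (indicator (box a b) x * g x)) = (\<lambda>x. 0)"
          using cd by (auto simp: indicator_def fun_eq_iff)
        then show ?thesis by simp
      next
        case False
        have "box c' d' \<subseteq> box a b" using cd by blast
        moreover from this have "box a b \<noteq> {}" using False by blast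
        ultimately have "cbox c' d' \<subseteq> cbox a b"
          using closure_mono[of "box c' d'" "box a b"] False by (simp add: closure_box)
        moreover have "(\<lambda>x. indicator (box c d) x * (indicator (box a b) x * g x)) =
            (\<lambda>x. indicator (box c' d') x * g x)"
          unfolding cd[symmetric] by (auto simp: indicator_def fun_eq_iff)
        ultimately show ?thesis
          using box[of c' d'] ab by simp
      qed
    qed
    then show ?thesis by eventually_elim auto
  qed
  define F where "F = {B. \<exists>a b. B = box a b \<and> cbox a b \<subseteq> U}"
  have "U \<subseteq> \<Union>F"
  proof
    fix x assume "x \<in> U"
    then obtain a b where "x \<in> box a b" "cbox a b \<subseteq> U"
      using U open_contains_cbox by metis
    then show "x \<in> \<Union>F" by (auto simp: F_def)
  qed
  moreover obtain F' where F': "F' \<subseteq> F" "countable F'" "\<Union>F' = \<Union>F"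
    using Lindelof[of F] by (auto simp: F_def)
  moreover have "AE x in lebesgue. \<forall>B\<in>F'. x \<in> B \<longrightarrow> g x = 0"
  proof (rule AE_ball_countable'[OF _ F'(2)])
    show "AE x in lebesgue. x \<in> B \<longrightarrow> g x = 0" if "B \<in> F'" for B
      using AE_box F'(1) that by (auto simp: F_def)
  qed
  ultimately have "AE x in lebesgue. x \<in> U \<longrightarrow> g x = 0"
    by (elim eventually_mono) blast
  then show ?thesis
    using U by (subst AE_restrict_space_iff) auto
qed

section \<open>Square integrable functions\<close>

lemma L2_lincomb:
  assumes "w \<in> L2 U" "w' \<in> L2 U"
  shows "(\<lambda>x. a *\<^sub>R w x + b *\<^sub>R w' x) \<in> L2 U"
proof -
  have [measurable]: "w \<in> borel_measurable (lebesgue_on U)" "w' \<in> borel_measurable (lebesgue_on U)"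
    and int: "integrable (lebesgue_on U) (\<lambda>x. (norm (w x))\<^sup>2)" "integrable (lebesgue_on U) (\<lambda>x. (norm (w' x))\<^sup>2)"
    using assms by (auto simp: L2_def)
  have "integrable (lebesgue_on U) (\<lambda>x. (norm (a *\<^sub>R w x + b *\<^sub>R w' x))\<^sup>2)"
  proof (rule Bochner_Integration.integrable_bound)
    show "integrable (lebesgue_on U) (\<lambda>x. 2 * a\<^sup>2 * (norm (w x))\<^sup>2 + 2 * b\<^sup>2 * (norm (w' x))\<^sup>2)"
      using int by simp
    show "AE x in lebesgue_on U. norm ((norm (a *\<^sub>R w x + b *\<^sub>R w' x))\<^sup>2)
        \<le> norm (2 * a\<^sup>2 * (norm (w x))\<^sup>2 + 2 * b\<^sup>2 * (norm (w' x))\<^sup>2)"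
    proof (intro AE_I2)
      fix x
      have "(norm (a *\<^sub>R w x + b *\<^sub>R w' x))\<^sup>2 \<le> (\<bar>a\<bar> * norm (w x) + \<bar>b\<bar> * norm (w' x))\<^sup>2"
        by (intro power_mono norm_triangle_le) auto
      also have "\<dots> \<le> 2 * (\<bar>a\<bar> * norm (w x))\<^sup>2 + 2 * (\<bar>b\<bar> * norm (w' x))\<^sup>2"
        using sum_squares_bound[of "\<bar>a\<bar> * norm (w x)" "\<bar>b\<bar> * norm (w' x)"] by (simp add: power2_sum)
      finally show "norm ((norm (a *\<^sub>R w x + b *\<^sub>R w' x))\<^sup>2)
          \<le> norm (2 * a\<^sup>2 * (norm (w x))\<^sup>2 + 2 * b\<^sup>2 * (norm (w' x))\<^sup>2)"
        by (simp add: power_mult_distrib)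
    qed
  qed measurable
  then show ?thesis by (simp add: L2_def)
qed

lemma L2_zero: "(\<lambda>x. 0) \<in> L2 U"
  by (simp add: L2_def)

lemma L2_sum: "(\<And>i. i \<in> I \<Longrightarrow> w i \<in> L2 U) \<Longrightarrow> (\<lambda>x. \<Sum>i\<in>I. w i x) \<in> L2 U"
proof (induction I rule: infinite_finite_induct)
  case (insert i I)
  then show ?case
    using L2_lincomb[of "w i" U "\<lambda>x. \<Sum>i\<in>I. w i x" 1 1] by simp
qed (simp_all add: L2_zero)

lemma L2_subset:
  assumes w: "w \<in> L2 U" and UV: "V \<subseteq> U" "U \<in> sets lebesgue" "V \<in> sets lebesgue"
  shows "w \<in> L2 V"
  using assms integrable_lebesgue_on_subset[OF _ UV, of "\<lambda>x. (norm (w x))\<^sup>2"]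
  by (auto simp: L2_def intro: measurable_restrict_mono)

lemma L2_cong_AE:
  assumes w: "w \<in> L2 U" and U: "U \<in> sets lebesgue" and AE: "AE x in lebesgue_on U. w x = w' x"
  shows "w' \<in> L2 U"
proof -
  have [measurable]: "w \<in> borel_measurable (lebesgue_on U)"
    and int: "integrable (lebesgue_on U) (\<lambda>x. (norm (w x))\<^sup>2)"
    using w by (auto simp: L2_def)
  have [measurable]: "w' \<in> borel_measurable (lebesgue_on U)"
    by (rule borel_measurable_lebesgue_on_cong_AE[OF U _ AE]) measurable
  have "integrable (lebesgue_on U) (\<lambda>x. (norm (w' x))\<^sup>2)"
    by (rule integrable_cong_AE_imp[OF int]) (measurable, use AE in eventually_elim, simp)
  then show ?thesis by (simp add: L2_def)
qed

lemma L2_bounded_multiple: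
  assumes w: "w \<in> L2 U" and [measurable]: "k \<in> borel_measurable (lebesgue_on U)"
    and k: "\<And>x. \<bar>k x\<bar> \<le> B"
  shows "(\<lambda>x. k x *\<^sub>R w x) \<in> L2 U"
proof -
  have [measurable]: "w \<in> borel_measurable (lebesgue_on U)"
    and int: "integrable (lebesgue_on U) (\<lambda>x. (norm (w x))\<^sup>2)"
    using w by (auto simp: L2_def)
  have "integrable (lebesgue_on U) (\<lambda>x. (norm (k x *\<^sub>R w x))\<^sup>2)"
  proof (rule Bochner_Integration.integrable_bound)
    show "integrable (lebesgue_on U) (\<lambda>x. B\<^sup>2 * (norm (w x))\<^sup>2)"
      using int by simp
    show "AE x in lebesgue_on U. norm ((norm (k x *\<^sub>R w x))\<^sup>2) \<le> norm (B\<^sup>2 * (norm (w x))\<^sup>2)"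
    proof (intro AE_I2)
      fix x
      have "norm (k x *\<^sub>R w x) \<le> B * norm (w x)"
        using k[of x] by (simp add: mult_right_mono)
      then have "(norm (k x *\<^sub>R w x))\<^sup>2 \<le> (B * norm (w x))\<^sup>2"
        by (intro power_mono) auto
      then show "norm ((norm (k x *\<^sub>R w x))\<^sup>2) \<le> norm (B\<^sup>2 * (norm (w x))\<^sup>2)"
        by (simp add: power_mult_distrib)
    qed
  qed measurable
  then show ?thesis by (simp add: L2_def)
qed

lemma L2_indicator:
  assumes "w \<in> L2 U" "A \<in> sets lebesgue"
  shows "(\<lambda>x. indicator A x *\<^sub>R w x) \<in> L2 U"
proof (rule L2_bounded_multiple[OF assms(1)])
  show "indicat_real A \<in> borel_measurable (lebesgue_on U)"
    using assms(2) by (intro measurable_restrict_space1 borel_measurable_indicator)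
  show "\<bar>indicat_real A x\<bar> \<le> 1" for x
    by (simp add: indicator_def)
qed

lemma L2_inner_integrable:
  assumes "w \<in> L2 U" "w' \<in> L2 U"
  shows "integrable (lebesgue_on U) (\<lambda>x. w x \<bullet> w' x)"
proof -
  have [measurable]: "w \<in> borel_measurable (lebesgue_on U)" "w' \<in> borel_measurable (lebesgue_on U)"
    and int: "integrable (lebesgue_on U) (\<lambda>x. (norm (w x))\<^sup>2)" "integrable (lebesgue_on U) (\<lambda>x. (norm (w' x))\<^sup>2)"
    using assms by (auto simp: L2_def)
  show ?thesis
  proof (rule Bochner_Integration.integrable_bound)
    show "integrable (lebesgue_on U) (\<lambda>x. (norm (w x))\<^sup>2 + (norm (w' x))\<^sup>2)"
      using int by simp
    show "AE x in lebesgue_on U. norm (w x \<bullet> w' x) \<le> norm ((norm (w x))\<^sup>2 + (norm (w' x))\<^sup>2)"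
    proof (intro AE_I2)
      fix x
      have "\<bar>w x \<bullet> w' x\<bar> \<le> norm (w x) * norm (w' x)"
        by (rule Cauchy_Schwarz_ineq2)
      also have "\<dots> \<le> (norm (w x))\<^sup>2 + (norm (w' x))\<^sup>2"
        using sum_squares_bound[of "norm (w x)" "norm (w' x)"]
          zero_le_power2[of "norm (w x)"] zero_le_power2[of "norm (w' x)"] by linarith
      finally show "norm (w x \<bullet> w' x) \<le> norm ((norm (w x))\<^sup>2 + (norm (w' x))\<^sup>2)" by simp
    qed
  qed measurable
qed

lemma continuous_compact_support_L2:
  fixes h :: "real^'n \<Rightarrow> 'b::euclidean_space"
  assumes U: "U \<in> sets lebesgue" and K: "compact K"
    and h: "continuous_on UNIV h" "\<And>x. x \<notin> K \<Longrightarrow> h x = 0"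
  shows "h \<in> L2 U"
proof -
  have "h \<in> borel_measurable lebesgue"
    using h(1) by (intro measurable_completion) (simp add: borel_measurable_continuous_onI)
  then have "h \<in> borel_measurable (lebesgue_on U)"
    by (rule measurable_restrict_space1)
  have K': "K \<in> sets lebesgue"
    using K by (simp add: borel_compact)
  have c: "continuous_on K (\<lambda>x. (norm (h x))\<^sup>2)"
    using h(1) by (intro continuous_intros continuous_on_subset[OF h(1)]) auto
  have "integrable lborel (\<lambda>x. indicator K x *\<^sub>R (norm (h x))\<^sup>2)"
    by (rule borel_integrable_compact[OF K c])
  then have "integrable lebesgue (\<lambda>x. indicator K x *\<^sub>R (norm (h x))\<^sup>2)"
    by (subst integrable_completion) auto
  moreover have "(\<lambda>x. indicator K x *\<^sub>R (norm (h x))\<^sup>2) = (\<lambda>x. (norm (h x))\<^sup>2)"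
  proof
    show "indicator K x *\<^sub>R (norm (h x))\<^sup>2 = (norm (h x))\<^sup>2" for x
      by (cases "x \<in> K") (simp_all add: h(2))
  qed
  ultimately have "integrable (lebesgue_on UNIV) (\<lambda>x. (norm (h x))\<^sup>2)"
    by (simp only: lebesgue_on_UNIV_eq)
  then have "integrable (lebesgue_on U) (\<lambda>x. (norm (h x))\<^sup>2)"
    by (rule integrable_lebesgue_on_subset) (use U in auto)
  with \<open>h \<in> borel_measurable (lebesgue_on U)\<close> show ?thesis
    by (simp add: L2_def)
qed

lemma bounded_const_L2:
  assumes U: "U \<in> lmeasurable"
  shows "(\<lambda>x. c) \<in> L2 U"
  using U by (auto simp: L2_def intro!: finite_measure.integrable_const finite_measure_lebesgue_on)

lemma grad_L2:
  assumes "\<psi> \<in> test_functions A" "U \<in> sets lebesgue"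
  shows "grad \<psi> \<in> L2 U"
  using grad_support[OF assms(1)] continuous_compact_support_L2[OF assms(2)] grad_continuous[OF assms(1)]
  by metis

lemma test_function_L2:
  fixes \<psi> :: "real^'n \<Rightarrow> 'b::euclidean_space"
  assumes "\<psi> \<in> test_functions A" "U \<in> sets lebesgue"
  shows "\<psi> \<in> L2 U"
  using test_functions_support[OF assms(1)] continuous_compact_support_L2[OF assms(2)]
    test_functions_continuous[OF assms(1)]
  by metis

section \<open>Weak gradients\<close>

lemma open_lebesgue: "open (U :: 'a::euclidean_space set) \<Longrightarrow> U \<in> sets lebesgue"
  by simp

lemma is_weak_grad_integrable:
  assumes "is_weak_grad U w G" "open U" "\<phi> \<in> test_functions U"
  shows "integrable (lebesgue_on U) (\<lambda>x. w x $ i * frechet_derivative \<phi> (at x) (axis j 1))"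
    and "integrable (lebesgue_on U) (\<lambda>x. G x $ i $ j * \<phi> x)"
proof -
  obtain K where K: "compact K" "K \<subseteq> U" "\<And>x. x \<notin> K \<Longrightarrow> \<phi> x = 0"
    "\<And>x. x \<notin> K \<Longrightarrow> frechet_derivative \<phi> (at x) = (\<lambda>v. 0)"
    using test_functions_support[OF assms(3)] by blast
  have int: "integrable (lebesgue_on K) w" "integrable (lebesgue_on K) G"
    using assms(1) K by (auto simp: is_weak_grad_def)
  have "integrable (lebesgue_on K) (\<lambda>x. w x $ i)"
    by (rule integrable_bounded_linear[OF bounded_linear_vec_nth int(1)])
  then show "integrable (lebesgue_on U) (\<lambda>x. w x $ i * frechet_derivative \<phi> (at x) (axis j 1))"
    using assms(2) K
    by (intro integrable_times_compact_support[OF bounded_bilinear_mult]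
        test_functions_derivative_continuous[OF assms(3)]) auto
  have "integrable (lebesgue_on K) (\<lambda>x. G x $ i $ j)"
    by (intro integrable_bounded_linear[OF bounded_linear_vec_nth] int(2))
  then show "integrable (lebesgue_on U) (\<lambda>x. G x $ i $ j * \<phi> x)"
    using assms(2) K
    by (intro integrable_times_compact_support[OF bounded_bilinear_mult]
        test_functions_continuous[OF assms(3)]) auto
qed

lemma is_weak_grad_unique:
  fixes G G' :: "real^'n \<Rightarrow> real^'n^'n"
  assumes U: "open U" and G: "is_weak_grad U w G" and G': "is_weak_grad U w G'"
  shows "AE x in lebesgue_on U. G x = G' x"
proof -
  have comp: "AE x in lebesgue_on U. G x $ i $ j - G' x $ i $ j = 0" for i j :: 'n
  proof (rule fundamental_lemma_calculus_of_variations[OF U])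
    fix K assume "compact K" "K \<subseteq> U"
    then have "integrable (lebesgue_on K) G" "integrable (lebesgue_on K) G'"
      using G G' by (auto simp: is_weak_grad_def)
    then show "integrable (lebesgue_on K) (\<lambda>x. G x $ i $ j - G' x $ i $ j)"
      by (intro Bochner_Integration.integrable_diff integrable_bounded_linear[OF bounded_linear_vec_nth])
  next
    fix \<phi> :: "real^'n \<Rightarrow> real" assume \<phi>: "\<phi> \<in> test_functions U"
    have "(\<integral>x. (G x $ i $ j - G' x $ i $ j) * \<phi> x \<partial>lebesgue_on U) =
        (\<integral>x. G x $ i $ j * \<phi> x \<partial>lebesgue_on U) - (\<integral>x. G' x $ i $ j * \<phi> x \<partial>lebesgue_on U)"
      using is_weak_grad_integrable(2)[OF G U \<phi>] is_weak_grad_integrable(2)[OF G' U \<phi>]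
      by (simp add: left_diff_distrib)
    also have "\<dots> = 0"
      using G G' \<phi> unfolding is_weak_grad_def by (metis (no_types, lifting) diff_self neg_equal_iff_equal)
    finally show "(\<integral>x. (G x $ i $ j - G' x $ i $ j) * \<phi> x \<partial>lebesgue_on U) = 0" .
  qed
  have "AE x in lebesgue_on U. \<forall>i\<in>UNIV. \<forall>j\<in>UNIV. G x $ i $ j - G' x $ i $ j = 0"
    by (intro AE_finite_allI comp) auto
  then show ?thesis
    by eventually_elim (simp add: vec_eq_iff)
qed

lemma is_weak_grad_weak_grad: "is_weak_grad U w G \<Longrightarrow> is_weak_grad U w (weak_grad U w)"
  unfolding weak_grad_def by (rule someI[where P = "is_weak_grad U w"])

lemma weak_grad_AE_eq:
  assumes "open U" "is_weak_grad U w G"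
  shows "AE x in lebesgue_on U. weak_grad U w x = G x"
  by (rule is_weak_grad_unique[OF assms(1) is_weak_grad_weak_grad[OF assms(2)] assms(2)])

lemma is_weak_grad_lincomb:
  fixes G G' :: "real^'n \<Rightarrow> real^'n^'n"
  assumes U: "open U" and G: "is_weak_grad U w G" and G': "is_weak_grad U w' G'"
  shows "is_weak_grad U (\<lambda>x. a *\<^sub>R w x + b *\<^sub>R w' x) (\<lambda>x. a *\<^sub>R G x + b *\<^sub>R G' x)"
  unfolding is_weak_grad_def
proof (intro conjI ballI allI impI)
  fix K assume "compact K \<and> K \<subseteq> U"
  then show "integrable (lebesgue_on K) (\<lambda>x. a *\<^sub>R w x + b *\<^sub>R w' x)"
    "integrable (lebesgue_on K) (\<lambda>x. a *\<^sub>R G x + b *\<^sub>R G' x)"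
    using G G' by (auto simp: is_weak_grad_def)
next
  fix \<phi> :: "real^'n \<Rightarrow> real" and i j :: 'n assume \<phi>: "\<phi> \<in> test_functions U"
  let ?d = "\<lambda>x. frechet_derivative \<phi> (at x) (axis j 1)"
  note int = is_weak_grad_integrable[OF G U \<phi>, where i = i and j = j]
    is_weak_grad_integrable[OF G' U \<phi>, where i = i and j = j]
  have "(\<integral>x. (a *\<^sub>R w x + b *\<^sub>R w' x) $ i * ?d x \<partial>lebesgue_on U)
      = (\<integral>x. a * (w x $ i * ?d x) + b * (w' x $ i * ?d x) \<partial>lebesgue_on U)"
    by (simp add: algebra_simps)
  also have "\<dots> = a * (\<integral>x. w x $ i * ?d x \<partial>lebesgue_on U) + b * (\<integral>x. w' x $ i * ?d x \<partial>lebesgue_on U)"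
    using int by simp
  also have "\<dots> = a * (- (\<integral>x. G x $ i $ j * \<phi> x \<partial>lebesgue_on U)) + b * (- (\<integral>x. G' x $ i $ j * \<phi> x \<partial>lebesgue_on U))"
    using G G' \<phi> unfolding is_weak_grad_def by simp
  also have "\<dots> = - (\<integral>x. a * (G x $ i $ j * \<phi> x) + b * (G' x $ i $ j * \<phi> x) \<partial>lebesgue_on U)"
    using int by simp
  also have "\<dots> = - (\<integral>x. (a *\<^sub>R G x + b *\<^sub>R G' x) $ i $ j * \<phi> x \<partial>lebesgue_on U)"
    by (simp add: algebra_simps)
  finally show "(\<integral>x. (a *\<^sub>R w x + b *\<^sub>R w' x) $ i * ?d x \<partial>lebesgue_on U) =
      - (\<integral>x. (a *\<^sub>R G x + b *\<^sub>R G' x) $ i $ j * \<phi> x \<partial>lebesgue_on U)" .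
qed

lemma is_weak_grad_subset:
  assumes G: "is_weak_grad U w G" and UV: "V \<subseteq> U" "open U" "open V"
  shows "is_weak_grad V w G"
  unfolding is_weak_grad_def
proof (intro conjI ballI allI impI)
  fix K assume "compact K \<and> K \<subseteq> V"
  then show "integrable (lebesgue_on K) w" "integrable (lebesgue_on K) G"
    using G UV(1) by (auto simp: is_weak_grad_def)
next
  fix \<phi> :: "real^'a \<Rightarrow> real" and i j :: 'a assume \<phi>: "\<phi> \<in> test_functions V"
  then have \<phi>': "\<phi> \<in> test_functions U" using test_functions_mono[OF UV(1)] by blast
  obtain K where K: "compact K" "K \<subseteq> V" "\<And>x. x \<notin> K \<Longrightarrow> \<phi> x = 0"
    "\<And>x. x \<notin> K \<Longrightarrow> frechet_derivative \<phi> (at x) = (\<lambda>v. 0)"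
    using test_functions_support[OF \<phi>] by blast
  have off: "\<phi> x = 0" "frechet_derivative \<phi> (at x) (axis j 1) = 0" if "x \<in> U - V" for x
  proof -
    have "x \<notin> K" using that K(2) by blast
    then show "\<phi> x = 0" "frechet_derivative \<phi> (at x) (axis j 1) = 0"
      using K(3,4)[of x] by simp_all
  qed
  have "(\<integral>x. w x $ i * frechet_derivative \<phi> (at x) (axis j 1) \<partial>lebesgue_on V)
      = (\<integral>x. w x $ i * frechet_derivative \<phi> (at x) (axis j 1) \<partial>lebesgue_on U)"
    using UV off by (intro integral_lebesgue_on_subset) simp_all
  also have "\<dots> = - (\<integral>x. G x $ i $ j * \<phi> x \<partial>lebesgue_on U)"
    using G \<phi>' by (simp add: is_weak_grad_def)
  also have "(\<integral>x. G x $ i $ j * \<phi> x \<partial>lebesgue_on U) = (\<integral>x. G x $ i $ j * \<phi> x \<partial>lebesgue_on V)"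
    using UV off by (intro integral_lebesgue_on_subset[symmetric]) simp_all
  finally show "(\<integral>x. w x $ i * frechet_derivative \<phi> (at x) (axis j 1) \<partial>lebesgue_on V)
      = - (\<integral>x. G x $ i $ j * \<phi> x \<partial>lebesgue_on V)" .
qed

lemma is_weak_grad_cong:
  assumes G: "is_weak_grad U w G" and eq: "\<And>x. x \<in> U \<Longrightarrow> w x = w' x"
  shows "is_weak_grad U w' G"
proof -
  have "integrable (lebesgue_on K) w' \<longleftrightarrow> integrable (lebesgue_on K) w" if "K \<subseteq> U" for K
    using that by (intro Bochner_Integration.integrable_cong) (auto simp: eq)
  moreover have "(\<integral>x. w' x $ i * frechet_derivative \<phi> (at x) (axis j 1) \<partial>lebesgue_on U)
      = (\<integral>x. w x $ i * frechet_derivative \<phi> (at x) (axis j 1) \<partial>lebesgue_on U)" for \<phi> i j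
    by (intro Bochner_Integration.integral_cong) (auto simp: eq)
  ultimately show ?thesis
    using G by (simp add: is_weak_grad_def)
qed

lemma is_weak_grad_indicator:
  assumes G: "is_weak_grad U w G" and U: "open U" and A: "A \<in> sets lebesgue" "U \<inter> frontier A = {}"
  shows "is_weak_grad U (\<lambda>x. indicator A x *\<^sub>R w x) (\<lambda>x. indicator A x *\<^sub>R G x)"
  unfolding is_weak_grad_def
proof (intro conjI ballI allI impI)
  fix K assume "compact K \<and> K \<subseteq> U"
  then have int: "integrable (lebesgue_on K) w" "integrable (lebesgue_on K) G" and K: "K \<in> sets lebesgue"
    using G by (auto simp: is_weak_grad_def borel_compact)
  have "A \<inter> K \<in> sets (lebesgue_on K)"
    using A(1) K by (auto simp: sets_restrict_space)
  then have "integrable (lebesgue_on K) (\<lambda>x. indicator (A \<inter> K) x *\<^sub>R w x)"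
    "integrable (lebesgue_on K) (\<lambda>x. indicator (A \<inter> K) x *\<^sub>R G x)"
    using int by (auto intro: integrable_mult_indicator)
  then show "integrable (lebesgue_on K) (\<lambda>x. indicator A x *\<^sub>R w x)"
    "integrable (lebesgue_on K) (\<lambda>x. indicator A x *\<^sub>R G x)"
    by (auto elim!: Bochner_Integration.integrable_cong[THEN iffD1, rotated 2] simp: indicator_def)
next
  fix \<phi> :: "real^'a \<Rightarrow> real" and i j :: 'a assume \<phi>: "\<phi> \<in> test_functions U"
  let ?\<phi> = "\<lambda>x. indicator A x *\<^sub>R \<phi> x"
  have "?\<phi> \<in> test_functions U"
    using test_functions_indicator[OF \<phi> A(2)] test_functions_mono[of "U \<inter> A" U] by blast
  then have "(\<integral>x. w x $ i * frechet_derivative ?\<phi> (at x) (axis j 1) \<partial>lebesgue_on U)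
      = - (\<integral>x. G x $ i $ j * ?\<phi> x \<partial>lebesgue_on U)"
    using G unfolding is_weak_grad_def by blast
  then have "(\<integral>x. w x $ i * (indicator A x *\<^sub>R frechet_derivative \<phi> (at x) (axis j 1)) \<partial>lebesgue_on U)
      = - (\<integral>x. G x $ i $ j * ?\<phi> x \<partial>lebesgue_on U)"
    unfolding frechet_derivative_indicator[OF \<phi> A(2)] .
  then show "(\<integral>x. (indicator A x *\<^sub>R w x) $ i * frechet_derivative \<phi> (at x) (axis j 1) \<partial>lebesgue_on U)
      = - (\<integral>x. (indicator A x *\<^sub>R G x) $ i $ j * \<phi> x \<partial>lebesgue_on U)"
    by (simp add: mult_ac)
qed

section \<open>The space \<open>H\<^sup>1\<close>\<close>

text \<open>The chosen weak gradient agrees almost everywhere with a square integrable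
  one.\<close>

lemma H1_weak_grad:
  assumes "open U" "w \<in> H1 U"
  shows "is_weak_grad U w (weak_grad U w)" "weak_grad U w \<in> L2 U"
proof -
  obtain G where G: "G \<in> L2 U" "is_weak_grad U w G"
    using assms(2) by (auto simp: H1_def)
  then show "is_weak_grad U w (weak_grad U w)"
    by (blast intro: is_weak_grad_weak_grad)
  have "AE x in lebesgue_on U. G x = weak_grad U w x"
    using weak_grad_AE_eq[OF assms(1) G(2)] by eventually_elim simp
  then show "weak_grad U w \<in> L2 U"
    using G(1) assms(1) by (blast intro: L2_cong_AE open_lebesgue)
qed

lemma H1_lincomb:
  assumes U: "open U" and w: "w \<in> H1 U" "w' \<in> H1 U"
  shows "(\<lambda>x. a *\<^sub>R w x + b *\<^sub>R w' x) \<in> H1 U"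
    and "AE x in lebesgue_on U. weak_grad U (\<lambda>x. a *\<^sub>R w x + b *\<^sub>R w' x) x
      = a *\<^sub>R weak_grad U w x + b *\<^sub>R weak_grad U w' x"
proof -
  have G: "is_weak_grad U (\<lambda>x. a *\<^sub>R w x + b *\<^sub>R w' x)
      (\<lambda>x. a *\<^sub>R weak_grad U w x + b *\<^sub>R weak_grad U w' x)"
    by (intro is_weak_grad_lincomb U H1_weak_grad w)
  then show "(\<lambda>x. a *\<^sub>R w x + b *\<^sub>R w' x) \<in> H1 U"
    using w L2_lincomb[OF H1_weak_grad(2)[OF U w(1)] H1_weak_grad(2)[OF U w(2)]]
    by (auto simp: H1_def intro!: L2_lincomb)
  show "AE x in lebesgue_on U. weak_grad U (\<lambda>x. a *\<^sub>R w x + b *\<^sub>R w' x) x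
      = a *\<^sub>R weak_grad U w x + b *\<^sub>R weak_grad U w' x"
    by (rule weak_grad_AE_eq[OF U G])
qed

lemma H1_zero:
  assumes "open U"
  shows "(\<lambda>x. 0) \<in> H1 U" "AE x in lebesgue_on U. weak_grad U (\<lambda>x. 0) x = 0"
proof -
  have G: "is_weak_grad U (\<lambda>x. 0) (\<lambda>x. 0)"
    by (simp add: is_weak_grad_def)
  then show "(\<lambda>x. 0) \<in> H1 U"
    by (auto simp: H1_def L2_zero)
  show "AE x in lebesgue_on U. weak_grad U (\<lambda>x. 0) x = 0"
    by (rule weak_grad_AE_eq[OF assms G])
qed

lemma H1_sum:
  assumes U: "open U" and w: "\<And>i. i \<in> I \<Longrightarrow> w i \<in> H1 U"
  shows "(\<lambda>x. \<Sum>i\<in>I. w i x) \<in> H1 U \<and>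
    (AE x in lebesgue_on U. weak_grad U (\<lambda>x. \<Sum>i\<in>I. w i x) x = (\<Sum>i\<in>I. weak_grad U (w i) x))"
  using w
proof (induction I rule: infinite_finite_induct)
  case (insert i I)
  have IH: "(\<lambda>x. \<Sum>i\<in>I. w i x) \<in> H1 U"
    "AE x in lebesgue_on U. weak_grad U (\<lambda>x. \<Sum>i\<in>I. w i x) x = (\<Sum>i\<in>I. weak_grad U (w i) x)"
    using insert by auto
  note * = H1_lincomb[OF U insert.prems[OF insertI1] IH(1), of 1 1, simplified]
  have "AE x in lebesgue_on U. weak_grad U (\<lambda>x. w i x + (\<Sum>i\<in>I. w i x)) x
      = weak_grad U (w i) x + (\<Sum>i\<in>I. weak_grad U (w i) x)"
    using *(2) IH(2) by eventually_elim simp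
  then show ?case using *(1) insert(1,2) by simp
qed (use H1_zero[OF U] in simp_all)

lemma H1_subset:
  assumes w: "w \<in> H1 U" and UV: "V \<subseteq> U" "open U" "open V"
  shows "w \<in> H1 V" "AE x in lebesgue_on V. weak_grad V w x = weak_grad U w x"
proof -
  have G: "is_weak_grad V w (weak_grad U w)"
    by (rule is_weak_grad_subset[OF H1_weak_grad(1)[OF UV(2) w] UV])
  moreover have "weak_grad U w \<in> L2 V"
    using H1_weak_grad(2)[OF UV(2) w] UV by (auto intro: L2_subset)
  moreover have "w \<in> L2 V"
    using w UV by (auto simp: H1_def intro: L2_subset)
  ultimately show "w \<in> H1 V"
    by (auto simp: H1_def)
  show "AE x in lebesgue_on V. weak_grad V w x = weak_grad U w x"
    by (rule weak_grad_AE_eq[OF UV(3) G])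
qed

lemma H1_cong:
  assumes w: "w \<in> H1 U" and eq: "\<And>x. x \<in> U \<Longrightarrow> w x = w' x" and U: "open U"
  shows "w' \<in> H1 U" "AE x in lebesgue_on U. weak_grad U w' x = weak_grad U w x"
proof -
  have G: "is_weak_grad U w' (weak_grad U w)"
    by (rule is_weak_grad_cong[OF H1_weak_grad(1)[OF U w] eq])
  moreover have "w' \<in> L2 U"
    using w U eq by (auto simp: H1_def intro!: L2_cong_AE[of w])
  ultimately show "w' \<in> H1 U"
    using H1_weak_grad(2)[OF U w] by (auto simp: H1_def)
  show "AE x in lebesgue_on U. weak_grad U w' x = weak_grad U w x"
    by (rule weak_grad_AE_eq[OF U G])
qed

lemma H1_indicator:
  assumes w: "w \<in> H1 U" and U: "open U" and A: "A \<in> sets lebesgue" "U \<inter> frontier A = {}"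
  shows "(\<lambda>x. indicator A x *\<^sub>R w x) \<in> H1 U"
    "AE x in lebesgue_on U. weak_grad U (\<lambda>x. indicator A x *\<^sub>R w x) x = indicator A x *\<^sub>R weak_grad U w x"
proof -
  have G: "is_weak_grad U (\<lambda>x. indicator A x *\<^sub>R w x) (\<lambda>x. indicator A x *\<^sub>R weak_grad U w x)"
    by (intro is_weak_grad_indicator H1_weak_grad U w A)
  then show "(\<lambda>x. indicator A x *\<^sub>R w x) \<in> H1 U"
    using w L2_indicator[OF _ A(1)] L2_indicator[OF H1_weak_grad(2)[OF U w] A(1)]
    unfolding H1_def by blast
  show "AE x in lebesgue_on U. weak_grad U (\<lambda>x. indicator A x *\<^sub>R w x) x = indicator A x *\<^sub>R weak_grad U w x"
    by (rule weak_grad_AE_eq[OF U G])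
qed

text \<open>On a bounded set, the global fields of the droplet problems are ordinary
  \<open>H\<^sup>1\<close> functions, and restriction changes their weak gradient on a null set at
  most.\<close>

lemma H1_bdd_subset:
  assumes w: "w \<in> H1_bdd U" and UV: "V \<subseteq> U" "open U" "open V" "bounded V"
  shows "w \<in> H1 V" "AE x in lebesgue_on V. weak_grad V w x = weak_grad U w x"
    "weak_grad U w \<in> L2 V"
proof -
  obtain G where G: "G \<in> L2_bdd U" "is_weak_grad U w G"
    using w by (auto simp: H1_bdd_def)
  obtain R where "V \<subseteq> ball 0 R"
    using UV(4) by (metis bounded_subset_ballD)
  then have R: "V \<subseteq> U \<inter> ball 0 R" "open (U \<inter> ball 0 R)" using UV by auto
  have L2: "z \<in> L2 V" if "z \<in> L2_bdd U" for z :: "real^'a \<Rightarrow> 'b::euclidean_space"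
    using that R UV(3) by (auto simp: L2_bdd_def intro: L2_subset)
  have GV: "is_weak_grad V w G"
    by (rule is_weak_grad_subset[OF G(2) UV(1-3)])
  then show w: "w \<in> H1 V"
    using L2[of w] L2[OF G(1)] w by (auto simp: H1_def H1_bdd_def)
  have GV': "is_weak_grad V w (weak_grad U w)"
    by (rule is_weak_grad_subset[OF is_weak_grad_weak_grad[OF G(2)] UV(1-3)])
  then show "AE x in lebesgue_on V. weak_grad V w x = weak_grad U w x"
    by (rule weak_grad_AE_eq[OF UV(3)])
  then show "weak_grad U w \<in> L2 V"
    using H1_weak_grad(2)[OF UV(3) w] UV(3) by (blast intro: L2_cong_AE open_lebesgue)
qed

lemma transpose_add: "transpose (A + B) = transpose A + transpose (B :: 'a::monoid_add^'n^'m)"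
  by (simp add: transpose_def vec_eq_iff)

lemma transpose_scaleR: "transpose (a *\<^sub>R A) = a *\<^sub>R transpose (A :: real^'n^'m)"
  by (simp add: transpose_def vec_eq_iff)

lemma norm_transpose: "norm (transpose (A :: real^'n^'m)) = norm A"
proof -
  have "transpose A \<bullet> transpose A = A \<bullet> A"
    unfolding inner_vec_def by (subst sum.swap) (simp add: transpose_def)
  then show ?thesis by (simp add: norm_eq_sqrt_inner)
qed

lemma strain_L2:
  fixes w :: "real^'n \<Rightarrow> real^'n"
  assumes G: "weak_grad U w \<in> L2 V"
  shows "strain U w \<in> L2 V"
proof -
  have "bounded_linear (transpose :: real^'n^'n \<Rightarrow> real^'n^'n)"
    by (rule bounded_linear_intro[of _ 1]) (auto simp: transpose_add transpose_scaleR norm_transpose)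
  then have "(transpose :: real^'n^'n \<Rightarrow> real^'n^'n) \<in> borel_measurable borel"
    by (intro borel_measurable_continuous_onI linear_continuous_on)
  moreover have "weak_grad U w \<in> borel_measurable (lebesgue_on V)"
    using G by (simp add: L2_def)
  ultimately have "(\<lambda>x. transpose (weak_grad U w x)) \<in> borel_measurable (lebesgue_on V)"
    by (rule measurable_compose[rotated])
  then have "(\<lambda>x. transpose (weak_grad U w x)) \<in> L2 V"
    using G by (simp add: L2_def norm_transpose)
  then have "(\<lambda>x. (1/2) *\<^sub>R weak_grad U w x + (1/2) *\<^sub>R transpose (weak_grad U w x)) \<in> L2 V"
    using G by (intro L2_lincomb)
  then show ?thesis
    by (simp add: strain_def[abs_def] scaleR_add_right)
qed

section \<open>The divergence theorem on a ball\<close>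

lemma integral_lborel_translate:
  fixes f :: "'a::euclidean_space \<Rightarrow> real"
  assumes "f \<in> borel_measurable borel"
  shows "(\<integral>x. f (c + x) \<partial>lborel) = (\<integral>x. f x \<partial>lborel)"
proof -
  have "(\<integral>x. f x \<partial>lborel) = (\<integral>x. f x \<partial>distr lborel borel ((+) c))"
    by (simp add: lborel_distr_plus)
  also have "\<dots> = (\<integral>x. f (c + x) \<partial>lborel)"
    using assms by (intro integral_distr) simp_all
  finally show ?thesis ..
qed

lemma integrable_lborel_bounded_support:
  fixes f :: "'a::euclidean_space \<Rightarrow> real"
  assumes "f \<in> borel_measurable borel" "\<And>x. \<bar>f x\<bar> \<le> B * indicator (cball 0 R) x"
  shows "integrable lborel f"
proof (rule Bochner_Integration.integrable_bound)
  show "integrable lborel (\<lambda>x. B * indicator (cball (0::'a) R) x)"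
    by (intro integrable_mult_right integrable_real_indicator) (auto simp: emeasure_bounded_finite[OF bounded_cball, unfolded infinity_ennreal_def])
  show "AE x in lborel. norm (f x) \<le> norm (B * indicator (cball 0 R) x)"
    using assms(2) by (intro AE_I2) (smt (verit) real_norm_def)
qed (use assms in simp)

text \<open>Translation invariance makes the integral of every difference quotient vanish;
  Lipschitz continuity dominates the quotients.\<close>

lemma integral_derivative_Lipschitz_eq_0:
  fixes \<phi> :: "'a::euclidean_space \<Rightarrow> real"
  assumes lip: "L-lipschitz_on UNIV \<phi>" and supp: "\<And>x. x \<notin> ball 0 R \<Longrightarrow> \<phi> x = 0"
    and Z: "negligible Z" and der: "\<And>x. x \<notin> Z \<Longrightarrow> (\<phi> has_derivative D x) (at x)"
  shows "(\<integral>x. D x e \<partial>lebesgue) = 0" "integrable lebesgue (\<lambda>x. D x e)"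
proof -
  let ?h = "\<lambda>n. inverse (real (Suc n))"
  let ?q = "\<lambda>n x. (\<phi> (?h n *\<^sub>R e + x) - \<phi> x) / ?h n"
  have L: "L \<ge> 0" using lip by (rule lipschitz_on_nonneg)
  have cont: "continuous_on UNIV \<phi>" by (rule lipschitz_on_continuous_on[OF lip])
  then have meas[measurable]: "\<phi> \<in> borel_measurable borel"
    by (rule borel_measurable_continuous_onI)
  have qmeas: "?q n \<in> borel_measurable borel" for n by measurable
  have bound: "\<bar>?q n x\<bar> \<le> L * norm e * indicator (cball 0 (R + norm e)) x" for n x
  proof (cases "x \<in> cball 0 (R + norm e)")
    case True
    have "\<bar>\<phi> (?h n *\<^sub>R e + x) - \<phi> x\<bar> \<le> L * norm (?h n *\<^sub>R e)"
      using lipschitz_onD[OF lip, of "?h n *\<^sub>R e + x" x] by (simp add: dist_norm)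
    also have "\<dots> = L * norm e * ?h n" by simp
    finally have "\<bar>\<phi> (?h n *\<^sub>R e + x) - \<phi> x\<bar> \<le> L * norm e * ?h n" .
    moreover have "?h n > 0" by simp
    ultimately have "\<bar>?q n x\<bar> \<le> L * norm e"
      unfolding abs_divide by (subst pos_divide_le_eq) (simp_all only: abs_of_pos zero_less_abs_iff)
    then show ?thesis using True by simp
  next
    case False
    have "norm (?h n *\<^sub>R e) \<le> norm e"
      by (simp add: mult_left_le_one_le inverse_le_1_iff del: of_nat_Suc)
    moreover have "norm x \<le> norm (?h n *\<^sub>R e + x) + norm (?h n *\<^sub>R e)"
      using norm_triangle_ineq4[of "?h n *\<^sub>R e + x" "?h n *\<^sub>R e"] by simp
    moreover have "norm x > R + norm e" using False by simp
    moreover have "0 \<le> norm e" by simp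
    ultimately have "norm (?h n *\<^sub>R e + x) \<ge> R" "norm x \<ge> R" by linarith+
    then show ?thesis using False supp by simp
  qed
  have int0: "(\<integral>x. ?q n x \<partial>lebesgue) = 0" for n
  proof -
    have b: "\<exists>B. \<forall>x. \<bar>\<phi> x\<bar> \<le> B * indicator (cball 0 R) x"
    proof -
      have "bounded (\<phi> ` cball 0 R)"
        by (intro compact_imp_bounded compact_continuous_image continuous_on_subset[OF cont] compact_cball) auto
      then obtain B where B: "\<And>x. x \<in> cball 0 R \<Longrightarrow> norm (\<phi> x) \<le> B"
        unfolding bounded_iff by blast
      have "\<bar>\<phi> x\<bar> \<le> B * indicator (cball 0 R) x" for x
        using B[of x] supp[of x] by (cases "x \<in> cball 0 R") auto
      then show ?thesis by blast
    qed
    then have i1: "integrable lborel \<phi>"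
      using integrable_lborel_bounded_support[OF meas] by blast
    have i2: "integrable lborel (\<lambda>x. \<phi> (?h n *\<^sub>R e + x))"
    proof -
      have "integrable (distr lborel borel ((+) (?h n *\<^sub>R e))) \<phi>"
        using i1 by (simp add: lborel_distr_plus)
      then show ?thesis by (subst (asm) integrable_distr_eq) auto
    qed
    have "(\<integral>x. ?q n x \<partial>lebesgue) = (\<integral>x. ?q n x \<partial>lborel)"
      using qmeas by (intro integral_completion) simp
    also have "\<dots> = ((\<integral>x. \<phi> (?h n *\<^sub>R e + x) \<partial>lborel) - (\<integral>x. \<phi> x \<partial>lborel)) / ?h n"
      using i1 i2 by simp
    also have "\<dots> = 0" by (simp add: integral_lborel_translate[OF meas])
    finally show ?thesis .
  qed
  have lim: "(\<lambda>n. ?q n x) \<longlonglongrightarrow> D x e" if "x \<notin> Z" for x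
  proof -
    have d: "(\<phi> has_derivative D x) (at x)" by (rule der[OF that])
    have "((\<lambda>t. \<phi> (x + t *\<^sub>R e)) has_derivative (\<lambda>t. D x (t *\<^sub>R e))) (at 0)"
      by (rule has_derivative_compose[where f = "\<lambda>t. x + t *\<^sub>R e" and g = \<phi>, simplified])
        (auto intro!: derivative_eq_intros d)
    then have "((\<lambda>t. \<phi> (x + t *\<^sub>R e)) has_real_derivative D x e) (at 0)"
      using linear_scale[OF has_derivative_linear[OF d]]
      by (simp add: has_field_derivative_def mult_commute_abs)
    then have "((\<lambda>t. (\<phi> (x + t *\<^sub>R e) - \<phi> x) / t) \<longlongrightarrow> D x e) (at 0)"
      by (simp add: DERIV_def)
    moreover have "filterlim ?h (at 0) sequentially"
      unfolding filterlim_at using LIMSEQ_inverse_real_of_nat by simp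
    ultimately have "(\<lambda>n. (\<phi> (x + ?h n *\<^sub>R e) - \<phi> x) / ?h n) \<longlonglongrightarrow> D x e"
      by (rule filterlim_compose)
    then show ?thesis by (simp add: add.commute)
  qed
  have Z0: "AE x in lebesgue. x \<notin> Z"
    using Z by (intro AE_not_in) (simp add: negligible_iff_null_sets)
  have AE_lim: "AE x in lebesgue. (\<lambda>n. ?q n x) \<longlonglongrightarrow> D x e"
    using Z0 by eventually_elim (rule lim)
  have qmeas': "?q n \<in> borel_measurable lebesgue" for n
    using qmeas by (intro measurable_completion) simp
  have Dmeas: "(\<lambda>x. D x e) \<in> borel_measurable lebesgue"
  proof -
    let ?l = "\<lambda>x. lim (\<lambda>n. ?q n x)"
    have "?l \<in> borel_measurable lebesgue"
      by (intro borel_measurable_lim_metric qmeas')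
    moreover have "AE x in lebesgue. ?l x = D x e"
      using AE_lim by eventually_elim (rule limI)
    ultimately show ?thesis
      by (rule borel_measurable_lebesgue_on_cong_AE[of UNIV, unfolded lebesgue_on_UNIV_eq, rotated]) simp
  qed
  have dom: "integrable lebesgue (\<lambda>x. L * norm e * indicator (cball (0::'a) (R + norm e)) x)"
    by (intro integrable_mult_right integrable_real_indicator) (auto simp: emeasure_bounded_finite[OF bounded_cball, unfolded infinity_ennreal_def])
  have dbound: "AE x in lebesgue. norm (?q n x) \<le> L * norm e * indicator (cball 0 (R + norm e)) x" for n
    using bound by (intro AE_I2) simp
  show "integrable lebesgue (\<lambda>x. D x e)"
    by (rule integrable_dominated_convergence[OF Dmeas qmeas' dom AE_lim dbound])
  have "(\<lambda>n. \<integral>x. ?q n x \<partial>lebesgue) \<longlonglongrightarrow> (\<integral>x. D x e \<partial>lebesgue)"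
    by (rule integral_dominated_convergence[OF Dmeas qmeas' dom AE_lim dbound])
  then have "(\<lambda>n::nat. 0) \<longlonglongrightarrow> (\<integral>x. D x e \<partial>lebesgue)"
    by (simp only: int0)
  then show "(\<integral>x. D x e \<partial>lebesgue) = 0"
    using LIMSEQ_unique tendsto_const by blast
qed

lemma test_function_lipschitz:
  fixes \<psi> :: "'a::euclidean_space \<Rightarrow> 'b::euclidean_space"
  assumes "\<psi> \<in> test_functions A"
  obtains L where "L > 0" "L-lipschitz_on UNIV \<psi>"
proof -
  let ?D = "\<lambda>x. frechet_derivative \<psi> (at x)"
  obtain K where K: "compact K" "K \<subseteq> A" "\<And>x. x \<notin> K \<Longrightarrow> \<psi> x = 0" "\<And>x. x \<notin> K \<Longrightarrow> ?D x = (\<lambda>v. 0)"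
    using test_functions_support[OF assms] by blast
  have "\<exists>B. \<forall>x. norm (?D x b) \<le> B" for b
  proof -
    have "bounded ((\<lambda>x. ?D x b) ` K)"
      by (intro compact_imp_bounded compact_continuous_image K(1)
          continuous_on_subset[OF test_functions_derivative_continuous[OF assms]]) auto
    then obtain B where B: "\<And>x. x \<in> K \<Longrightarrow> norm (?D x b) \<le> B"
      unfolding bounded_iff by blast
    have "norm (?D x b) \<le> max B 0" for x
      using B[of x] K(4)[of x] by (cases "x \<in> K") auto
    then show ?thesis by blast
  qed
  then obtain B where B: "\<And>b x. norm (?D x b) \<le> B b" by metis
  define L where "L = 1 + (\<Sum>b\<in>Basis. B b)"
  have B0: "B b \<ge> 0" for b using B[of undefined b] norm_ge_zero order_trans by blast
  have "L-lipschitz_on UNIV \<psi>"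
  proof (rule bounded_derivative_imp_lipschitz)
    show "(\<psi> has_derivative ?D x) (at x within UNIV)" for x
      using has_frechet_derivative[OF test_functions_differentiable[OF assms]] by simp
    show "onorm (?D x) \<le> L" for x
    proof (rule onorm_le)
      fix v
      have lin: "linear (?D x)"
        by (rule linear_frechet_derivative[OF test_functions_differentiable[OF assms]])
      have "norm (?D x v) = norm (\<Sum>b\<in>Basis. (v \<bullet> b) *\<^sub>R ?D x b)"
        using linear_sum[OF lin, of "\<lambda>b. (v \<bullet> b) *\<^sub>R b" Basis] linear_scale[OF lin]
        by (simp add: euclidean_representation)
      also have "\<dots> \<le> (\<Sum>b\<in>Basis. norm v * B b)"
        by (rule sum_norm_le) (use B B0 Basis_le_norm in \<open>auto intro!: mult_mono\<close>)
      also have "\<dots> = norm v * (\<Sum>b\<in>Basis. B b)" by (simp add: sum_distrib_left)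
      also have "\<dots> \<le> L * norm v" by (simp add: L_def algebra_simps)
      finally show "norm (?D x v) \<le> L * norm v" .
    qed
    show "0 \<le> L" by (auto simp: L_def intro!: add_nonneg_nonneg sum_nonneg B0)
  qed simp
  moreover have "L > 0" by (auto simp: L_def intro!: add_pos_nonneg sum_nonneg B0)
  ultimately show thesis using that by blast
qed

lemma mat_inner_grad: "mat 1 \<bullet> grad \<psi> x = (\<Sum>j\<in>UNIV. frechet_derivative \<psi> (at x) (axis j 1) $ j)"
proof -
  have "mat 1 \<bullet> grad \<psi> x = (\<Sum>i\<in>UNIV. \<Sum>j\<in>UNIV. (if i = j then 1 else 0) * grad \<psi> x $ i $ j)"
    by (simp add: inner_vec_def mat_def)
  also have "\<dots> = (\<Sum>i\<in>UNIV. grad \<psi> x $ i $ i)"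
    by (simp add: if_distrib[where f = "\<lambda>z. z * _"] cong: if_cong)
  finally show ?thesis by (simp add: grad_component)
qed

lemma test_function_bounded:
  fixes \<psi> :: "'a::euclidean_space \<Rightarrow> 'b::euclidean_space"
  assumes "\<psi> \<in> test_functions A"
  obtains B where "B > 0" "\<And>x. norm (\<psi> x) \<le> B"
proof -
  obtain K where K: "compact K" "K \<subseteq> A" "\<And>x. x \<notin> K \<Longrightarrow> \<psi> x = 0"
    "\<And>x. x \<notin> K \<Longrightarrow> frechet_derivative \<psi> (at x) = (\<lambda>v. 0)"
    using test_functions_support[OF assms] by blast
  have "bounded (\<psi> ` K)"
    by (intro compact_imp_bounded compact_continuous_image K(1)
        continuous_on_subset[OF test_functions_continuous[OF assms]]) auto
  then obtain B where B: "B > 0" "\<And>x. x \<in> K \<Longrightarrow> norm (\<psi> x) \<le> B"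
    unfolding bounded_pos by blast
  have "norm (\<psi> x) \<le> B" for x
    using B(2)[of x] K(3)[of x] B(1) by (cases "x \<in> K") auto
  then show thesis using B(1) that by blast
qed

text \<open>The divergence of the Lipschitz field \<open>max 0 (t - norm (x - a)) *\<^sub>R \<psi>
  x\<close> integrates to 0.\<close>

lemma radial_cutoff_identity:
  fixes \<psi> :: "real^'n \<Rightarrow> real^'n"
  assumes \<psi>: "\<psi> \<in> test_functions A" and t: "t > 0"
  shows "integrable lebesgue (\<lambda>x. max 0 (t - norm (x - a)) * (mat 1 \<bullet> grad \<psi> x))" (is ?i1)
    and "integrable lebesgue (\<lambda>x. indicator (ball a t) x * (sgn (x - a) \<bullet> \<psi> x))" (is ?i2)
    and "(\<integral>x. max 0 (t - norm (x - a)) * (mat 1 \<bullet> grad \<psi> x) \<partial>lebesgue)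
      = (\<integral>x. indicator (ball a t) x * (sgn (x - a) \<bullet> \<psi> x) \<partial>lebesgue)" (is ?eq)
proof -
  let ?w = "\<lambda>x. max 0 (t - norm (x - a))"
  let ?D = "\<lambda>x. frechet_derivative \<psi> (at x)"
  let ?E = "\<lambda>j x v. if x \<in> ball a t then (t - norm (x - a)) * (?D x v $ j) - (sgn (x - a) \<bullet> v) * \<psi> x $ j else 0"
  obtain L where L: "L > 0" "L-lipschitz_on UNIV \<psi>"
    using test_function_lipschitz[OF \<psi>] by blast
  obtain B where B: "B > 0" "\<And>x. norm (\<psi> x) \<le> B"
    using test_function_bounded[OF \<psi>] by blast
  have *: "(\<integral>x. ?E j x (axis j 1) \<partial>lebesgue) = 0" "integrable lebesgue (\<lambda>x. ?E j x (axis j 1))" for j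
  proof -
    have lip: "(t * L + B)-lipschitz_on UNIV (\<lambda>x. ?w x * \<psi> x $ j)"
    proof (rule lipschitz_onI)
      fix x y
      have 1: "\<bar>?w x\<bar> \<le> t" "\<bar>?w x - ?w y\<bar> \<le> dist x y"
        using t norm_triangle_ineq3[of "x - a" "y - a"] by (auto simp: dist_norm max_def)
      have 2: "\<bar>\<psi> y $ j\<bar> \<le> B"
        using component_le_norm_cart[of "\<psi> y" j] B(2)[of y] by linarith
      have 3: "\<bar>\<psi> x $ j - \<psi> y $ j\<bar> \<le> L * dist x y"
        using component_le_norm_cart[of "\<psi> x - \<psi> y" j] lipschitz_onD[OF L(2), of x y] by (simp add: dist_norm)
      have "?w x * \<psi> x $ j - ?w y * \<psi> y $ j = ?w x * (\<psi> x $ j - \<psi> y $ j) + \<psi> y $ j * (?w x - ?w y)"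
        by (simp add: algebra_simps)
      then have "\<bar>?w x * \<psi> x $ j - ?w y * \<psi> y $ j\<bar>
          \<le> \<bar>?w x\<bar> * \<bar>\<psi> x $ j - \<psi> y $ j\<bar> + \<bar>\<psi> y $ j\<bar> * \<bar>?w x - ?w y\<bar>"
        unfolding abs_mult[symmetric] by (simp only: abs_triangle_ineq)
      also have "\<dots> \<le> t * (L * dist x y) + B * dist x y"
        by (rule add_mono[OF mult_mono[OF 1(1) 3] mult_mono[OF 2 1(2)]]) (use t B(1) in simp_all)
      finally show "dist (?w x * \<psi> x $ j) (?w y * \<psi> y $ j) \<le> (t * L + B) * dist x y"
        by (simp add: dist_real_def algebra_simps)
    qed (use t L B in auto)
    have supp: "?w x * \<psi> x $ j = 0" if "x \<notin> ball 0 (norm a + t)" for x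
      using that norm_triangle_sub[of x a] by (simp add: norm_minus_commute)
    have neg: "negligible (sphere a t \<union> {a})"
      by (simp add: negligible_Un negligible_sphere)
    have der: "((\<lambda>x. ?w x * \<psi> x $ j) has_derivative ?E j x) (at x)" if "x \<notin> sphere a t \<union> {a}" for x
    proof (cases "x \<in> ball a t")
      case True
      have "x \<noteq> a" using that by auto
      then have "((\<lambda>x. (t - norm (x - a)) * \<psi> x $ j) has_derivative
          (\<lambda>v. (t - norm (x - a)) * (?D x v $ j) - (sgn (x - a) \<bullet> v) * \<psi> x $ j)) (at x)"
        by (auto intro!: derivative_eq_intros has_derivative_compose[OF _ has_derivative_norm, where f = "\<lambda>x. x - a"]
            bounded_linear.has_derivative[OF bounded_linear_vec_nth]
            has_frechet_derivative[OF test_functions_differentiable[OF \<psi>]] simp: algebra_simps inner_commute)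
      then have "((\<lambda>x. ?w x * \<psi> x $ j) has_derivative
          (\<lambda>v. (t - norm (x - a)) * (?D x v $ j) - (sgn (x - a) \<bullet> v) * \<psi> x $ j)) (at x)"
        by (rule has_derivative_transform_within_open[of _ _ _ _ "ball a t"])
          (use True in \<open>auto simp: dist_norm norm_minus_commute\<close>)
      then show ?thesis using True by simp
    next
      case False
      have out: "x \<in> - cball a t" using False that by (auto simp: not_less)
      have 0: "((\<lambda>x. 0::real) has_derivative (\<lambda>v. 0)) (at x)" by simp
      have "((\<lambda>x. ?w x * \<psi> x $ j) has_derivative (\<lambda>v. 0)) (at x)"
        by (rule has_derivative_transform_within_open[OF 0 _ out])
          (auto simp: dist_norm norm_minus_commute)
      then show ?thesis using False by simp
    qed
    show "(\<integral>x. ?E j x (axis j 1) \<partial>lebesgue) = 0" "integrable lebesgue (\<lambda>x. ?E j x (axis j 1))"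
      by (rule integral_derivative_Lipschitz_eq_0[OF lip supp neg der]; assumption)+
  qed
  have sum: "(\<Sum>j\<in>UNIV. ?E j x (axis j 1)) =
      ?w x * (mat 1 \<bullet> grad \<psi> x) - indicator (ball a t) x * (sgn (x - a) \<bullet> \<psi> x)" for x
  proof (cases "x \<in> ball a t")
    case True
    have "(\<Sum>j\<in>UNIV. (sgn (x - a) \<bullet> axis j 1) * \<psi> x $ j) = sgn (x - a) \<bullet> \<psi> x"
      by (simp only: inner_axis) (simp add: inner_vec_def)
    then show ?thesis
      using True by (simp add: sum_subtractf mat_inner_grad sum_distrib_left dist_norm norm_minus_commute)
  next
    case False
    then show ?thesis by (simp add: dist_norm norm_minus_commute)
  qed
  have "integrable lebesgue (\<lambda>x. \<Sum>j\<in>UNIV. ?E j x (axis j 1))"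
    using * by (intro Bochner_Integration.integrable_sum)
  then have isum: "integrable lebesgue (\<lambda>x. ?w x * (mat 1 \<bullet> grad \<psi> x) - indicator (ball a t) x * (sgn (x - a) \<bullet> \<psi> x))"
    by (simp only: sum)
  have "(\<integral>x. (\<Sum>j\<in>UNIV. ?E j x (axis j 1)) \<partial>lebesgue) = 0"
    using * by (subst Bochner_Integration.integral_sum) simp_all
  then have zero: "(\<integral>x. ?w x * (mat 1 \<bullet> grad \<psi> x) - indicator (ball a t) x * (sgn (x - a) \<bullet> \<psi> x) \<partial>lebesgue) = 0"
    by (simp only: sum)
  show i1: ?i1
  proof -
    have "(\<lambda>x. ?w x *\<^sub>R mat 1) \<in> L2 UNIV"
      by (rule continuous_compact_support_L2[of _ "cball a t"])
        (auto intro!: continuous_intros simp: dist_norm norm_minus_commute)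
    then have "integrable (lebesgue_on UNIV) (\<lambda>x. (?w x *\<^sub>R mat 1) \<bullet> grad \<psi> x)"
      by (intro L2_inner_integrable grad_L2[OF \<psi>]) auto
    then show ?thesis by (simp add: lebesgue_on_UNIV_eq)
  qed
  show i2: ?i2
    using Bochner_Integration.integrable_diff[OF i1 isum] by simp
  show ?eq
    using zero i1 i2 by simp
qed

lemma integral_lborel_scale:
  fixes H :: "'a::euclidean_space \<Rightarrow> real"
  assumes [measurable]: "H \<in> borel_measurable borel" and s: "s > 0"
  shows "(\<integral>x. H x \<partial>lborel) = s ^ DIM('a) * (\<integral>x. H (a + s *\<^sub>R (x - a)) \<partial>lborel)"
proof -
  let ?T = "\<lambda>x. (a - s *\<^sub>R a) + s *\<^sub>R x"
  have "lborel = density (distr lborel borel ?T) (\<lambda>_. ennreal (s ^ DIM('a)))"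
    using lborel_affine[of s "a - s *\<^sub>R a"] s by simp
  then have "(\<integral>x. H x \<partial>lborel) = (\<integral>x. H x \<partial>density (distr lborel borel ?T) (\<lambda>_. ennreal (s ^ DIM('a))))"
    by simp
  also have "\<dots> = (\<integral>x. s ^ DIM('a) *\<^sub>R H x \<partial>distr lborel borel ?T)"
    using s by (intro integral_density) auto
  also have "\<dots> = (\<integral>x. s ^ DIM('a) *\<^sub>R H (?T x) \<partial>lborel)"
    by (intro integral_distr) auto
  finally show ?thesis by (simp add: algebra_simps)
qed

text \<open>The substitution rule for the projection of the ball to the sphere, as in the
  definition of \<open>sphere_measure\<close>.\<close>

lemma integral_sphere_measure:
  fixes h :: "real^'n \<Rightarrow> real"
  assumes \<rho>: "\<rho> > 0" and [measurable]: "h \<in> borel_measurable borel"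
  shows "(\<integral>y. h y \<partial>sphere_measure a \<rho>) =
    real CARD('n) / \<rho> * (\<integral>x. h (a + \<rho> *\<^sub>R sgn (x - a)) \<partial>lebesgue_on (ball a \<rho>))"
proof -
  let ?T = "\<lambda>x. a + (\<rho> / norm (x - a)) *\<^sub>R (x - a)"
  let ?M = "distr (lebesgue_on (ball a \<rho>)) borel ?T"
  have "?T \<in> borel_measurable lebesgue"
    by (intro measurable_completion) measurable
  then have T[measurable]: "?T \<in> borel_measurable (lebesgue_on (ball a \<rho>))"
    by (rule measurable_restrict_space1)
  have "scale_measure (ennreal k) ?M = density ?M (\<lambda>_. ennreal k)" for k
    by (rule measure_eqI) (simp_all add: emeasure_density_const)
  then have "(\<integral>y. h y \<partial>sphere_measure a \<rho>) = (\<integral>y. h y \<partial>density ?M (\<lambda>_. ennreal (real CARD('n) / \<rho>)))"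
    by (simp add: sphere_measure_def)
  also have "\<dots> = (\<integral>y. (real CARD('n) / \<rho>) *\<^sub>R h y \<partial>?M)"
    using \<rho> by (intro integral_density) auto
  also have "\<dots> = (\<integral>x. (real CARD('n) / \<rho>) *\<^sub>R h (?T x) \<partial>lebesgue_on (ball a \<rho>))"
    by (intro integral_distr T) simp
  finally show ?thesis
    by (simp add: sgn_div_norm divide_inverse)
qed

lemma borel_measurable_ball_indicator_times:
  fixes h :: "'a::euclidean_space \<Rightarrow> real"
  assumes "h \<in> borel_measurable borel"
  shows "(\<lambda>x. indicator (ball a t) x * h x) \<in> borel_measurable borel"
  by (rule borel_measurable_times[OF borel_measurable_indicator assms]) simp

lemma integral_ball_homogeneous:
  fixes G :: "'a::euclidean_space \<Rightarrow> real"
  assumes G: "G \<in> borel_measurable borel" and s: "s > 0"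
    and hom: "\<And>x. G (a + s *\<^sub>R (x - a)) = G x"
  shows "(\<integral>x. indicator (ball a (s * \<rho>)) x * G x \<partial>lebesgue)
    = s ^ DIM('a) * (\<integral>x. indicator (ball a \<rho>) x * G x \<partial>lebesgue)"
proof -
  have ind: "indicator (ball a (s * \<rho>)) (a + s *\<^sub>R (x - a)) = (indicator (ball a \<rho>) x :: real)" for x
    using s by (auto simp: indicator_def dist_norm norm_minus_commute)
  have "(\<integral>x. indicator (ball a (s * \<rho>)) x * G x \<partial>lborel)
    = s ^ DIM('a) * (\<integral>x. indicator (ball a \<rho>) x * G x \<partial>lborel)"
    using integral_lborel_scale[OF borel_measurable_ball_indicator_times[OF G], of s a "s * \<rho>" a] s
    by (simp add: ind hom)
  moreover have "(\<integral>x. indicator (ball a t) x * G x \<partial>lebesgue) = (\<integral>x. indicator (ball a t) x * G x \<partial>lborel)" for t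
    using borel_measurable_ball_indicator_times[OF G] by (intro integral_completion) simp
  ultimately show ?thesis
    by simp
qed

text \<open>Let \<open>F(t)\<close> be the common value of the two sides of
  \<open>radial_cutoff_identity\<close>. The difference quotient of \<open>F\<close> over
  \<open>[s \<rho>, \<rho>]\<close> tends, as \<open>s \<rightarrow> 1\<close>, to the integral of
  the divergence over the ball if it is computed from the left side. Computed from the right side,
  it is the integral of the radial component of \<open>\<psi>\<close> over a thin shell, divided
  by the thickness of the shell; up to an error of the order of the volume of the shell, this
  component may be replaced by its value at the projection to the sphere. That is homogeneous of
  degree 0, so its integral over the shell is \<open>1 - s ^ d\<close> times that over the ball,
  and \<open>(1 - s ^ d) / (1 - s)\<close> tends to the factor \<open>d\<close> of the cone
  formula for surface measure.\<close>

theorem divergence_theorem_ball: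
  fixes \<psi> :: "real^'n \<Rightarrow> real^'n"
  assumes \<psi>: "\<psi> \<in> test_functions A" and \<rho>: "\<rho> > 0"
  shows "(\<integral>x. mat 1 \<bullet> grad \<psi> x \<partial>lebesgue_on (ball a \<rho>))
    = (\<integral>y. ((1 / \<rho>) *\<^sub>R (y - a)) \<bullet> \<psi> y \<partial>sphere_measure a \<rho>)"
proof -
  let ?d = "CARD('n)"
  let ?dv = "\<lambda>x. mat 1 \<bullet> grad \<psi> x"
  let ?f = "\<lambda>x. sgn (x - a) \<bullet> \<psi> x"
  let ?g = "\<lambda>x. sgn (x - a) \<bullet> \<psi> (a + \<rho> *\<^sub>R sgn (x - a))"
  let ?I = "\<lambda>t h. \<integral>x. indicator (ball a t) x * h x \<partial>lebesgue"
  let ?F = "\<lambda>t. \<integral>x. max 0 (t - norm (x - a)) * ?dv x \<partial>lebesgue"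
  obtain L where L: "L > 0" "L-lipschitz_on UNIV \<psi>"
    using test_function_lipschitz[OF \<psi>] by blast
  obtain B where B: "B > 0" "\<And>x. norm (\<psi> x) \<le> B"
    using test_function_bounded[OF \<psi>] by blast
  have [measurable]: "\<psi> \<in> borel_measurable borel"
    by (intro borel_measurable_continuous_onI test_functions_continuous[OF \<psi>])
  have gm[measurable]: "?g \<in> borel_measurable borel"
    unfolding sgn_div_norm by measurable
  have gb: "\<bar>?g x\<bar> \<le> B" for x
  proof -
    have "\<bar>?g x\<bar> \<le> norm (sgn (x - a)) * norm (\<psi> (a + \<rho> *\<^sub>R sgn (x - a)))"
      by (rule Cauchy_Schwarz_ineq2)
    also have "\<dots> \<le> 1 * B"
      using B by (intro mult_mono) (auto simp: norm_sgn)
    finally show ?thesis by simp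
  qed
  have bi: "integrable lebesgue (\<lambda>x. indicator (ball a t) x :: real)" for t
    by (intro integrable_real_indicator)
      (auto simp: emeasure_bounded_finite[OF bounded_ball, unfolded infinity_ennreal_def])
  have gi: "integrable lebesgue (\<lambda>x. indicator (ball a t) x * ?g x)" for t
  proof (rule Bochner_Integration.integrable_bound)
    show "integrable lebesgue (\<lambda>x. B * indicator (ball a t) x)"
      using bi by simp
    show "AE x in lebesgue. norm (indicator (ball a t) x * ?g x) \<le> norm (B * indicator (ball a t) x)"
      using gb B(1) by (intro AE_I2) (simp add: abs_mult indicator_def)
    show "(\<lambda>x. indicator (ball a t) x * ?g x) \<in> borel_measurable lebesgue"
      using borel_measurable_ball_indicator_times[OF gm] by (intro measurable_completion) simp
  qed
  have dvL2: "integrable lebesgue (\<lambda>x. indicator (ball a \<rho>) x * ?dv x)"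
  proof -
    have "(\<lambda>x. mat 1 :: real^'n^'n) \<in> L2 (ball a \<rho>)"
      by (intro bounded_const_L2) simp
    then have "integrable (lebesgue_on (ball a \<rho>)) ?dv"
      by (intro L2_inner_integrable grad_L2[OF \<psi>]) simp_all
    then show ?thesis by (simp add: integrable_restrict_space)
  qed
  have dvi: "?I \<rho> ?dv = (\<integral>x. ?dv x \<partial>lebesgue_on (ball a \<rho>))"
    by (simp add: integral_restrict_space)
  \<comment> \<open>two shifts keep \<open>s n\<close> positive for \<open>n = 0\<close>\<close>
  define s where "s n = 1 - inverse (real (Suc (Suc n)))" for n
  have s: "0 < s n" "s n < 1" for n
    by (auto simp: s_def inverse_less_1_iff)
  have slim: "s \<longlonglongrightarrow> 1"
  proof -
    have "(\<lambda>n. 1 - inverse (real (Suc (Suc n)))) \<longlonglongrightarrow> 1 - 0"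
      by (intro tendsto_intros LIMSEQ_Suc[OF LIMSEQ_inverse_real_of_nat])
    then show ?thesis by (simp add: s_def[abs_def])
  qed
  define Q where "Q n = (?F \<rho> - ?F (s n * \<rho>)) / ((1 - s n) * \<rho>)" for n
  let ?k = "\<lambda>n x. (max 0 (\<rho> - norm (x - a)) - max 0 (s n * \<rho> - norm (x - a))) / ((1 - s n) * \<rho>)"
  have den: "(1 - s n) * \<rho> > 0" for n using s[of n] \<rho> by simp
  have k: "?k n x \<ge> 0" "?k n x \<le> indicator (ball a \<rho>) x" for n x
  proof -
    have "s n * \<rho> \<le> \<rho>" using s[of n] \<rho> by simp
    then have "0 \<le> max 0 (\<rho> - norm (x - a)) - max 0 (s n * \<rho> - norm (x - a))"
      "max 0 (\<rho> - norm (x - a)) - max 0 (s n * \<rho> - norm (x - a)) \<le> indicator (ball a \<rho>) x * ((1 - s n) * \<rho>)"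
      by (auto simp: indicator_def dist_norm norm_minus_commute algebra_simps max_def)
    then show "?k n x \<ge> 0" "?k n x \<le> indicator (ball a \<rho>) x"
      using den[of n] by (auto simp: pos_divide_le_eq)
  qed
  \<comment> \<open>the cutoffs \<open>?k n\<close> are bounded by, and tend to, the indicator function of the ball\<close>
  have Q1: "Q \<longlonglongrightarrow> ?I \<rho> ?dv"
  proof -
    have "(\<lambda>n. \<integral>x. ?k n x * ?dv x \<partial>lebesgue) \<longlonglongrightarrow> ?I \<rho> ?dv"
    proof (rule integral_dominated_convergence)
      show "integrable lebesgue (\<lambda>x. \<bar>indicator (ball a \<rho>) x * ?dv x\<bar>)"
        using dvL2 by (rule integrable_abs)
      show "AE x in lebesgue. norm (?k n x * ?dv x) \<le> \<bar>indicator (ball a \<rho>) x * ?dv x\<bar>" for n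
      proof (intro AE_I2)
        fix x
        have "\<bar>?k n x\<bar> \<le> \<bar>indicator (ball a \<rho>) x\<bar>"
          using k[of x n] by (simp only: abs_of_nonneg abs_indicator)
        then show "norm (?k n x * ?dv x) \<le> \<bar>indicator (ball a \<rho>) x * ?dv x\<bar>"
          unfolding real_norm_def abs_mult by (rule mult_right_mono) simp
      qed
      show "(\<lambda>x. indicator (ball a \<rho>) x * ?dv x) \<in> borel_measurable lebesgue"
        using dvL2 by auto
      have [measurable]: "?dv \<in> borel_measurable borel"
        by (intro borel_measurable_continuous_onI continuous_intros grad_continuous[OF \<psi>])
      show "(\<lambda>x. ?k n x * ?dv x) \<in> borel_measurable lebesgue" for n
        by (intro measurable_completion) measurable
      show "AE x in lebesgue. (\<lambda>n. ?k n x * ?dv x) \<longlonglongrightarrow> indicator (ball a \<rho>) x * ?dv x"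
      proof (intro AE_I2 tendsto_mult tendsto_const)
        fix x
        show "(\<lambda>n. ?k n x) \<longlonglongrightarrow> indicator (ball a \<rho>) x"
        proof (cases "x \<in> ball a \<rho>")
          case False
          then have "?k n x = indicator (ball a \<rho>) x" for n
            using k[of x n] by (intro antisym) simp_all
          then show ?thesis by (intro tendsto_eventually always_eventually) blast
        next
          case True
          then have x: "norm (x - a) < \<rho>" by (simp add: dist_norm norm_minus_commute)
          have "(\<lambda>n. s n * \<rho>) \<longlonglongrightarrow> 1 * \<rho>" by (intro tendsto_intros slim)
          then have "\<forall>\<^sub>F n in sequentially. norm (x - a) < s n * \<rho>"
            using x by (intro order_tendstoD) simp
          then have "\<forall>\<^sub>F n in sequentially. ?k n x = indicator (ball a \<rho>) x"
          proof eventually_elim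
            case (elim n)
            then have e: "max 0 (\<rho> - norm (x - a)) - max 0 (s n * \<rho> - norm (x - a)) = (1 - s n) * \<rho>"
              using x by (simp add: algebra_simps)
            show ?case unfolding e using s[of n] \<rho> True by simp
          qed
          then show ?thesis
            by (rule tendsto_eventually)
        qed
      qed
    qed
    moreover have "(\<integral>x. ?k n x * ?dv x \<partial>lebesgue) = Q n" for n
    proof -
      have "(\<integral>x. ?k n x * ?dv x \<partial>lebesgue) =
          (\<integral>x. (max 0 (\<rho> - norm (x - a)) * ?dv x - max 0 (s n * \<rho> - norm (x - a)) * ?dv x)
            / ((1 - s n) * \<rho>) \<partial>lebesgue)"
        by (simp add: left_diff_distrib diff_divide_distrib)
      also have "\<dots> = Q n"
        unfolding Q_def using radial_cutoff_identity(1)[OF \<psi>] \<rho> s by simp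
      finally show ?thesis .
    qed
    ultimately show ?thesis by (simp only:)
  qed
  have Q2: "\<bar>Q n - (1 - s n ^ ?d) / (1 - s n) * (?I \<rho> ?g / \<rho>)\<bar> \<le> L * ((1 - s n ^ ?d) * ?I \<rho> (\<lambda>x. 1))" for n
  proof -
    note sn = s[of n]
    have g: "?I (s n * \<rho>) ?g = s n ^ ?d * ?I \<rho> ?g"
      using integral_ball_homogeneous[OF gm sn(1), of a \<rho>] sn(1) by (simp add: sgn_scaleR)
    have v: "?I (s n * \<rho>) (\<lambda>x. 1) = s n ^ ?d * ?I \<rho> (\<lambda>x. 1)"
      using integral_ball_homogeneous[of "\<lambda>x. 1" "s n" a \<rho>] sn(1) by simp
    have sr: "s n * \<rho> > 0" "s n * \<rho> < \<rho>" using sn \<rho> by auto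
    have fi: "integrable lebesgue (\<lambda>x. indicator (ball a t) x * ?f x)" if "t > 0" for t
      by (rule radial_cutoff_identity(2)[OF \<psi> that])
    have eq: "?F t = ?I t ?f" if "t > 0" for t
      by (rule radial_cutoff_identity(3)[OF \<psi> that])
    let ?A = "\<lambda>x. indicator (ball a \<rho>) x - indicator (ball a (s n * \<rho>)) x :: real"
    have A: "?A x = (if s n * \<rho> \<le> norm (x - a) \<and> norm (x - a) < \<rho> then 1 else 0)" for x
      using sr by (auto simp: indicator_def dist_norm norm_minus_commute)
    have Ai: "integrable lebesgue (\<lambda>x. ?A x * (?f x - ?g x))"
      using fi[OF sr(1)] fi[OF \<rho>] gi by (simp add: algebra_simps)
    \<comment> \<open>\<open>?A\<close> is the indicator function of the shell, where \<open>x\<close> is \<open>(1 - s n) * \<rho>\<close>-close to its projection\<close>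
    have "\<bar>\<integral>x. ?A x * (?f x - ?g x) \<partial>lebesgue\<bar> \<le> (\<integral>x. \<bar>?A x * (?f x - ?g x)\<bar> \<partial>lebesgue)"
      by (rule integral_abs_bound)
    also have "\<dots> \<le> (\<integral>x. L * ((1 - s n) * \<rho>) * ?A x \<partial>lebesgue)"
    proof (rule Bochner_Integration.integral_mono)
      show "integrable lebesgue (\<lambda>x. \<bar>?A x * (?f x - ?g x)\<bar>)"
        using Ai by (rule integrable_abs)
      show "integrable lebesgue (\<lambda>x. L * ((1 - s n) * \<rho>) * ?A x)"
        using bi by simp
      fix x
      show "\<bar>?A x * (?f x - ?g x)\<bar> \<le> L * ((1 - s n) * \<rho>) * ?A x"
      proof (cases "s n * \<rho> \<le> norm (x - a) \<and> norm (x - a) < \<rho>")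
        case True
        then have xa: "norm (x - a) > 0" using sr by linarith
        have e: "x - (a + \<rho> *\<^sub>R sgn (x - a)) = (norm (x - a) - \<rho>) *\<^sub>R sgn (x - a)"
          using xa by (simp add: sgn_div_norm algebra_simps)
        have "dist x (a + \<rho> *\<^sub>R sgn (x - a)) = \<bar>norm (x - a) - \<rho>\<bar>"
          unfolding dist_norm e using xa by (simp add: norm_sgn)
        then have "dist x (a + \<rho> *\<^sub>R sgn (x - a)) \<le> (1 - s n) * \<rho>"
          using True by (simp add: left_diff_distrib)
        then have "dist (\<psi> x) (\<psi> (a + \<rho> *\<^sub>R sgn (x - a))) \<le> L * ((1 - s n) * \<rho>)"
          using lipschitz_onD[OF L(2), of x "a + \<rho> *\<^sub>R sgn (x - a)"] L(1)
          by (meson UNIV_I mult_left_mono less_imp_le order_trans)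
        moreover have "\<bar>?f x - ?g x\<bar> \<le> norm (sgn (x - a)) * norm (\<psi> x - \<psi> (a + \<rho> *\<^sub>R sgn (x - a)))"
          unfolding inner_diff_right[symmetric] by (rule Cauchy_Schwarz_ineq2)
        ultimately show ?thesis
          using A[of x] True xa by (simp add: dist_norm norm_sgn)
      next
        case False
        then have z: "?A x = 0"
          by (subst A) (rule if_not_P)
        show ?thesis unfolding z by simp
      qed
    qed
    also have "\<dots> = L * ((1 - s n) * \<rho>) * ((1 - s n ^ ?d) * ?I \<rho> (\<lambda>x. 1))"
      using bi v by (simp add: algebra_simps)
    finally have bound: "\<bar>\<integral>x. ?A x * (?f x - ?g x) \<partial>lebesgue\<bar> \<le> L * ((1 - s n) * \<rho>) * ((1 - s n ^ ?d) * ?I \<rho> (\<lambda>x. 1))" .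
    have "(\<integral>x. ?A x * (?f x - ?g x) \<partial>lebesgue) = (\<integral>x. (indicator (ball a \<rho>) x * ?f x - indicator (ball a (s n * \<rho>)) x * ?f x)
        - (indicator (ball a \<rho>) x * ?g x - indicator (ball a (s n * \<rho>)) x * ?g x) \<partial>lebesgue)"
      by (simp add: algebra_simps)
    also have "\<dots> = (?I \<rho> ?f - ?I (s n * \<rho>) ?f) - (?I \<rho> ?g - ?I (s n * \<rho>) ?g)"
      using fi[OF sr(1)] fi[OF \<rho>] gi by simp
    also have "\<dots> = (1 - s n) * \<rho> * (Q n - (1 - s n ^ ?d) / (1 - s n) * (?I \<rho> ?g / \<rho>))"
    proof -
      have "X - Y - (G - e * G) = (1 - s n) * \<rho> * ((X - Y) / ((1 - s n) * \<rho>) - (1 - e) / (1 - s n) * (G / \<rho>))"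
        for X Y G e :: real
      proof -
        have "(1 - e) / (1 - s n) * (G / \<rho>) = (1 - e) * G / ((1 - s n) * \<rho>)" by simp
        moreover have "X - Y - (G - e * G) = c * ((X - Y) / c - (1 - e) * G / c)" if "c \<noteq> 0" for c
          using that by (simp add: field_simps)
        ultimately show ?thesis using den[of n] by (metis less_irrefl)
      qed
      then show ?thesis
        unfolding Q_def eq[OF \<rho>] eq[OF sr(1)] g .
    qed
    finally have e: "(\<integral>x. ?A x * (?f x - ?g x) \<partial>lebesgue)
        = (1 - s n) * \<rho> * (Q n - (1 - s n ^ ?d) / (1 - s n) * (?I \<rho> ?g / \<rho>))" .
    have "(1 - s n) * \<rho> * \<bar>Q n - (1 - s n ^ ?d) / (1 - s n) * (?I \<rho> ?g / \<rho>)\<bar>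
        = \<bar>(1 - s n) * \<rho> * (Q n - (1 - s n ^ ?d) / (1 - s n) * (?I \<rho> ?g / \<rho>))\<bar>"
      unfolding abs_mult[of "(1 - s n) * \<rho>"] abs_of_pos[OF den] ..
    also have "\<dots> \<le> L * ((1 - s n) * \<rho>) * ((1 - s n ^ ?d) * ?I \<rho> (\<lambda>x. 1))"
      using bound unfolding e .
    also have "\<dots> = (1 - s n) * \<rho> * (L * ((1 - s n ^ ?d) * ?I \<rho> (\<lambda>x. 1)))"
      by (simp only: mult.assoc mult.left_commute[of L])
    finally have "(1 - s n) * \<rho> * \<bar>Q n - (1 - s n ^ ?d) / (1 - s n) * (?I \<rho> ?g / \<rho>)\<bar>
        \<le> (1 - s n) * \<rho> * (L * ((1 - s n ^ ?d) * ?I \<rho> (\<lambda>x. 1)))" .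
    then show ?thesis
      using den[of n] by (simp only: mult_le_cancel_left_pos)
  qed
  have ratio: "(\<lambda>n. (1 - s n ^ ?d) / (1 - s n)) \<longlonglongrightarrow> real ?d"
  proof -
    have "(1 - s n ^ ?d) / (1 - s n) = (\<Sum>i<?d. s n ^ i)" for n
      using s[of n] by (simp add: one_diff_power_eq)
    moreover have "(\<lambda>n. \<Sum>i<?d. s n ^ i) \<longlonglongrightarrow> (\<Sum>i<?d. 1 ^ i)"
      by (intro tendsto_intros slim)
    ultimately show ?thesis by (simp only: power_one) simp
  qed
  have "(\<lambda>n. L * ((1 - s n ^ ?d) * ?I \<rho> (\<lambda>x. 1))) \<longlonglongrightarrow> L * ((1 - 1 ^ ?d) * ?I \<rho> (\<lambda>x. 1))"
    by (intro tendsto_intros slim)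
  then have bound0: "(\<lambda>n. L * ((1 - s n ^ ?d) * ?I \<rho> (\<lambda>x. 1))) \<longlonglongrightarrow> 0"
    by (simp only: power_one diff_self mult_zero_left mult_zero_right)
  have "(\<lambda>n. Q n - (1 - s n ^ ?d) / (1 - s n) * (?I \<rho> ?g / \<rho>)) \<longlonglongrightarrow> 0"
    by (rule Lim_null_comparison[OF _ bound0], rule always_eventually) (simp only: real_norm_def Q2 simp_thms)
  moreover have "(\<lambda>n. Q n - (1 - s n ^ ?d) / (1 - s n) * (?I \<rho> ?g / \<rho>)) \<longlonglongrightarrow> ?I \<rho> ?dv - real ?d * (?I \<rho> ?g / \<rho>)"
    by (intro tendsto_intros Q1 ratio)
  ultimately have "0 = ?I \<rho> ?dv - real ?d * (?I \<rho> ?g / \<rho>)"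
    by (rule LIMSEQ_unique)
  then have "?I \<rho> ?dv = real ?d * (?I \<rho> ?g / \<rho>)" by simp
  moreover have "(\<integral>y. ((1 / \<rho>) *\<^sub>R (y - a)) \<bullet> \<psi> y \<partial>sphere_measure a \<rho>) = real ?d / \<rho> * ?I \<rho> ?g"
    using \<rho> by (subst integral_sphere_measure) (simp_all add: integral_restrict_space)
  ultimately show ?thesis
    unfolding dvi by (simp only: times_divide_eq_left times_divide_eq_right)
qed

section \<open>Traces\<close>

lemma hausdorff_null_Un:
  assumes "hausdorff_null s A" "hausdorff_null s B"
  shows "hausdorff_null s (A \<union> B)"
  unfolding hausdorff_null_def
proof (intro allI impI)
  fix e :: real assume "e > 0"
  then obtain C D where
    C: "A \<subseteq> (\<Union>k. C k)" "\<And>k. bounded (C k)" "summable (\<lambda>k. diameter (C k) ^ s)" "(\<Sum>k. diameter (C k) ^ s) < e / 2" and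
    D: "B \<subseteq> (\<Union>k. D k)" "\<And>k. bounded (D k)" "summable (\<lambda>k. diameter (D k) ^ s)" "(\<Sum>k. diameter (D k) ^ s) < e / 2"
    using assms[unfolded hausdorff_null_def] by (metis half_gt_zero)
  \<comment> \<open>interleave the two covers\<close>
  let ?E = "\<lambda>n. if even n then C (n div 2) else D ((n - 1) div 2)"
  have "(\<lambda>n. if even n then diameter (C (n div 2)) ^ s else diameter (D ((n - 1) div 2)) ^ s)
      sums ((\<Sum>k. diameter (D k) ^ s) + (\<Sum>k. diameter (C k) ^ s))"
    using C(3) D(3) by (intro sums_if summable_sums)
  then have sums: "(\<lambda>n. diameter (?E n) ^ s) sums ((\<Sum>k. diameter (D k) ^ s) + (\<Sum>k. diameter (C k) ^ s))"
    by (simp add: if_distrib[where f = "\<lambda>X. diameter X ^ s"] cong: if_cong)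
  have "x \<in> (\<Union>n. ?E n)" if "x \<in> A \<union> B" for x
  proof -
    consider k where "x \<in> C k" | k where "x \<in> D k"
      using \<open>x \<in> A \<union> B\<close> C(1) D(1) by blast
    then show ?thesis
    proof cases
      case (1 k)
      then have "x \<in> ?E (2 * k)" by simp
      then show ?thesis by blast
    next
      case (2 k)
      then have "x \<in> ?E (2 * k + 1)" by simp
      then show ?thesis by blast
    qed
  qed
  then have "A \<union> B \<subseteq> (\<Union>n. ?E n)" by blast
  moreover have "\<forall>n. bounded (?E n)" using C(2) D(2) by simp
  moreover have "(\<Sum>n. diameter (?E n) ^ s) < e"
    using sums_unique[OF sums] C(4) D(4) by simp
  ultimately show "\<exists>E. A \<union> B \<subseteq> (\<Union>k. E k) \<and> (\<forall>k. bounded (E k)) \<and>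
      summable (\<lambda>k. diameter (E k) ^ s) \<and> (\<Sum>k. diameter (E k) ^ s) < e"
    using sums_summable[OF sums] by blast
qed

lemma hausdorff_null_empty: "s \<ge> 1 \<Longrightarrow> hausdorff_null s {}"
  by (auto simp: hausdorff_null_def power_0_left intro!: exI[of _ "\<lambda>k. {}"])

lemma lmeasurable_Int_ball:
  fixes U :: "'a::euclidean_space set"
  shows "U \<in> sets lebesgue \<Longrightarrow> U \<inter> ball x \<rho> \<in> lmeasurable"
  by (subst Int_commute) (rule fmeasurable_Int_fmeasurable[OF lmeasurable_ball])

lemma integrable_norm_diff_const:
  fixes w :: "'a::euclidean_space \<Rightarrow> 'b::euclidean_space"
  assumes "integrable (lebesgue_on V) w" "V \<in> lmeasurable"
  shows "integrable (lebesgue_on V) (\<lambda>y. norm (w y - c))"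
  using assms
  by (intro integrable_norm Bochner_Integration.integrable_diff)
    (auto intro!: finite_measure.integrable_const finite_measure_lebesgue_on)

lemma has_trace_lincomb:
  fixes w w' :: "real^'n \<Rightarrow> real^'n"
  assumes U: "U \<in> sets lebesgue" and w: "has_trace U S w g" and w': "has_trace U S w' g'"
  shows "has_trace U S (\<lambda>x. a *\<^sub>R w x + b *\<^sub>R w' x) (\<lambda>x. a *\<^sub>R g x + b *\<^sub>R g' x)"
proof -
  let ?m = "\<lambda>w g x \<rho>. (\<integral>y. norm (w y - g x) \<partial>lebesgue_on (U \<inter> ball x \<rho>)) / \<rho> ^ CARD('n)"
  let ?i = "\<lambda>w x \<rho>. integrable (lebesgue_on (U \<inter> ball x \<rho>)) w"
  let ?W = "\<lambda>x. a *\<^sub>R w x + b *\<^sub>R w' x" and ?G = "\<lambda>x. a *\<^sub>R g x + b *\<^sub>R g' x"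
  obtain Z where Z: "hausdorff_null (CARD('n) - 1) Z"
    "\<And>x. x \<in> S - Z \<Longrightarrow> (\<forall>\<^sub>F \<rho> in at_right 0. ?i w x \<rho>) \<and> (?m w g x \<longlongrightarrow> 0) (at_right 0)"
    using w unfolding has_trace_def by blast
  obtain Z' where Z': "hausdorff_null (CARD('n) - 1) Z'"
    "\<And>x. x \<in> S - Z' \<Longrightarrow> (\<forall>\<^sub>F \<rho> in at_right 0. ?i w' x \<rho>) \<and> (?m w' g' x \<longlongrightarrow> 0) (at_right 0)"
    using w' unfolding has_trace_def by blast
  show ?thesis
    unfolding has_trace_def
  proof (intro exI[of _ "Z \<union> Z'"] conjI ballI)
    show "hausdorff_null (CARD('n) - 1) (Z \<union> Z')"
      by (rule hausdorff_null_Un[OF Z(1) Z'(1)])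
    fix x assume "x \<in> S - (Z \<union> Z')"
    then have x: "\<forall>\<^sub>F \<rho> in at_right 0. ?i w x \<rho>" "(?m w g x \<longlongrightarrow> 0) (at_right 0)"
      "\<forall>\<^sub>F \<rho> in at_right 0. ?i w' x \<rho>" "(?m w' g' x \<longlongrightarrow> 0) (at_right 0)"
      using Z(2) Z'(2) by auto
    show "\<forall>\<^sub>F \<rho> in at_right 0. ?i ?W x \<rho>"
      using x(1,3) by eventually_elim simp
    have pos: "\<forall>\<^sub>F \<rho> :: real in at_right 0. \<rho> > 0"
      by (simp add: eventually_at_right_less)
    show "(?m ?W ?G x \<longlongrightarrow> 0) (at_right 0)"
    proof (rule tendsto_sandwich)
      show "\<forall>\<^sub>F \<rho> in at_right 0. 0 \<le> ?m ?W ?G x \<rho>"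
        using pos by eventually_elim (auto intro!: divide_nonneg_nonneg integral_nonneg_AE)
      show "\<forall>\<^sub>F \<rho> in at_right 0. ?m ?W ?G x \<rho> \<le> \<bar>a\<bar> * ?m w g x \<rho> + \<bar>b\<bar> * ?m w' g' x \<rho>"
        using x(1,3) pos
      proof eventually_elim
        case (elim \<rho>)
        let ?V = "U \<inter> ball x \<rho>"
        have V: "?V \<in> lmeasurable" by (rule lmeasurable_Int_ball[OF U])
        note i = integrable_norm_diff_const[OF elim(1) V] integrable_norm_diff_const[OF elim(2) V]
        have "integrable (lebesgue_on ?V) ?W" using elim by simp
        note iW = integrable_norm_diff_const[OF this V]
        have "(\<integral>y. norm (?W y - ?G x) \<partial>lebesgue_on ?V)
            \<le> (\<integral>y. \<bar>a\<bar> * norm (w y - g x) + \<bar>b\<bar> * norm (w' y - g' x) \<partial>lebesgue_on ?V)"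
        proof (rule Bochner_Integration.integral_mono[OF iW])
          show "integrable (lebesgue_on ?V) (\<lambda>y. \<bar>a\<bar> * norm (w y - g x) + \<bar>b\<bar> * norm (w' y - g' x))"
            using i by simp
          fix y
          have "?W y - ?G x = a *\<^sub>R (w y - g x) + b *\<^sub>R (w' y - g' x)"
            by (simp add: algebra_simps)
          then show "norm (?W y - ?G x) \<le> \<bar>a\<bar> * norm (w y - g x) + \<bar>b\<bar> * norm (w' y - g' x)"
            by (metis norm_scaleR norm_triangle_ineq)
        qed
        also have "\<dots> = \<bar>a\<bar> * (\<integral>y. norm (w y - g x) \<partial>lebesgue_on ?V) + \<bar>b\<bar> * (\<integral>y. norm (w' y - g' x) \<partial>lebesgue_on ?V)"
          using i by simp
        finally show ?case
          using elim(3) by (simp add: divide_right_mono flip: add_divide_distrib)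
      qed
      have "((\<lambda>\<rho>. \<bar>a\<bar> * ?m w g x \<rho> + \<bar>b\<bar> * ?m w' g' x \<rho>) \<longlongrightarrow> \<bar>a\<bar> * 0 + \<bar>b\<bar> * 0) (at_right 0)"
        by (intro tendsto_intros x)
      then show "((\<lambda>\<rho>. \<bar>a\<bar> * ?m w g x \<rho> + \<bar>b\<bar> * ?m w' g' x \<rho>) \<longlongrightarrow> 0) (at_right 0)"
        by simp
    qed simp
  qed
qed

text \<open>The defining means are over small balls, so only the vicinity of \<open>S\<close>
  counts. This moves traces between the exterior of one droplet and
  \<open>\<Omega>\<^sub>F\<close>.\<close>

lemma has_trace_local:
  fixes w w' :: "real^'n \<Rightarrow> real^'n"
  assumes w: "has_trace U S w g" and N: "open N" "S \<subseteq> N" and UV: "U \<inter> N = V \<inter> N"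
    and eq: "\<And>x. x \<in> U \<inter> N \<Longrightarrow> w x = w' x" and g: "\<And>x. x \<in> S \<Longrightarrow> g x = g' x"
  shows "has_trace V S w' g'"
proof -
  let ?m = "\<lambda>U w c x \<rho>. (\<integral>y. norm (w y - c) \<partial>lebesgue_on (U \<inter> ball x \<rho>)) / \<rho> ^ CARD('n)"
  let ?i = "\<lambda>U w x \<rho>. integrable (lebesgue_on (U \<inter> ball x \<rho>)) w"
  obtain Z where Z: "hausdorff_null (CARD('n) - 1) Z"
    "\<And>x. x \<in> S - Z \<Longrightarrow> (\<forall>\<^sub>F \<rho> in at_right 0. ?i U w x \<rho>) \<and> (?m U w (g x) x \<longlongrightarrow> 0) (at_right 0)"
    using w unfolding has_trace_def by blast
  show ?thesis
    unfolding has_trace_def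
  proof (intro exI[of _ Z] conjI ballI Z(1))
    fix x assume x: "x \<in> S - Z"
    then obtain \<delta> where \<delta>: "\<delta> > 0" "ball x \<delta> \<subseteq> N"
      using N openE by blast
    have small: "\<forall>\<^sub>F \<rho> in at_right 0. \<rho> < \<delta>"
      using \<delta>(1) by (auto simp: eventually_at_right_field)
    have same: "U \<inter> ball x \<rho> = V \<inter> ball x \<rho>" "\<And>y. y \<in> U \<inter> ball x \<rho> \<Longrightarrow> w y = w' y" if "\<rho> < \<delta>" for \<rho>
    proof -
      have "ball x \<rho> \<subseteq> N" using that \<delta>(2) by (meson less_imp_le order_trans subset_ball)
      then show "U \<inter> ball x \<rho> = V \<inter> ball x \<rho>" "\<And>y. y \<in> U \<inter> ball x \<rho> \<Longrightarrow> w y = w' y"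
        using UV eq by blast+
    qed
    have "\<forall>\<^sub>F \<rho> in at_right 0. ?i U w x \<rho>" using Z(2)[OF x] by blast
    then show "\<forall>\<^sub>F \<rho> in at_right 0. ?i V w' x \<rho>"
      using small
    proof eventually_elim
      case (elim \<rho>)
      then show ?case
        unfolding same(1)[OF elim(2), symmetric]
        by (subst Bochner_Integration.integrable_cong[OF refl, of _ w' w]) (auto simp: same(2)[OF elim(2)])
    qed
    have "\<forall>\<^sub>F \<rho> in at_right 0. ?m U w (g x) x \<rho> = ?m V w' (g' x) x \<rho>"
      using small
    proof eventually_elim
      case (elim \<rho>)
      have "(\<integral>y. norm (w y - g x) \<partial>lebesgue_on (U \<inter> ball x \<rho>)) = (\<integral>y. norm (w' y - g' x) \<partial>lebesgue_on (U \<inter> ball x \<rho>))"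
        using x g by (intro Bochner_Integration.integral_cong) (auto simp: same(2)[OF elim])
      then show ?case by (simp add: same(1)[OF elim])
    qed
    then show "(?m V w' (g' x) x \<longlongrightarrow> 0) (at_right 0)"
      using Z(2)[OF x] by (blast intro: Lim_transform_eventually)
  qed
qed

lemma has_trace_continuous:
  fixes w :: "real^'n \<Rightarrow> real^'n"
  assumes U: "U \<in> sets lebesgue" and V: "open V" "S \<subseteq> V" and w: "continuous_on V w"
    and dim: "CARD('n) \<ge> 2"
  shows "has_trace U S w w"
  unfolding has_trace_def
proof (intro exI[of _ "{}"] conjI ballI)
  show "hausdorff_null (CARD('n) - 1) {}"
    using dim by (intro hausdorff_null_empty) simp
  fix x assume "x \<in> S - {}"
  then have x: "x \<in> V" using V by blast
  then obtain \<delta> where \<delta>: "\<delta> > 0" "cball x \<delta> \<subseteq> V"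
    using V(1) open_contains_cball by blast
  have wc: "continuous_on (cball x \<delta>) w" using w \<delta>(2) continuous_on_subset by blast
  have int: "integrable (lebesgue_on (U \<inter> ball x \<rho>)) w" if "\<rho> \<le> \<delta>" for \<rho>
  proof -
    have "integrable lborel (\<lambda>y. indicator (cball x \<delta>) y *\<^sub>R w y)"
      by (rule borel_integrable_compact[OF compact_cball wc])
    then have "integrable lebesgue (\<lambda>y. indicator (cball x \<delta>) y *\<^sub>R w y)"
      by (subst integrable_completion) auto
    then have "integrable (lebesgue_on (cball x \<delta>)) w"
      by (simp add: integrable_restrict_space)
    then show ?thesis
      by (rule integrable_lebesgue_on_subset) (use that U in auto)
  qed
  have small: "\<forall>\<^sub>F \<rho> in at_right 0. 0 < \<rho> \<and> \<rho> < \<eta>" if "\<eta> > 0" for \<eta> :: real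
    using that by (auto simp: eventually_at_right_field)
  show "\<forall>\<^sub>F \<rho> in at_right 0. integrable (lebesgue_on (U \<inter> ball x \<rho>)) w"
    using small[OF \<delta>(1)] by eventually_elim (auto intro: int)
  let ?C = "\<integral>y. indicator (ball x 1) y * 1 \<partial>lebesgue :: real"
  have C: "?C \<ge> 0" by (intro integral_nonneg_AE) simp
  have vol: "(\<integral>y. indicator (ball x \<rho>) y * 1 \<partial>lebesgue) = \<rho> ^ CARD('n) * ?C" if "\<rho> > 0" for \<rho> :: real
    using integral_ball_homogeneous[of "\<lambda>x. 1" \<rho> x 1] that by simp
  show "((\<lambda>\<rho>. (\<integral>y. norm (w y - w x) \<partial>lebesgue_on (U \<inter> ball x \<rho>)) / \<rho> ^ CARD('n)) \<longlongrightarrow> 0) (at_right 0)"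
  proof (rule tendstoI)
    fix e :: real assume "e > 0"
    define \<epsilon> where "\<epsilon> = e / (?C + 1)"
    have "e / (C + 1) > 0 \<and> e / (C + 1) * C < e" if "C \<ge> 0" for C
      using that \<open>e > 0\<close> by (auto simp: field_simps)
    from this[OF C] have \<epsilon>: "\<epsilon> > 0" "\<epsilon> * ?C < e"
      unfolding \<epsilon>_def by blast+
    have "isCont w x" using w V(1) x by (simp add: continuous_on_eq_continuous_at)
    then obtain \<eta> where \<eta>: "\<eta> > 0" "\<And>y. dist y x < \<eta> \<Longrightarrow> dist (w y) (w x) < \<epsilon>"
      unfolding continuous_at_eps_delta using \<epsilon>(1) by metis
    have "\<forall>\<^sub>F \<rho> in at_right 0. 0 < \<rho> \<and> \<rho> < min \<delta> \<eta>"
      using small[of "min \<delta> \<eta>"] \<delta>(1) \<eta>(1) by simp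
    then show "\<forall>\<^sub>F \<rho> in at_right 0. dist ((\<integral>y. norm (w y - w x) \<partial>lebesgue_on (U \<inter> ball x \<rho>)) / \<rho> ^ CARD('n)) 0 < e"
    proof eventually_elim
      case (elim \<rho>)
      let ?V = "U \<inter> ball x \<rho>"
      have V: "?V \<in> lmeasurable" by (rule lmeasurable_Int_ball[OF U])
      then have V': "?V \<in> sets lebesgue" by (rule fmeasurableD)
      have "(\<integral>y. norm (w y - w x) \<partial>lebesgue_on ?V) \<le> (\<integral>y. \<epsilon> \<partial>lebesgue_on ?V)"
      proof (rule Bochner_Integration.integral_mono)
        show "integrable (lebesgue_on ?V) (\<lambda>y. norm (w y - w x))"
          using elim by (intro integrable_norm_diff_const int V) simp
        show "integrable (lebesgue_on ?V) (\<lambda>y. \<epsilon>)"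
          using V by (intro finite_measure.integrable_const finite_measure_lebesgue_on)
        show "norm (w y - w x) \<le> \<epsilon>" if "y \<in> space (lebesgue_on ?V)" for y
          using \<eta>(2)[of y] that elim by (simp add: dist_norm norm_minus_commute less_imp_le)
      qed
      also have "\<dots> = (\<integral>y. indicator ?V y * \<epsilon> \<partial>lebesgue)"
        using V' by (subst integral_restrict_space) simp_all
      also have "\<dots> \<le> (\<integral>y. \<epsilon> * (indicator (ball x \<rho>) y * 1) \<partial>lebesgue)"
      proof (rule Bochner_Integration.integral_mono)
        show "integrable lebesgue (\<lambda>y. indicator ?V y * \<epsilon>)"
          using V by (intro integrable_mult_left integrable_real_indicator) (auto simp: fmeasurable_def)
        show "integrable lebesgue (\<lambda>y. \<epsilon> * (indicator (ball x \<rho>) y * 1))"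
          using lmeasurable_ball[of x \<rho>] by (intro integrable_mult_right integrable_mult_left integrable_real_indicator) (auto simp: fmeasurable_def)
        show "indicator ?V y * \<epsilon> \<le> \<epsilon> * (indicator (ball x \<rho>) y * 1)" for y
          using \<epsilon>(1) by (auto simp: indicator_def)
      qed
      also have "\<dots> = (\<epsilon> * ?C) * \<rho> ^ CARD('n)"
        using vol[of \<rho>] elim by simp
      finally have "(\<integral>y. norm (w y - w x) \<partial>lebesgue_on ?V) / \<rho> ^ CARD('n) \<le> \<epsilon> * ?C"
        using elim by (simp add: pos_divide_le_eq)
      moreover have "0 \<le> (\<integral>y. norm (w y - w x) \<partial>lebesgue_on ?V) / \<rho> ^ CARD('n)"
        using elim by (intro divide_nonneg_nonneg integral_nonneg_AE) auto
      ultimately show ?case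
        using \<epsilon>(2) by (simp add: dist_real_def)
    qed
  qed
qed

lemma trace_jump_lincomb:
  assumes "E \<in> sets lebesgue" "I \<in> sets lebesgue"
    and "trace_jump E I S w g" "trace_jump E I S w' g'"
  shows "trace_jump E I S (\<lambda>x. a *\<^sub>R w x + b *\<^sub>R w' x) (\<lambda>x. a *\<^sub>R g x + b *\<^sub>R g' x)"
proof -
  obtain \<alpha> \<beta> \<alpha>' \<beta>' where
    1: "has_trace E S w \<alpha>" "has_trace I S w \<beta>" "\<And>x. x \<in> S \<Longrightarrow> \<alpha> x - \<beta> x = g x" and
    2: "has_trace E S w' \<alpha>'" "has_trace I S w' \<beta>'" "\<And>x. x \<in> S \<Longrightarrow> \<alpha>' x - \<beta>' x = g' x"
    using assms(3,4) unfolding trace_jump_def by blast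
  have "(a *\<^sub>R \<alpha> x + b *\<^sub>R \<alpha>' x) - (a *\<^sub>R \<beta> x + b *\<^sub>R \<beta>' x) = a *\<^sub>R g x + b *\<^sub>R g' x" if "x \<in> S" for x
    unfolding 1(3)[OF that, symmetric] 2(3)[OF that, symmetric] by (simp add: algebra_simps)
  then show ?thesis
    unfolding trace_jump_def
    using has_trace_lincomb[OF assms(1) 1(1) 2(1)] has_trace_lincomb[OF assms(2) 1(2) 2(2)] by blast
qed

lemma trace_jump_continuous:
  fixes w :: "real^'n \<Rightarrow> real^'n"
  assumes "E \<in> sets lebesgue" "I \<in> sets lebesgue" "open V" "S \<subseteq> V" "continuous_on V w" "CARD('n) \<ge> 2"
  shows "trace_jump E I S w (\<lambda>x. 0)"
  unfolding trace_jump_def using has_trace_continuous[OF _ assms(3-6)] assms(1,2) by fastforce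

lemma trace_jump_local:
  assumes "trace_jump E I S w g" "open N" "S \<subseteq> N" "E \<inter> N = E' \<inter> N"
  shows "trace_jump E' I S w g"
  using assms has_trace_local[OF _ assms(2-4)] unfolding trace_jump_def by metis

section \<open>Normal traces\<close>

lemma frontier_local:
  assumes "open N" "U \<inter> N = V \<inter> N"
  shows "frontier U \<inter> N = frontier V \<inter> N"
proof -
  have "x \<in> closure U \<longleftrightarrow> x \<in> closure V" if "x \<in> N" for x
    using that assms open_Int_closure_subset[OF assms(1)] closure_mono[of "N \<inter> U" V] closure_mono[of "N \<inter> V" U]
    by blast
  moreover have "x \<in> interior U \<longleftrightarrow> x \<in> interior V" if "x \<in> N" for x
    using that assms by (metis IntD1 IntI interior_Int interior_open)
  ultimately show ?thesis by (auto simp: frontier_def)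
qed

lemma div_dist_subset:
  assumes \<psi>: "\<psi> \<in> test_functions V" and UV: "V \<subseteq> U" "U \<in> sets lebesgue" "V \<in> sets lebesgue"
  shows "div_dist V T \<psi> = div_dist U T \<psi>"
proof -
  obtain K where K: "compact K" "K \<subseteq> V" "\<And>x. x \<notin> K \<Longrightarrow> \<psi> x = 0" "\<And>x. x \<notin> K \<Longrightarrow> grad \<psi> x = 0"
    using grad_support[OF \<psi>] by blast
  have "T x \<bullet> grad \<psi> x = 0" if "x \<in> U - V" for x
  proof -
    have "x \<notin> K" using that K(2) by blast
    then show ?thesis using K(4)[of x] by simp
  qed
  then show ?thesis
    unfolding div_dist_def using UV by (intro arg_cong[where f = uminus] integral_lebesgue_on_subset) auto
qed

lemma div_dist_lincomb:
  assumes T: "T \<in> L2 U" "T' \<in> L2 U" and U: "U \<in> sets lebesgue" and \<psi>: "\<psi> \<in> test_functions A"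
  shows "div_dist U (\<lambda>x. a *\<^sub>R T x + b *\<^sub>R T' x) \<psi> = a * div_dist U T \<psi> + b * div_dist U T' \<psi>"
proof -
  note i = L2_inner_integrable[OF T(1) grad_L2[OF \<psi> U]] L2_inner_integrable[OF T(2) grad_L2[OF \<psi> U]]
  have "(\<integral>x. (a *\<^sub>R T x + b *\<^sub>R T' x) \<bullet> grad \<psi> x \<partial>lebesgue_on U)
      = (\<integral>x. a * (T x \<bullet> grad \<psi> x) + b * (T' x \<bullet> grad \<psi> x) \<partial>lebesgue_on U)"
    by (simp add: inner_add_left)
  also have "\<dots> = a * (\<integral>x. T x \<bullet> grad \<psi> x \<partial>lebesgue_on U) + b * (\<integral>x. T' x \<bullet> grad \<psi> x \<partial>lebesgue_on U)"
    using i by simp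
  finally show ?thesis by (simp add: div_dist_def)
qed

lemma integral_inner_cong_AE:
  assumes T: "T \<in> L2 U" and h: "h \<in> L2 U" and U: "U \<in> sets lebesgue" and AE: "AE x in lebesgue_on U. T x = T' x"
  shows "(\<integral>x. T x \<bullet> h x \<partial>lebesgue_on U) = (\<integral>x. T' x \<bullet> h x \<partial>lebesgue_on U)"
proof (rule integral_cong_AE)
  show "(\<lambda>x. T x \<bullet> h x) \<in> borel_measurable (lebesgue_on U)"
    using T h by (auto simp: L2_def)
  show "(\<lambda>x. T' x \<bullet> h x) \<in> borel_measurable (lebesgue_on U)"
    using L2_cong_AE[OF T U AE] h by (auto simp: L2_def)
  show "AE x in lebesgue_on U. T x \<bullet> h x = T' x \<bullet> h x"
    using AE by eventually_elim simp
qed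

lemma div_dist_cong_AE:
  assumes "T \<in> L2 U" "U \<in> sets lebesgue" "\<psi> \<in> test_functions A" "AE x in lebesgue_on U. T x = T' x"
  shows "div_dist U T \<psi> = div_dist U T' \<psi>"
  unfolding div_dist_def
  by (rule arg_cong[where f = uminus], rule integral_inner_cong_AE)
    (use assms grad_L2 in auto)

text \<open>The body of \<open>has_normal_trace\<close> with its witnesses as parameters: two
  normal traces can only be added after both have been restricted to a common
  neighbourhood.\<close>

definition normal_trace_on ::
    "(real^'n) set \<Rightarrow> (real^'n) set \<Rightarrow> (real^'n \<Rightarrow> real^'n^'n) \<Rightarrow>
     ((real^'n \<Rightarrow> real^'n) \<Rightarrow> real) \<Rightarrow> (real^'n) set \<Rightarrow> (real^'n \<Rightarrow> real^'n) \<Rightarrow> bool" where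
  "normal_trace_on U S T g N d \<longleftrightarrow>
     open N \<and> S \<subseteq> N \<and> T \<in> L2 (U \<inter> N) \<and> d \<in> L2 (U \<inter> N) \<and>
     (\<forall>\<psi> \<in> test_functions (U \<inter> N).
        div_dist (U \<inter> N) T \<psi> = (\<integral>x. d x \<bullet> \<psi> x \<partial>lebesgue_on (U \<inter> N))) \<and>
     (\<forall>\<psi> \<in> test_functions (N - (frontier U - S)).
        g \<psi> = (\<integral>x. T x \<bullet> grad \<psi> x + d x \<bullet> \<psi> x \<partial>lebesgue_on (U \<inter> N)))"

lemma has_normal_trace_iff: "has_normal_trace U S T g \<longleftrightarrow> (\<exists>N d. normal_trace_on U S T g N d)"
  by (simp add: has_normal_trace_def normal_trace_on_def)

lemma normal_trace_integral_split:
  assumes T: "T \<in> L2 U" "d \<in> L2 U" and U: "U \<in> sets lebesgue" and \<psi>: "\<psi> \<in> test_functions A"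
  shows "(\<integral>x. T x \<bullet> grad \<psi> x + d x \<bullet> \<psi> x \<partial>lebesgue_on U)
    = - div_dist U T \<psi> + (\<integral>x. d x \<bullet> \<psi> x \<partial>lebesgue_on U)"
  using L2_inner_integrable[OF T(1) grad_L2[OF \<psi> U]] L2_inner_integrable[OF T(2) test_function_L2[OF \<psi> U]]
  by (simp add: div_dist_def)

lemma normal_trace_on_local:
  fixes T :: "real^'n \<Rightarrow> real^'n^'n"
  assumes T: "normal_trace_on U S T g N d" and U: "open U" and V: "open V"
    and M: "open M" "S \<subseteq> M" "M \<subseteq> N" "U \<inter> M = V \<inter> M"
    and AE: "AE x in lebesgue_on (U \<inter> M). T x = T' x"
    and g: "\<And>\<psi>. \<psi> \<in> test_functions M \<Longrightarrow> g \<psi> = g' \<psi>"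
  shows "normal_trace_on V S T' g' M d"
proof -
  have N: "open N" "S \<subseteq> N" "T \<in> L2 (U \<inter> N)" "d \<in> L2 (U \<inter> N)"
    and D: "\<And>\<psi>. \<psi> \<in> test_functions (U \<inter> N) \<Longrightarrow> div_dist (U \<inter> N) T \<psi> = (\<integral>x. d x \<bullet> \<psi> x \<partial>lebesgue_on (U \<inter> N))"
    and G: "\<And>\<psi>. \<psi> \<in> test_functions (N - (frontier U - S)) \<Longrightarrow>
        g \<psi> = (\<integral>x. T x \<bullet> grad \<psi> x + d x \<bullet> \<psi> x \<partial>lebesgue_on (U \<inter> N))"
    using T unfolding normal_trace_on_def by auto
  have sets: "U \<inter> N \<in> sets lebesgue" "U \<inter> M \<in> sets lebesgue"
    using U N(1) M(1) by auto
  have sub: "U \<inter> M \<subseteq> U \<inter> N" using M(3) by blast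
  have L2: "T \<in> L2 (U \<inter> M)" "d \<in> L2 (U \<inter> M)"
    using N(3,4) sub sets by (blast intro: L2_subset)+
  have L2': "T' \<in> L2 (U \<inter> M)"
    by (rule L2_cong_AE[OF L2(1) sets(2) AE])
  \<comment> \<open>both integrals only see the part of \<open>U \<inter> N\<close> where the test function lives\<close>
  have restrict: "div_dist (U \<inter> N) T \<psi> = div_dist (U \<inter> M) T' \<psi>"
    "(\<integral>x. d x \<bullet> \<psi> x \<partial>lebesgue_on (U \<inter> N)) = (\<integral>x. d x \<bullet> \<psi> x \<partial>lebesgue_on (U \<inter> M))"
    if \<psi>: "\<psi> \<in> test_functions M" for \<psi>
  proof -
    obtain K where K: "compact K" "K \<subseteq> M" "\<And>x. x \<notin> K \<Longrightarrow> \<psi> x = 0" "\<And>x. x \<notin> K \<Longrightarrow> grad \<psi> x = 0"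
      using grad_support[OF \<psi>] by blast
    have off: "\<psi> x = 0 \<and> grad \<psi> x = 0" if "x \<in> U \<inter> N - U \<inter> M" for x
    proof -
      have "x \<notin> K" using that K(2) by blast
      then show ?thesis using K(3,4)[of x] by simp
    qed
    have "(\<integral>x. T x \<bullet> grad \<psi> x \<partial>lebesgue_on (U \<inter> M)) = (\<integral>x. T x \<bullet> grad \<psi> x \<partial>lebesgue_on (U \<inter> N))"
      using sets sub by (rule integral_lebesgue_on_subset) (simp add: off)
    then show "div_dist (U \<inter> N) T \<psi> = div_dist (U \<inter> M) T' \<psi>"
      using div_dist_cong_AE[OF L2(1) sets(2) \<psi> AE] by (simp add: div_dist_def)
    show "(\<integral>x. d x \<bullet> \<psi> x \<partial>lebesgue_on (U \<inter> N)) = (\<integral>x. d x \<bullet> \<psi> x \<partial>lebesgue_on (U \<inter> M))"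
      using sets sub by (intro integral_lebesgue_on_subset[symmetric]) (simp_all add: off)
  qed
  have fr: "M - (frontier V - S) = M - (frontier U - S)"
    using frontier_local[OF M(1,4)] by blast
  show ?thesis
    unfolding normal_trace_on_def M(4)[symmetric] fr
  proof (intro conjI ballI M(1,2) L2' L2(2))
    fix \<psi> :: "real^'n \<Rightarrow> real^'n" assume "\<psi> \<in> test_functions (U \<inter> M)"
    then have \<psi>: "\<psi> \<in> test_functions M" "\<psi> \<in> test_functions (U \<inter> N)"
      using test_functions_mono[of "U \<inter> M" M] test_functions_mono[OF sub] by blast+
    show "div_dist (U \<inter> M) T' \<psi> = (\<integral>x. d x \<bullet> \<psi> x \<partial>lebesgue_on (U \<inter> M))"
      using D[OF \<psi>(2)] restrict[OF \<psi>(1)] by simp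
  next
    fix \<psi> :: "real^'n \<Rightarrow> real^'n" assume "\<psi> \<in> test_functions (M - (frontier U - S))"
    then have \<psi>: "\<psi> \<in> test_functions M" "\<psi> \<in> test_functions (N - (frontier U - S))"
      using test_functions_mono[of "M - (frontier U - S)"] M(3) by blast+
    have "g' \<psi> = - div_dist (U \<inter> N) T \<psi> + (\<integral>x. d x \<bullet> \<psi> x \<partial>lebesgue_on (U \<inter> N))"
      using G[OF \<psi>(2)] g[OF \<psi>(1)] normal_trace_integral_split[OF N(3,4) sets(1) \<psi>(1)] by simp
    also have "\<dots> = (\<integral>x. T' x \<bullet> grad \<psi> x + d x \<bullet> \<psi> x \<partial>lebesgue_on (U \<inter> M))"
      using normal_trace_integral_split[OF L2' L2(2) sets(2) \<psi>(1)] restrict[OF \<psi>(1)] by simp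
    finally show "g' \<psi> = (\<integral>x. T' x \<bullet> grad \<psi> x + d x \<bullet> \<psi> x \<partial>lebesgue_on (U \<inter> M))" .
  qed
qed

text \<open>Both Green's formula and its admissible test functions see \<open>U\<close> only near
  \<open>S\<close>, and \<open>T\<close> only up to null sets.\<close>

lemma has_normal_trace_local:
  fixes T :: "real^'n \<Rightarrow> real^'n^'n"
  assumes T: "has_normal_trace U S T g" and U: "open U" and V: "open V"
    and M: "open M" "S \<subseteq> M" "U \<inter> M = V \<inter> M"
    and AE: "AE x in lebesgue_on (U \<inter> M). T x = T' x"
  shows "has_normal_trace V S T' g"
proof -
  obtain N d where N: "normal_trace_on U S T g N d"
    using T by (auto simp: has_normal_trace_iff)
  then have N': "open N" "S \<subseteq> N" by (auto simp: normal_trace_on_def)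
  have "AE x in lebesgue_on (U \<inter> (M \<inter> N)). T x = T' x"
    using AE U M(1) N'(1) by (intro AE_lebesgue_on_subset[OF AE]) auto
  then have "normal_trace_on V S T' g (M \<inter> N) d"
    using M N' by (intro normal_trace_on_local[OF N U V]) auto
  then show ?thesis by (auto simp: has_normal_trace_iff)
qed

lemma has_normal_trace_lincomb:
  fixes T :: "real^'n \<Rightarrow> real^'n^'n"
  assumes U: "open U" and T: "has_normal_trace U S T g" and T': "has_normal_trace U S T' g'"
  shows "has_normal_trace U S (\<lambda>x. a *\<^sub>R T x + b *\<^sub>R T' x) (\<lambda>\<psi>. a * g \<psi> + b * g' \<psi>)"
proof -
  obtain N1 d1 N2 d2 where N: "normal_trace_on U S T g N1 d1" "normal_trace_on U S T' g' N2 d2"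
    using T T' by (auto simp: has_normal_trace_iff)
  let ?N = "N1 \<inter> N2" and ?d = "\<lambda>x. a *\<^sub>R d1 x + b *\<^sub>R d2 x"
  have oN: "open N1" "S \<subseteq> N1" "open N2" "S \<subseteq> N2"
    using N by (auto simp: normal_trace_on_def)
  then have n: "normal_trace_on U S T g ?N d1" "normal_trace_on U S T' g' ?N d2"
    by (auto intro!: normal_trace_on_local[OF N(1) U U] normal_trace_on_local[OF N(2) U U])
  then have L2: "T \<in> L2 (U \<inter> ?N)" "d1 \<in> L2 (U \<inter> ?N)" "T' \<in> L2 (U \<inter> ?N)" "d2 \<in> L2 (U \<inter> ?N)"
    by (auto simp: normal_trace_on_def)
  have UN: "U \<inter> ?N \<in> sets lebesgue" using U oN by auto
  have int: "(\<integral>x. ?d x \<bullet> \<psi> x \<partial>lebesgue_on (U \<inter> ?N))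
      = a * (\<integral>x. d1 x \<bullet> \<psi> x \<partial>lebesgue_on (U \<inter> ?N)) + b * (\<integral>x. d2 x \<bullet> \<psi> x \<partial>lebesgue_on (U \<inter> ?N))"
    if \<psi>: "\<psi> \<in> test_functions A" for \<psi> A
    using L2_inner_integrable[OF L2(2) test_function_L2[OF \<psi> UN]] L2_inner_integrable[OF L2(4) test_function_L2[OF \<psi> UN]]
    by (simp add: inner_add_left)
  have "normal_trace_on U S (\<lambda>x. a *\<^sub>R T x + b *\<^sub>R T' x) (\<lambda>\<psi>. a * g \<psi> + b * g' \<psi>) ?N ?d"
    unfolding normal_trace_on_def
  proof (intro conjI ballI L2_lincomb L2)
    fix \<psi> :: "real^'n \<Rightarrow> real^'n" assume \<psi>: "\<psi> \<in> test_functions (U \<inter> ?N)"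
    then have "div_dist (U \<inter> ?N) T \<psi> = (\<integral>x. d1 x \<bullet> \<psi> x \<partial>lebesgue_on (U \<inter> ?N))"
      "div_dist (U \<inter> ?N) T' \<psi> = (\<integral>x. d2 x \<bullet> \<psi> x \<partial>lebesgue_on (U \<inter> ?N))"
      using n unfolding normal_trace_on_def by blast+
    then show "div_dist (U \<inter> ?N) (\<lambda>x. a *\<^sub>R T x + b *\<^sub>R T' x) \<psi> = (\<integral>x. ?d x \<bullet> \<psi> x \<partial>lebesgue_on (U \<inter> ?N))"
      by (simp only: div_dist_lincomb[OF L2(1,3) UN \<psi>] int[OF \<psi>])
  next
    fix \<psi> :: "real^'n \<Rightarrow> real^'n" assume \<psi>: "\<psi> \<in> test_functions (?N - (frontier U - S))"
    have g: "g \<psi> = - div_dist (U \<inter> ?N) T \<psi> + (\<integral>x. d1 x \<bullet> \<psi> x \<partial>lebesgue_on (U \<inter> ?N))"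
      "g' \<psi> = - div_dist (U \<inter> ?N) T' \<psi> + (\<integral>x. d2 x \<bullet> \<psi> x \<partial>lebesgue_on (U \<inter> ?N))"
      using n \<psi> normal_trace_integral_split[OF L2(1,2) UN \<psi>] normal_trace_integral_split[OF L2(3,4) UN \<psi>]
      unfolding normal_trace_on_def by auto
    show "a * g \<psi> + b * g' \<psi> = (\<integral>x. (a *\<^sub>R T x + b *\<^sub>R T' x) \<bullet> grad \<psi> x + ?d x \<bullet> \<psi> x \<partial>lebesgue_on (U \<inter> ?N))"
      unfolding normal_trace_integral_split[OF L2_lincomb[OF L2(1,3)] L2_lincomb[OF L2(2,4)] UN \<psi>]
        div_dist_lincomb[OF L2(1,3) UN \<psi>] int[OF \<psi>] g
      by (simp add: algebra_simps)
  qed (use oN in auto)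
  then show ?thesis by (auto simp: has_normal_trace_iff)
qed

lemma has_normal_trace_zero: "has_normal_trace U S (\<lambda>x. 0) (\<lambda>\<psi>. 0)"
  unfolding has_normal_trace_def
  by (intro exI[of _ UNIV] exI[of _ "\<lambda>x. 0"]) (simp add: L2_zero div_dist_def)

lemma normal_jump_lincomb:
  fixes T :: "real^'n \<Rightarrow> real^'n^'n"
  assumes E: "open E" and I: "open I"
    and T: "normal_jump E I S T g" and T': "normal_jump E I S T' g'"
  shows "normal_jump E I S (\<lambda>x. a *\<^sub>R T x + b *\<^sub>R T' x) (\<lambda>\<psi>. a * g \<psi> + b * g' \<psi>)"
proof -
  obtain \<alpha> \<beta> N where 1: "has_normal_trace E S T \<alpha>" "has_normal_trace I S T \<beta>" "open N" "S \<subseteq> N"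
    "\<And>\<psi>. \<psi> \<in> test_functions N \<Longrightarrow> - \<alpha> \<psi> - \<beta> \<psi> = g \<psi>"
    using T unfolding normal_jump_def by blast
  obtain \<alpha>' \<beta>' N' where 2: "has_normal_trace E S T' \<alpha>'" "has_normal_trace I S T' \<beta>'" "open N'" "S \<subseteq> N'"
    "\<And>\<psi>. \<psi> \<in> test_functions N' \<Longrightarrow> - \<alpha>' \<psi> - \<beta>' \<psi> = g' \<psi>"
    using T' unfolding normal_jump_def by blast
  have "- (a * \<alpha> \<psi> + b * \<alpha>' \<psi>) - (a * \<beta> \<psi> + b * \<beta>' \<psi>) = a * g \<psi> + b * g' \<psi>"
    if "\<psi> \<in> test_functions (N \<inter> N')" for \<psi>
  proof -
    have "\<psi> \<in> test_functions N" "\<psi> \<in> test_functions N'"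
      using that test_functions_mono[of "N \<inter> N'"] by blast+
    then show ?thesis
      using 1(5) 2(5) by (simp flip: 1(5) 2(5) add: algebra_simps)
  qed
  then show ?thesis
    unfolding normal_jump_def
    using has_normal_trace_lincomb[OF E 1(1) 2(1)] has_normal_trace_lincomb[OF I 1(2) 2(2)] 1(3,4) 2(3,4)
    by (intro exI[of _ "\<lambda>\<psi>. a * \<alpha> \<psi> + b * \<alpha>' \<psi>"] exI[of _ "\<lambda>\<psi>. a * \<beta> \<psi> + b * \<beta>' \<psi>"]
        exI[of _ "N \<inter> N'"]) auto
qed

lemma normal_jump_local:
  fixes T :: "real^'n \<Rightarrow> real^'n^'n"
  assumes T: "normal_jump E I S T g" and opn: "open E" "open E'" "open I"
    and M: "open M" "S \<subseteq> M" "E \<inter> M = E' \<inter> M"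
    and AE: "AE x in lebesgue_on (E \<inter> M). T x = T' x" "AE x in lebesgue_on (I \<inter> M). T x = T' x"
    and g: "\<And>\<psi>. \<psi> \<in> test_functions M \<Longrightarrow> g \<psi> = g' \<psi>"
  shows "normal_jump E' I S T' g'"
proof -
  obtain \<alpha> \<beta> N where 1: "has_normal_trace E S T \<alpha>" "has_normal_trace I S T \<beta>" "open N" "S \<subseteq> N"
    "\<And>\<psi>. \<psi> \<in> test_functions N \<Longrightarrow> - \<alpha> \<psi> - \<beta> \<psi> = g \<psi>"
    using T unfolding normal_jump_def by blast
  have "- \<alpha> \<psi> - \<beta> \<psi> = g' \<psi>" if "\<psi> \<in> test_functions (N \<inter> M)" for \<psi>
  proof -
    have "\<psi> \<in> test_functions N" "\<psi> \<in> test_functions M"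
      using that test_functions_mono[of "N \<inter> M"] by blast+
    then show ?thesis using 1(5) g by simp
  qed
  moreover have "has_normal_trace E' S T' \<alpha>"
    by (rule has_normal_trace_local[OF 1(1) opn(1,2) M AE(1)])
  moreover have "has_normal_trace I S T' \<beta>"
    by (rule has_normal_trace_local[OF 1(2) opn(3,3) M(1,2) refl AE(2)])
  ultimately show ?thesis
    unfolding normal_jump_def using 1(3,4) M(1,2) by (meson Int_greatest open_Int)
qed

lemma normal_jump_zero: "normal_jump E I S (\<lambda>x. 0) (\<lambda>\<psi>. 0)"
  unfolding normal_jump_def
  by (intro exI[of _ "\<lambda>\<psi>. 0"] exI[of _ UNIV]) (simp add: has_normal_trace_zero)

text \<open>A field that is divergence-free across \<open>S\<close> has no normal jump there: by
  Green's formula the two one-sided traces add up to the integral over both sides, which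
  vanishes.\<close>

lemma normal_jump_interior:
  fixes T :: "real^'n \<Rightarrow> real^'n^'n"
  assumes N: "open N" "S \<subseteq> N" and EI: "open E" "open I" "E \<inter> I = {}" "negligible (N - (E \<union> I))"
    and T: "T \<in> L2 N" and div: "\<And>\<psi>. \<psi> \<in> test_functions N \<Longrightarrow> div_dist N T \<psi> = 0"
  shows "normal_jump E I S T (\<lambda>\<psi>. 0)"
proof -
  have nt: "has_normal_trace U S T (\<lambda>\<psi>. \<integral>x. T x \<bullet> grad \<psi> x \<partial>lebesgue_on (U \<inter> N))" if U: "open U" for U
    unfolding has_normal_trace_def
  proof (intro exI[of _ N] exI[of _ "\<lambda>x. 0"] conjI ballI N L2_zero)
    show "T \<in> L2 (U \<inter> N)" using T U N(1) by (auto intro: L2_subset)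
    fix \<psi> :: "real^'n \<Rightarrow> real^'n" assume \<psi>: "\<psi> \<in> test_functions (U \<inter> N)"
    then have "\<psi> \<in> test_functions N" using test_functions_mono[of "U \<inter> N" N] by blast
    then show "div_dist (U \<inter> N) T \<psi> = (\<integral>x. 0 \<bullet> \<psi> x \<partial>lebesgue_on (U \<inter> N))"
      using div div_dist_subset[OF \<psi>, of N T] U N(1) by simp
  qed simp
  show ?thesis
    unfolding normal_jump_def
  proof (intro exI conjI ballI)
    show "has_normal_trace E S T (\<lambda>\<psi>. \<integral>x. T x \<bullet> grad \<psi> x \<partial>lebesgue_on (E \<inter> N))"
      "has_normal_trace I S T (\<lambda>\<psi>. \<integral>x. T x \<bullet> grad \<psi> x \<partial>lebesgue_on (I \<inter> N))"
      using nt EI by auto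
    show "open N" "S \<subseteq> N" by (rule N)+
    fix \<psi> :: "real^'n \<Rightarrow> real^'n" assume \<psi>: "\<psi> \<in> test_functions N"
    let ?f = "\<lambda>x. T x \<bullet> grad \<psi> x"
    have int: "integrable (lebesgue_on N) ?f"
      using T \<psi> N(1) by (intro L2_inner_integrable grad_L2) auto
    have meas: "(\<lambda>x. indicator A x *\<^sub>R ?f x) \<in> borel_measurable (lebesgue_on N)" if "open A" for A
    proof (rule borel_measurable_scaleR)
      show "indicat_real A \<in> borel_measurable (lebesgue_on N)"
        using that by (intro measurable_restrict_space1 borel_measurable_indicator) simp
    qed (use int in auto)
    have i: "integrable (lebesgue_on N) (\<lambda>x. indicator A x *\<^sub>R ?f x)" if "open A" for A
      by (rule Bochner_Integration.integrable_bound[OF int meas[OF that]]) (auto simp: indicator_def)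
    have "AE x in lebesgue. x \<notin> N - (E \<union> I)"
      using EI(4) by (intro AE_not_in) (simp add: negligible_iff_null_sets)
    then have "AE x in lebesgue_on N. x \<in> E \<union> I"
      using N(1) by (subst AE_restrict_space_iff) auto
    then have "AE x in lebesgue_on N. ?f x = indicator E x *\<^sub>R ?f x + indicator I x *\<^sub>R ?f x"
      by eventually_elim (use EI(3) in \<open>auto simp: indicator_def\<close>)
    then have "(\<integral>x. ?f x \<partial>lebesgue_on N) = (\<integral>x. indicator E x *\<^sub>R ?f x + indicator I x *\<^sub>R ?f x \<partial>lebesgue_on N)"
      using int meas[OF EI(1)] meas[OF EI(2)] by (intro integral_cong_AE) auto
    also have "\<dots> = (\<integral>x. ?f x \<partial>lebesgue_on (N \<inter> E)) + (\<integral>x. ?f x \<partial>lebesgue_on (N \<inter> I))"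
      using i[OF EI(1)] i[OF EI(2)] integral_lebesgue_on_indicator[of N E ?f] integral_lebesgue_on_indicator[of N I ?f] EI N(1)
      by (simp del: real_scaleR_def)
    finally show "- (\<integral>x. ?f x \<partial>lebesgue_on (E \<inter> N)) - (\<integral>x. ?f x \<partial>lebesgue_on (I \<inter> N)) = 0"
      using div[OF \<psi>] by (simp add: div_dist_def Int_commute)
  qed
qed

section \<open>Divergence and stress\<close>

lemma div_dist_Un:
  assumes T: "T \<in> L2 (U1 \<union> U2)" and U: "U1 \<in> sets lebesgue" "U2 \<in> sets lebesgue" "U1 \<inter> U2 = {}"
    and \<psi>: "\<psi> \<in> test_functions A"
  shows "div_dist (U1 \<union> U2) T \<psi> = div_dist U1 T \<psi> + div_dist U2 T \<psi>"
proof -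
  let ?f = "\<lambda>x. T x \<bullet> grad \<psi> x" and ?U = "U1 \<union> U2"
  have int: "integrable (lebesgue_on ?U) ?f"
    using U by (intro L2_inner_integrable T grad_L2[OF \<psi>]) auto
  have i: "integrable lebesgue (\<lambda>x. indicator V x *\<^sub>R ?f x)" if "V \<in> sets lebesgue" "V \<subseteq> ?U" for V
    using integrable_lebesgue_on_subset[OF int that(2) _ that(1)] U that(1)
    by (simp add: integrable_restrict_space)
  have "(\<integral>x. ?f x \<partial>lebesgue_on ?U) = (\<integral>x. indicator U1 x *\<^sub>R ?f x + indicator U2 x *\<^sub>R ?f x \<partial>lebesgue)"
    using U by (subst integral_restrict_space)
      (auto simp: indicator_def intro!: Bochner_Integration.integral_cong)
  also have "\<dots> = (\<integral>x. ?f x \<partial>lebesgue_on U1) + (\<integral>x. ?f x \<partial>lebesgue_on U2)"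
    using i[OF U(1)] i[OF U(2)] U by (simp add: integral_restrict_space del: real_scaleR_def)
  finally show ?thesis by (simp add: div_dist_def)
qed

lemma div_dist_cong:
  assumes "\<And>x. x \<in> U \<Longrightarrow> T x \<bullet> grad \<psi> x = T' x \<bullet> grad \<psi>' x"
  shows "div_dist U T \<psi> = div_dist U T' \<psi>'"
  unfolding div_dist_def using assms
  by (intro arg_cong[where f = uminus] Bochner_Integration.integral_cong) auto

lemma div_dist_indicator:
  assumes "\<psi> \<in> test_functions U" "U \<inter> frontier A = {}" "V \<subseteq> A"
  shows "div_dist V T (\<lambda>x. indicator A x *\<^sub>R \<psi> x) = div_dist V T \<psi>"
proof (rule div_dist_cong)
  fix x assume "x \<in> V"
  then have "x \<in> A" using assms(3) by blast
  then show "T x \<bullet> grad (\<lambda>x. indicator A x *\<^sub>R \<psi> x) x = T x \<bullet> grad \<psi> x"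
    by (simp add: grad_indicator[OF assms(1,2)])
qed

lemma divergence_integrand_integrable:
  assumes "open U" "w \<in> H1 U" "\<phi> \<in> test_functions U"
  shows "integrable (lebesgue_on U)
    (\<lambda>x. \<Sum>j\<in>UNIV. w x $ j * frechet_derivative \<phi> (at x) (axis j (1::real)))"
  by (intro Bochner_Integration.integrable_sum
      is_weak_grad_integrable(1)[OF H1_weak_grad(1)[OF assms(1,2)] assms(1,3)])

lemma divergence_free_lincomb:
  fixes w w' :: "real^'n \<Rightarrow> real^'n"
  assumes U: "open U" and w: "w \<in> H1 U" "w' \<in> H1 U" and div: "divergence_free U w" "divergence_free U w'"
  shows "divergence_free U (\<lambda>x. a *\<^sub>R w x + b *\<^sub>R w' x)"
  unfolding divergence_free_def
proof
  fix \<phi> :: "real^'n \<Rightarrow> real" assume \<phi>: "\<phi> \<in> test_functions U"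
  let ?d = "\<lambda>w x. \<Sum>j\<in>UNIV. w x $ j * frechet_derivative \<phi> (at x) (axis j 1)"
  have "(\<integral>x. ?d (\<lambda>x. a *\<^sub>R w x + b *\<^sub>R w' x) x \<partial>lebesgue_on U) = (\<integral>x. a * ?d w x + b * ?d w' x \<partial>lebesgue_on U)"
    by (simp add: sum_distrib_left algebra_simps sum.distrib)
  also have "\<dots> = a * (\<integral>x. ?d w x \<partial>lebesgue_on U) + b * (\<integral>x. ?d w' x \<partial>lebesgue_on U)"
    using divergence_integrand_integrable[OF U w(1) \<phi>] divergence_integrand_integrable[OF U w(2) \<phi>] by simp
  also have "\<dots> = 0" using div \<phi> by (simp add: divergence_free_def)
  finally show "(\<integral>x. ?d (\<lambda>x. a *\<^sub>R w x + b *\<^sub>R w' x) x \<partial>lebesgue_on U) = 0" .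
qed

lemma divergence_free_subset:
  fixes w :: "real^'n \<Rightarrow> real^'n"
  assumes div: "divergence_free U w" and UV: "V \<subseteq> U" "open U" "open V"
  shows "divergence_free V w"
  unfolding divergence_free_def
proof
  fix \<phi> :: "real^'n \<Rightarrow> real" assume \<phi>: "\<phi> \<in> test_functions V"
  let ?d = "\<lambda>x. \<Sum>j\<in>UNIV. w x $ j * frechet_derivative \<phi> (at x) (axis j 1)"
  obtain K where K: "compact K" "K \<subseteq> V" "\<And>x. x \<notin> K \<Longrightarrow> \<phi> x = 0"
    "\<And>x. x \<notin> K \<Longrightarrow> frechet_derivative \<phi> (at x) = (\<lambda>v. 0)"
    using test_functions_support[OF \<phi>] by blast
  have off: "?d x = 0" if "x \<in> U - V" for x
  proof -
    have "x \<notin> K" using that K(2) by blast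
    then show ?thesis using K(4)[of x] by simp
  qed
  have "(\<integral>x. ?d x \<partial>lebesgue_on V) = (\<integral>x. ?d x \<partial>lebesgue_on U)"
    using UV off by (intro integral_lebesgue_on_subset) auto
  also have "\<dots> = 0"
    using div \<phi> test_functions_mono[OF UV(1)] unfolding divergence_free_def by blast
  finally show "(\<integral>x. ?d x \<partial>lebesgue_on V) = 0" .
qed

lemma L2_times_const:
  fixes s :: "real^'n \<Rightarrow> real" and C :: "'b::euclidean_space"
  assumes "s \<in> L2 U"
  shows "(\<lambda>x. s x *\<^sub>R C) \<in> L2 U"
  using assms by (auto simp: L2_def power_mult_distrib)

text \<open>As the weak gradient is a choice, strain and stress are linear and local only almost
  everywhere.\<close>

lemma strain_eq: "weak_grad U w x = a *\<^sub>R weak_grad V w1 x + b *\<^sub>R weak_grad V' w2 x \<Longrightarrow>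
    strain U w x = a *\<^sub>R strain V w1 x + b *\<^sub>R strain V' w2 x"
  by (simp add: strain_def transpose_add transpose_scaleR algebra_simps)

lemma strain_cong: "weak_grad U w x = weak_grad V w' x \<Longrightarrow> strain U w x = strain V w' x"
  by (simp add: strain_def)

lemma strain_lincomb:
  assumes "open U" "w \<in> H1 U" "w' \<in> H1 U"
  shows "AE x in lebesgue_on U. strain U (\<lambda>x. a *\<^sub>R w x + b *\<^sub>R w' x) x = a *\<^sub>R strain U w x + b *\<^sub>R strain U w' x"
  using H1_lincomb(2)[OF assms] by eventually_elim (rule strain_eq)

lemma strain_sum:
  assumes "open U" "\<And>i. i \<in> I \<Longrightarrow> w i \<in> H1 U"
  shows "AE x in lebesgue_on U. strain U (\<lambda>x. \<Sum>i\<in>I. w i x) x = (\<Sum>i\<in>I. strain U (w i) x)"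
proof -
  have tr: "transpose (\<Sum>i\<in>I. A i) = (\<Sum>i\<in>I. transpose (A i))" for A :: "'b \<Rightarrow> real^'a^'a"
    by (induction I rule: infinite_finite_induct) (simp_all add: transpose_add, simp_all add: transpose_def vec_eq_iff)
  have "AE x in lebesgue_on U. weak_grad U (\<lambda>x. \<Sum>i\<in>I. w i x) x = (\<Sum>i\<in>I. weak_grad U (w i) x)"
    using H1_sum[OF assms(1), of I w] assms(2) by blast
  then show ?thesis
    by eventually_elim (simp add: strain_def tr flip: scaleR_sum_right sum.distrib)
qed

lemma strain_indicator:
  assumes "w \<in> H1 U" "open U" "A \<in> sets lebesgue" "U \<inter> frontier A = {}"
  shows "AE x in lebesgue_on U. strain U (\<lambda>x. indicator A x *\<^sub>R w x) x = indicator A x *\<^sub>R strain U w x"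
  using H1_indicator(2)[OF assms] by eventually_elim (simp add: strain_def transpose_scaleR scaleR_add_right)

lemma stress_lincomb:
  assumes "open U" "w \<in> H1 U" "w' \<in> H1 U"
  shows "AE x in lebesgue_on U. stress U \<mu> (\<lambda>x. a *\<^sub>R w x + b *\<^sub>R w' x) (\<lambda>x. a * s x + b * s' x) x
    = a *\<^sub>R stress U \<mu> w s x + b *\<^sub>R stress U \<mu> w' s' x"
  using strain_lincomb[OF assms, of a b] by eventually_elim (simp add: stress_def algebra_simps)

lemma frontier_disjoint_if_relatively_clopen:
  assumes "open (U \<inter> A)" "open (U - A)"
  shows "U \<inter> frontier A = {}"
proof -
  have "U \<inter> A \<subseteq> interior A" using assms(1) by (simp add: interior_maximal)
  moreover have "U - A \<subseteq> interior (- A)" using assms(2) by (intro interior_maximal) auto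
  ultimately show ?thesis
    unfolding frontier_def interior_complement by blast
qed

section \<open>The geometry of the droplets\<close>

locale droplet_geometry =
  fixes \<Omega> :: "(real^'n) set" and M :: nat and c :: "nat \<Rightarrow> real^'n" and r :: "nat \<Rightarrow> real"
  assumes dim: "CARD('n) \<ge> 2"
    and open_domain: "open \<Omega>" and bounded_domain: "bounded \<Omega>"
    and radii: "\<And>i. i \<in> {1..M} \<Longrightarrow> r i > 0"
    and inside: "\<And>i. i \<in> {1..M} \<Longrightarrow> cball (c i) (r i) \<subseteq> \<Omega>"
    and disjoint: "\<And>i i'. i \<in> {1..M} \<Longrightarrow> i' \<in> {1..M} \<Longrightarrow> i \<noteq> i' \<Longrightarrow> cball (c i) (r i) \<inter> cball (c i') (r i') = {}"
begin

abbreviation B where "B i \<equiv> ball (c i) (r i)"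
abbreviation \<Sigma> where "\<Sigma> i \<equiv> sphere (c i) (r i)"
abbreviation \<Omega>\<^sub>F where "\<Omega>\<^sub>F \<equiv> fluid \<Omega> M c r"
abbreviation U where "U \<equiv> droplets M c r \<union> \<Omega>\<^sub>F"

text \<open>Within this neighbourhood of the droplet the only interface is its own boundary, and
  \<open>\<Omega>\<^sub>F\<close> cannot be told from the exterior of the droplet in the whole
  space.\<close>

definition nbhd :: "nat \<Rightarrow> (real^'n) set" where
  "nbhd i = \<Omega> - (\<Union>i'\<in>{1..M} - {i}. cball (c i') (r i'))"

text \<open>The droplets in which the flow of droplet \<open>i\<close>, computed with the
  viscosity of the surrounding fluid, has an excess stress.\<close>

definition others :: "nat \<Rightarrow> (real^'n) set" where
  "others i = (\<Union>i'\<in>{1..M} - {i}. B i')"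

lemma closure_droplets: "closure (droplets M c r) = (\<Union>i\<in>{1..M}. cball (c i) (r i))"
proof -
  have "cball (c i) (r i) \<subseteq> closure (droplets M c r)" if "i \<in> {1..M}" for i
    using closure_mono[of "B i" "droplets M c r"] closure_ball[OF radii[OF that], of "c i"] that
    unfolding droplets_def by blast
  moreover have "closure (droplets M c r) \<subseteq> (\<Union>i\<in>{1..M}. cball (c i) (r i))"
    using ball_subset_cball unfolding droplets_def
    by (intro closure_minimal closed_UN UN_mono) auto
  ultimately show ?thesis by blast
qed

lemma fluid_eq: "\<Omega>\<^sub>F = \<Omega> - (\<Union>i\<in>{1..M}. cball (c i) (r i))"
  by (simp add: fluid_def closure_droplets)

lemma open_fluid: "open \<Omega>\<^sub>F"
  unfolding fluid_def by (intro open_Diff open_domain closed_closure)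

lemma open_U: "open U"
  unfolding droplets_def by (intro open_Un open_UN ballI open_ball open_fluid)

lemma B_subset_U: "i \<in> {1..M} \<Longrightarrow> B i \<subseteq> U"
  by (auto simp: droplets_def)

lemma U_subset: "U \<subseteq> \<Omega>"
proof -
  have "B i \<subseteq> \<Omega>" if "i \<in> {1..M}" for i
    using inside[OF that] ball_subset_cball by blast
  then show ?thesis unfolding droplets_def fluid_def by blast
qed

lemma bounded_U: "bounded U"
  using bounded_domain U_subset bounded_subset by blast

lemma lmeasurable_U: "U \<in> lmeasurable"
  using bounded_U open_U by (simp add: lmeasurable_open)

lemma U_meas: "U \<in> sets lebesgue"
  by (rule open_lebesgue[OF open_U])

lemma lmeasurable_domain: "\<Omega> \<in> lmeasurable"
  using bounded_domain open_domain by (simp add: lmeasurable_open)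

lemma B_disjoint: "i \<in> {1..M} \<Longrightarrow> i' \<in> {1..M} \<Longrightarrow> i \<noteq> i' \<Longrightarrow> B i \<inter> cball (c i') (r i') = {}"
  using disjoint[of i i'] ball_subset_cball by blast

lemma fluid_disjoint_cball: "i \<in> {1..M} \<Longrightarrow> \<Omega>\<^sub>F \<inter> cball (c i) (r i) = {}"
  by (auto simp: fluid_eq)

lemma U_minus_B:
  assumes i: "i \<in> {1..M}"
  shows "U - B i = U \<inter> - cball (c i) (r i)" "U \<inter> B i = B i" "U \<inter> \<Sigma> i = {}"
proof -
  have "x \<notin> cball (c i) (r i)" if "x \<in> U" "x \<notin> B i" for x
  proof (cases "x \<in> \<Omega>\<^sub>F")
    case True
    then show ?thesis using fluid_disjoint_cball[OF i] by blast
  next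
    case False
    then obtain i' where "i' \<in> {1..M}" "x \<in> B i'" using \<open>x \<in> U\<close> unfolding droplets_def by blast
    then show ?thesis using B_disjoint[of i' i] i that(2) by blast
  qed
  then show "U - B i = U \<inter> - cball (c i) (r i)"
    using ball_subset_cball by blast
  then have "x \<in> B i \<or> x \<notin> cball (c i) (r i)" if "x \<in> U" for x
    using that by blast
  then show "U \<inter> \<Sigma> i = {}"
    by (fastforce simp del: Un_iff)
  show "U \<inter> B i = B i" using B_subset_U[OF i] by blast
qed

lemma U_frontier_B: "i \<in> {1..M} \<Longrightarrow> U \<inter> frontier (B i) = {}" "i \<in> {1..M} \<Longrightarrow> U \<inter> frontier (- cball (c i) (r i)) = {}"
  using U_minus_B(3) radii by (simp_all add: frontier_complement)

lemma open_others: "open (others i)"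
  unfolding others_def by (intro open_UN ballI open_ball)

lemma U_frontier_others: "i \<in> {1..M} \<Longrightarrow> U \<inter> frontier (others i) = {}"
proof (rule frontier_disjoint_if_relatively_clopen)
  assume i: "i \<in> {1..M}"
  show "open (U \<inter> others i)"
    by (intro open_Int open_U open_others)
  have "others i \<inter> B i = {}" "others i \<inter> \<Omega>\<^sub>F = {}"
  proof -
    have "B i' \<inter> B i = {}" "B i' \<inter> \<Omega>\<^sub>F = {}" if "i' \<in> {1..M} - {i}" for i'
      using B_disjoint[of i' i] fluid_disjoint_cball[of i'] ball_subset_cball[of "c i" "r i"]
        ball_subset_cball[of "c i'" "r i'"] i that by auto
    then show "others i \<inter> B i = {}" "others i \<inter> \<Omega>\<^sub>F = {}"
      unfolding others_def by blast+
  qed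
  moreover have "U = others i \<union> B i \<union> \<Omega>\<^sub>F"
    using i by (auto simp: others_def droplets_def)
  ultimately have "U - others i = B i \<union> \<Omega>\<^sub>F" by blast
  then show "open (U - others i)"
    using open_fluid by auto
qed

lemma indicator_others: "indicator (others i) x = (\<Sum>i'\<in>{1..M} - {i}. indicator (B i') x :: real)"
proof -
  have "disjoint_family_on B ({1..M} - {i})"
    unfolding disjoint_family_on_def
  proof (intro ballI impI)
    fix k l assume "k \<in> {1..M} - {i}" "l \<in> {1..M} - {i}" "k \<noteq> l"
    then show "B k \<inter> B l = {}"
      using B_disjoint[of k l] ball_subset_cball[of "c l" "r l"] by blast
  qed
  then show ?thesis unfolding others_def by (intro indicator_UN_disjoint) auto
qed

lemma nbhd_properties:
  assumes i: "i \<in> {1..M}"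
  shows "open (nbhd i)" "bounded (nbhd i)" "cball (c i) (r i) \<subseteq> nbhd i" "\<Sigma> i \<subseteq> nbhd i" "B i \<subseteq> nbhd i"
    "\<Omega>\<^sub>F \<inter> nbhd i = - cball (c i) (r i) \<inter> nbhd i" "negligible (nbhd i - (\<Omega>\<^sub>F \<union> B i))"
    "\<And>i'. i' \<in> {1..M} \<Longrightarrow> i' \<noteq> i \<Longrightarrow> nbhd i \<subseteq> - cball (c i') (r i')"
proof -
  show "open (nbhd i)" unfolding nbhd_def by (intro open_Diff open_domain closed_UN) auto
  show "bounded (nbhd i)" using bounded_domain by (auto simp: nbhd_def intro: bounded_subset)
  show sub: "cball (c i) (r i) \<subseteq> nbhd i"
    using inside[OF i] disjoint[OF i] unfolding nbhd_def by blast
  then show "\<Sigma> i \<subseteq> nbhd i" "B i \<subseteq> nbhd i"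
    using sphere_cball ball_subset_cball by blast+
  show eq: "\<Omega>\<^sub>F \<inter> nbhd i = - cball (c i) (r i) \<inter> nbhd i"
    using i by (auto simp: fluid_eq nbhd_def)
  have "nbhd i - (\<Omega>\<^sub>F \<union> B i) \<subseteq> \<Sigma> i"
  proof
    fix x assume "x \<in> nbhd i - (\<Omega>\<^sub>F \<union> B i)"
    then have "x \<in> cball (c i) (r i)" "x \<notin> B i" using eq by blast+
    then show "x \<in> \<Sigma> i" by simp
  qed
  then show "negligible (nbhd i - (\<Omega>\<^sub>F \<union> B i))"
    by (rule negligible_subset[OF negligible_sphere])
  show "\<And>i'. i' \<in> {1..M} \<Longrightarrow> i' \<noteq> i \<Longrightarrow> nbhd i \<subseteq> - cball (c i') (r i')"
    unfolding nbhd_def by blast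
qed

lemma U_cases:
  assumes "x \<in> U"
  obtains (fluid) "x \<in> \<Omega>\<^sub>F" "\<And>i. i \<in> {1..M} \<Longrightarrow> x \<notin> B i"
  | (droplet) i where "i \<in> {1..M}" "x \<in> B i" "\<And>i'. i' \<in> {1..M} \<Longrightarrow> i' \<noteq> i \<Longrightarrow> x \<notin> B i'"
proof (cases "x \<in> \<Omega>\<^sub>F")
  case True
  then have "x \<notin> B i" if "i \<in> {1..M}" for i
    using fluid_disjoint_cball[OF that] ball_subset_cball by blast
  then show thesis using True fluid by blast
next
  case False
  then obtain i where i: "i \<in> {1..M}" "x \<in> B i" using assms unfolding droplets_def by blast
  then have "x \<notin> B i'" if "i' \<in> {1..M}" "i' \<noteq> i" for i'
    using B_disjoint[OF that(1) i(1) that(2)] ball_subset_cball by blast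
  then show thesis using i droplet by blast
qed

text \<open>The conditions on the outer boundary can be examined in a neighbourhood where the
  viscosity is \<open>\<mu>\<^sub>F\<close> and all pressure updates vanish.\<close>

lemma outer_nbhd: "open (- closure (droplets M c r))" "frontier \<Omega> \<subseteq> - closure (droplets M c r)"
    "\<Omega> \<inter> - closure (droplets M c r) = \<Omega>\<^sub>F" "\<Omega> \<inter> - closure (droplets M c r) = U \<inter> - closure (droplets M c r)"
proof -
  have "frontier \<Omega> \<inter> \<Omega> = {}" using open_domain by (simp add: frontier_disjoint_eq)
  moreover have "closure (droplets M c r) \<subseteq> \<Omega>"
    using inside unfolding closure_droplets by blast
  ultimately show "frontier \<Omega> \<subseteq> - closure (droplets M c r)" by blast
  show "\<Omega> \<inter> - closure (droplets M c r) = \<Omega>\<^sub>F" by (auto simp: fluid_def)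
  then show "\<Omega> \<inter> - closure (droplets M c r) = U \<inter> - closure (droplets M c r)"
    using closure_subset[of "droplets M c r"] by blast
  show "open (- closure (droplets M c r))" by (intro open_Compl closed_closure)
qed

section \<open>Kinematic and dynamic transmission conditions\<close>

text \<open>The interface problem without its outer boundary conditions falls into a condition on
  the velocity and one on the stress. Stating the latter for an arbitrary field \<open>T\<close>
  allows summands that are not the stress of any flow, such as the excess stress.\<close>

definition kinematic :: "(real^'n \<Rightarrow> real^'n) \<Rightarrow> bool" where
  "kinematic w \<longleftrightarrow> w \<in> H1 U \<and> divergence_free U w \<and> (\<forall>i\<in>{1..M}. trace_jump \<Omega>\<^sub>F (B i) (\<Sigma> i) w (\<lambda>x. 0))"

definition balanced ::
    "(real^'n \<Rightarrow> real^'n^'n) \<Rightarrow> ((real^'n \<Rightarrow> real^'n) \<Rightarrow> real) \<Rightarrow>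
     (nat \<Rightarrow> (real^'n \<Rightarrow> real^'n) \<Rightarrow> real) \<Rightarrow> bool" where
  "balanced T f G \<longleftrightarrow> T \<in> L2 U \<and> (\<forall>\<psi>\<in>test_functions U. - div_dist U T \<psi> = f \<psi>) \<and>
     (\<forall>i\<in>{1..M}. normal_jump \<Omega>\<^sub>F (B i) (\<Sigma> i) T (G i))"

lemma kinematic_lincomb:
  assumes "kinematic w" "kinematic w'"
  shows "kinematic (\<lambda>x. a *\<^sub>R w x + b *\<^sub>R w' x)"
  unfolding kinematic_def
proof (intro conjI ballI)
  have w: "w \<in> H1 U" "w' \<in> H1 U" using assms by (auto simp: kinematic_def)
  show "(\<lambda>x. a *\<^sub>R w x + b *\<^sub>R w' x) \<in> H1 U"
    by (rule H1_lincomb(1)[OF open_U w])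
  show "divergence_free U (\<lambda>x. a *\<^sub>R w x + b *\<^sub>R w' x)"
    using assms by (intro divergence_free_lincomb open_U w) (auto simp: kinematic_def)
  fix i assume "i \<in> {1..M}"
  then have "trace_jump \<Omega>\<^sub>F (B i) (\<Sigma> i) w (\<lambda>x. 0)" "trace_jump \<Omega>\<^sub>F (B i) (\<Sigma> i) w' (\<lambda>x. 0)"
    using assms by (auto simp: kinematic_def)
  from trace_jump_lincomb[OF _ _ this, of a b]
  show "trace_jump \<Omega>\<^sub>F (B i) (\<Sigma> i) (\<lambda>x. a *\<^sub>R w x + b *\<^sub>R w' x) (\<lambda>x. 0)"
    using open_fluid by simp
qed

lemma kinematic_zero: "kinematic (\<lambda>x. 0)"
proof -
  have "trace_jump \<Omega>\<^sub>F (B i) (\<Sigma> i) (\<lambda>x. 0) (\<lambda>x. 0)" for i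
    by (rule trace_jump_continuous[of _ _ UNIV]) (use open_fluid dim in auto)
  then show ?thesis
    by (auto simp: kinematic_def H1_zero(1)[OF open_U] divergence_free_def)
qed

lemma kinematic_sum: "(\<And>k. k \<in> K \<Longrightarrow> kinematic (w k)) \<Longrightarrow> kinematic (\<lambda>x. \<Sum>k\<in>K. w k x)"
proof (induction K rule: infinite_finite_induct)
  case (insert k K)
  then show ?case using kinematic_lincomb[of "w k" "\<lambda>x. \<Sum>k\<in>K. w k x" 1 1] by simp
qed (simp_all add: kinematic_zero)

lemma balanced_lincomb:
  assumes "balanced T f G" "balanced T' f' G'"
  shows "balanced (\<lambda>x. a *\<^sub>R T x + b *\<^sub>R T' x) (\<lambda>\<psi>. a * f \<psi> + b * f' \<psi>) (\<lambda>i \<psi>. a * G i \<psi> + b * G' i \<psi>)"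
  unfolding balanced_def
proof (intro conjI ballI)
  have T: "T \<in> L2 U" "T' \<in> L2 U" using assms by (auto simp: balanced_def)
  then show "(\<lambda>x. a *\<^sub>R T x + b *\<^sub>R T' x) \<in> L2 U" by (rule L2_lincomb)
  fix \<psi> :: "real^'n \<Rightarrow> real^'n" assume \<psi>: "\<psi> \<in> test_functions U"
  then have "f \<psi> = - div_dist U T \<psi>" "f' \<psi> = - div_dist U T' \<psi>"
    using assms by (auto simp: balanced_def)
  then show "- div_dist U (\<lambda>x. a *\<^sub>R T x + b *\<^sub>R T' x) \<psi> = a * f \<psi> + b * f' \<psi>"
    by (simp add: div_dist_lincomb[OF T U_meas \<psi>])
next
  fix i assume "i \<in> {1..M}"
  then show "normal_jump \<Omega>\<^sub>F (B i) (\<Sigma> i) (\<lambda>x. a *\<^sub>R T x + b *\<^sub>R T' x) (\<lambda>\<psi>. a * G i \<psi> + b * G' i \<psi>)"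
    using assms by (intro normal_jump_lincomb open_fluid open_ball) (auto simp: balanced_def)
qed

lemma balanced_zero: "balanced (\<lambda>x. 0) (\<lambda>\<psi>. 0) (\<lambda>i \<psi>. 0)"
  by (simp add: balanced_def L2_zero div_dist_def normal_jump_zero)

lemma balanced_sum:
  "(\<And>k. k \<in> K \<Longrightarrow> balanced (T k) (f k) (G k)) \<Longrightarrow>
    balanced (\<lambda>x. \<Sum>k\<in>K. T k x) (\<lambda>\<psi>. \<Sum>k\<in>K. f k \<psi>) (\<lambda>i \<psi>. \<Sum>k\<in>K. G k i \<psi>)"
proof (induction K rule: infinite_finite_induct)
  case (insert k K)
  then show ?case
    using balanced_lincomb[of "T k" "f k" "G k" "\<lambda>x. \<Sum>k\<in>K. T k x" "\<lambda>\<psi>. \<Sum>k\<in>K. f k \<psi>" "\<lambda>i \<psi>. \<Sum>k\<in>K. G k i \<psi>" 1 1]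
    by simp
qed (simp_all add: balanced_zero)

lemma balanced_cong_AE:
  assumes T: "balanced T f G" and AE: "AE x in lebesgue_on U. T x = T' x"
    and f: "\<And>\<psi>. \<psi> \<in> test_functions U \<Longrightarrow> f \<psi> = f' \<psi>"
    and G: "\<And>i \<psi>. i \<in> {1..M} \<Longrightarrow> \<psi> \<in> test_functions UNIV \<Longrightarrow> G i \<psi> = G' i \<psi>"
  shows "balanced T' f' G'"
  unfolding balanced_def
proof (intro conjI ballI)
  have L2: "T \<in> L2 U" using T by (simp add: balanced_def)
  show "T' \<in> L2 U" by (rule L2_cong_AE[OF L2 U_meas AE])
  fix \<psi> :: "real^'n \<Rightarrow> real^'n" assume \<psi>: "\<psi> \<in> test_functions U"
  have "- div_dist U T \<psi> = f \<psi>" using T \<psi> unfolding balanced_def by blast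
  then show "- div_dist U T' \<psi> = f' \<psi>"
    by (simp only: f[OF \<psi>] div_dist_cong_AE[OF L2 U_meas \<psi> AE])
next
  fix i assume i: "i \<in> {1..M}"
  have J: "normal_jump \<Omega>\<^sub>F (B i) (\<Sigma> i) T (G i)" using T i unfolding balanced_def by blast
  have AE1: "AE x in lebesgue_on (\<Omega>\<^sub>F \<inter> UNIV). T x = T' x"
    by (rule AE_lebesgue_on_subset[OF AE _ U_meas]) (simp_all add: open_fluid)
  have AE2: "AE x in lebesgue_on (B i \<inter> UNIV). T x = T' x"
    using B_subset_U[OF i] by (intro AE_lebesgue_on_subset[OF AE _ U_meas]) simp_all
  show "normal_jump \<Omega>\<^sub>F (B i) (\<Sigma> i) T' (G' i)"
    by (rule normal_jump_local[OF J open_fluid open_fluid open_ball open_UNIV subset_UNIV refl AE1 AE2 G[OF i]])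
qed

end

section \<open>Piecewise constant viscosity\<close>

locale two_phase_geometry = droplet_geometry \<Omega> M c r
  for \<Omega> :: "(real^'n) set" and M :: nat and c :: "nat \<Rightarrow> real^'n" and r :: "nat \<Rightarrow> real" +
  fixes \<mu> :: "real^'n \<Rightarrow> real" and \<mu>\<^sub>F :: real and \<mu>\<^sub>B :: "nat \<Rightarrow> real"
  assumes mu_fluid: "x \<in> \<Omega>\<^sub>F \<Longrightarrow> \<mu> x = \<mu>\<^sub>F"
    and mu_droplet: "i \<in> {1..M} \<Longrightarrow> x \<in> B i \<Longrightarrow> \<mu> x = \<mu>\<^sub>B i"
begin

abbreviation ext where "ext i \<equiv> - cball (c i) (r i)"

text \<open>The viscosity of the free-space problem for droplet \<open>i\<close> alone.\<close>

abbreviation \<mu>1 where "\<mu>1 i \<equiv> \<lambda>x. \<mu>\<^sub>F + (\<mu>\<^sub>B i - \<mu>\<^sub>F) * indicator (B i) x"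

abbreviation droplet_stress where "droplet_stress i v q \<equiv> stress (- \<Sigma> i) (\<mu>1 i) v q"

lemma mu_eq:
  assumes "x \<in> U"
  shows "\<mu> x = \<mu>\<^sub>F + (\<Sum>i=1..M. (\<mu>\<^sub>B i - \<mu>\<^sub>F) * indicator (B i) x)"
  using assms
proof (cases rule: U_cases)
  case fluid
  then have "(\<Sum>i=1..M. (\<mu>\<^sub>B i - \<mu>\<^sub>F) * indicator (B i) x) = 0"
    by (intro sum.neutral) simp
  then show ?thesis using mu_fluid[OF fluid(1)] by simp
next
  case (droplet k)
  have "(\<Sum>i=1..M. (\<mu>\<^sub>B i - \<mu>\<^sub>F) * indicator (B i) x) = (\<Sum>i=1..M. if i = k then \<mu>\<^sub>B k - \<mu>\<^sub>F else 0)"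
    by (intro sum.cong refl) (use droplet in \<open>auto simp: indicator_def\<close>)
  also have "\<dots> = \<mu>\<^sub>B k - \<mu>\<^sub>F" using droplet(1) by simp
  finally show ?thesis using mu_droplet[OF droplet(1,2)] by simp
qed

lemma mu_times_L2:
  fixes T :: "real^'n \<Rightarrow> 'b::euclidean_space"
  assumes "T \<in> L2 U"
  shows "(\<lambda>x. (a * \<mu> x + b) *\<^sub>R T x) \<in> L2 U"
proof -
  let ?m = "\<lambda>x. a * (\<mu>\<^sub>F + (\<Sum>i=1..M. (\<mu>\<^sub>B i - \<mu>\<^sub>F) * indicator (B i) x)) + b"
  have "(\<lambda>x. ?m x *\<^sub>R T x) \<in> L2 U"
  proof (rule L2_bounded_multiple[OF assms])
    have "indicat_real (B i) \<in> borel_measurable (lebesgue_on U)" for i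
      by (intro measurable_restrict_space1 borel_measurable_indicator) simp
    then show "?m \<in> borel_measurable (lebesgue_on U)"
      by (intro borel_measurable_add borel_measurable_times borel_measurable_sum borel_measurable_const)
    fix x
    have "\<bar>\<Sum>i=1..M. (\<mu>\<^sub>B i - \<mu>\<^sub>F) * indicator (B i) x\<bar> \<le> (\<Sum>i=1..M. \<bar>\<mu>\<^sub>B i - \<mu>\<^sub>F\<bar>)"
      by (rule order_trans[OF sum_abs], rule sum_mono) (auto simp: abs_mult indicator_def)
    then have "\<bar>a\<bar> * \<bar>\<mu>\<^sub>F + (\<Sum>i=1..M. (\<mu>\<^sub>B i - \<mu>\<^sub>F) * indicator (B i) x)\<bar> \<le> \<bar>a\<bar> * (\<bar>\<mu>\<^sub>F\<bar> + (\<Sum>i=1..M. \<bar>\<mu>\<^sub>B i - \<mu>\<^sub>F\<bar>))"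
      by (intro mult_left_mono) linarith+
    then show "\<bar>?m x\<bar> \<le> \<bar>a\<bar> * (\<bar>\<mu>\<^sub>F\<bar> + (\<Sum>i=1..M. \<bar>\<mu>\<^sub>B i - \<mu>\<^sub>F\<bar>)) + \<bar>b\<bar>"
      unfolding abs_mult[symmetric] by linarith
  qed
  moreover have "AE x in lebesgue_on U. ?m x *\<^sub>R T x = (a * \<mu> x + b) *\<^sub>R T x"
    using mu_eq by (intro AE_I2) simp
  ultimately show ?thesis
    by (rule L2_cong_AE[OF _ U_meas])
qed

lemma stress_L2:
  assumes "w \<in> H1 U" "s \<in> L2 U"
  shows "stress U \<mu> w s \<in> L2 U"
proof -
  have "strain U w \<in> L2 U"
    by (rule strain_L2[OF H1_weak_grad(2)[OF open_U assms(1)]])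
  then have "(\<lambda>x. 1 *\<^sub>R ((2 * \<mu> x + 0) *\<^sub>R strain U w x) + (-1) *\<^sub>R (s x *\<^sub>R mat 1)) \<in> L2 U"
    by (intro L2_lincomb mu_times_L2 L2_times_const assms)
  then show ?thesis by (simp add: stress_def[abs_def])
qed

lemma L2_domain_U: "s \<in> L2 \<Omega> \<Longrightarrow> s \<in> L2 U"
  using U_subset open_domain by (intro L2_subset[of s \<Omega> U]) (auto simp: U_meas)

text \<open>The viscosity is locally constant on \<open>U\<close>, so it may be moved between a
  stress and a test function.\<close>

lemma grad_mu_times:
  assumes \<psi>: "\<psi> \<in> test_functions A" and x: "x \<in> U"
  shows "grad (\<lambda>x. (2 * (\<mu> x - \<mu>\<^sub>F)) *\<^sub>R \<psi> x) x = (2 * (\<mu> x - \<mu>\<^sub>F)) *\<^sub>R grad \<psi> x"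
proof -
  obtain N where N: "open N" "x \<in> N" "\<And>y. y \<in> N \<Longrightarrow> \<mu> y = \<mu> x"
    using x
  proof (cases rule: U_cases)
    case fluid
    then show thesis using that[OF open_fluid fluid(1)] mu_fluid by simp
  next
    case (droplet i)
    then show thesis using that[OF open_ball droplet(2)] mu_droplet by simp
  qed
  have "((\<lambda>y. (2 * (\<mu> x - \<mu>\<^sub>F)) *\<^sub>R \<psi> y) has_derivative
      (\<lambda>v. (2 * (\<mu> x - \<mu>\<^sub>F)) *\<^sub>R frechet_derivative \<psi> (at x) v)) (at x)"
    by (intro derivative_intros has_frechet_derivative[OF test_functions_differentiable[OF \<psi>]])
  then have "((\<lambda>y. (2 * (\<mu> y - \<mu>\<^sub>F)) *\<^sub>R \<psi> y) has_derivative
      (\<lambda>v. (2 * (\<mu> x - \<mu>\<^sub>F)) *\<^sub>R frechet_derivative \<psi> (at x) v)) (at x)"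
    by (rule has_derivative_transform_within_open[OF _ N(1,2)]) (simp add: N(3))
  note e = frechet_derivative_at[OF this, symmetric]
  show ?thesis
    by (simp only: vec_eq_iff grad_component e vector_scaleR_component real_scaleR_def simp_thms)
qed

lemma div_dist_mu_times:
  assumes "\<psi> \<in> test_functions A"
  shows "div_dist U E (\<lambda>x. (2 * (\<mu> x - \<mu>\<^sub>F)) *\<^sub>R \<psi> x) = div_dist U (\<lambda>x. (2 * (\<mu> x - \<mu>\<^sub>F)) *\<^sub>R E x) \<psi>"
proof (rule div_dist_cong)
  fix x assume "x \<in> U"
  then show "E x \<bullet> grad (\<lambda>x. (2 * (\<mu> x - \<mu>\<^sub>F)) *\<^sub>R \<psi> x) x = (2 * (\<mu> x - \<mu>\<^sub>F)) *\<^sub>R E x \<bullet> grad \<psi> x"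
    by (simp only: grad_mu_times[OF assms] inner_scaleR_left inner_scaleR_right)
qed

lemma div_dist_droplet_sum:
  assumes E: "E \<in> L2 U" and k: "\<And>x. x \<in> U \<Longrightarrow> k x = (\<Sum>i=1..M. a i * indicator (B i) x)"
    and \<psi>: "\<psi> \<in> test_functions A"
  shows "div_dist U (\<lambda>x. k x *\<^sub>R E x) \<psi> = (\<Sum>i=1..M. a i * div_dist (B i) E \<psi>)"
proof -
  let ?f = "\<lambda>x. E x \<bullet> grad \<psi> x"
  have int: "integrable (lebesgue_on U) ?f"
    by (intro L2_inner_integrable E grad_L2[OF \<psi>] U_meas)
  have BU: "B i \<in> sets (lebesgue_on U)" if "i \<in> {1..M}" for i
    using B_subset_U[OF that] U_meas by (subst sets_restrict_space_iff) auto
  have i: "integrable (lebesgue_on U) (\<lambda>x. indicator (B i) x *\<^sub>R ?f x)" if "i \<in> {1..M}" for i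
    by (rule integrable_mult_indicator[OF BU[OF that] int])
  have "(\<integral>x. (k x *\<^sub>R E x) \<bullet> grad \<psi> x \<partial>lebesgue_on U)
      = (\<integral>x. (\<Sum>i=1..M. a i * (indicator (B i) x *\<^sub>R ?f x)) \<partial>lebesgue_on U)"
  proof (intro Bochner_Integration.integral_cong refl)
    fix x assume "x \<in> space (lebesgue_on U)"
    then have "x \<in> U" by simp
    then show "(k x *\<^sub>R E x) \<bullet> grad \<psi> x = (\<Sum>i=1..M. a i * (indicator (B i) x *\<^sub>R ?f x))"
      by (simp only: inner_scaleR_left k sum_distrib_right mult.assoc real_scaleR_def)
  qed
  also have "\<dots> = (\<Sum>i=1..M. a i * (\<integral>x. indicator (B i) x *\<^sub>R ?f x \<partial>lebesgue_on U))"
  proof (subst Bochner_Integration.integral_sum)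
    show "integrable (lebesgue_on U) (\<lambda>x. a k * (indicator (B k) x *\<^sub>R ?f x))" if "k \<in> {1..M}" for k
      by (rule integrable_mult_right) (rule i[OF that])
  qed (simp only: integral_mult_right_zero)
  also have "\<dots> = (\<Sum>i=1..M. a i * (\<integral>x. ?f x \<partial>lebesgue_on (B i)))"
    by (intro sum.cong refl) (simp add: integral_lebesgue_on_indicator[OF U_meas] U_minus_B(2) del: real_scaleR_def)
  finally show ?thesis
    by (simp add: div_dist_def sum_negf)
qed

section \<open>Balance laws of the building blocks\<close>

lemma boundary_flow_balanced:
  assumes W: "W \<in> H1 \<Omega>" and S: "S \<in> L2 \<Omega>"
    and pde: "\<And>\<psi>. \<psi> \<in> test_functions \<Omega> \<Longrightarrow> - div_dist \<Omega> (stress \<Omega> (\<lambda>x. \<mu>\<^sub>F) W S) \<psi> = f \<psi>"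
    and jump: "\<And>i. i \<in> {1..M} \<Longrightarrow> normal_jump \<Omega>\<^sub>F (B i) (\<Sigma> i) (stress \<Omega> (\<lambda>x. \<mu>\<^sub>F) W S) (\<lambda>\<psi>. 0)"
  shows "balanced (stress \<Omega> (\<lambda>x. \<mu>\<^sub>F) W S) f (\<lambda>i \<psi>. 0)"
  unfolding balanced_def
proof (intro conjI ballI jump)
  have "strain \<Omega> W \<in> L2 \<Omega>"
    by (rule strain_L2[OF H1_weak_grad(2)[OF open_domain W]])
  then have "(\<lambda>x. (2 * \<mu>\<^sub>F) *\<^sub>R strain \<Omega> W x + (-1) *\<^sub>R (S x *\<^sub>R mat 1)) \<in> L2 \<Omega>"
    by (intro L2_lincomb L2_times_const S)
  then show "stress \<Omega> (\<lambda>x. \<mu>\<^sub>F) W S \<in> L2 U"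
    by (intro L2_domain_U) (simp add: stress_def[abs_def])
  fix \<psi> :: "real^'n \<Rightarrow> real^'n" assume \<psi>: "\<psi> \<in> test_functions U"
  then have "\<psi> \<in> test_functions \<Omega>" using test_functions_mono[OF U_subset] by blast
  then show "- div_dist U (stress \<Omega> (\<lambda>x. \<mu>\<^sub>F) W S) \<psi> = f \<psi>"
    using pde div_dist_subset[OF \<psi> U_subset open_lebesgue[OF open_domain] U_meas] by simp
qed

lemma L2_excess:
  assumes "\<phi> \<in> H1 U"
  shows "(\<lambda>x. (2 * (\<mu> x - \<mu>\<^sub>F)) *\<^sub>R strain U \<phi> x) \<in> L2 U"
proof -
  have "strain U \<phi> \<in> L2 U" by (rule strain_L2[OF H1_weak_grad(2)[OF open_U assms]])
  from mu_times_L2[OF this, of 2 "- 2 * \<mu>\<^sub>F"] show ?thesis by (simp add: algebra_simps)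
qed

text \<open>The excess viscous stress inside the droplets lives on one side of each interface
  only; its jump is minus its interior normal trace.\<close>

lemma excess_stress_balanced:
  assumes \<phi>: "\<phi> \<in> H1 U" and \<tau>: "\<And>i. i \<in> {1..M} \<Longrightarrow> has_normal_trace (B i) (\<Sigma> i) (strain U \<phi>) (\<tau> i)"
  shows "balanced (\<lambda>x. (2 * (\<mu> x - \<mu>\<^sub>F)) *\<^sub>R strain U \<phi> x)
      (\<lambda>\<psi>. - div_dist U (strain U \<phi>) (\<lambda>x. (2 * (\<mu> x - \<mu>\<^sub>F)) *\<^sub>R \<psi> x))
      (\<lambda>i \<psi>. 2 * (\<mu>\<^sub>F - \<mu>\<^sub>B i) * \<tau> i \<psi>)"
  unfolding balanced_def
proof (intro conjI ballI L2_excess[OF \<phi>])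
  fix \<psi> :: "real^'n \<Rightarrow> real^'n" assume \<psi>: "\<psi> \<in> test_functions U"
  show "- div_dist U (\<lambda>x. (2 * (\<mu> x - \<mu>\<^sub>F)) *\<^sub>R strain U \<phi> x) \<psi>
      = - div_dist U (strain U \<phi>) (\<lambda>x. (2 * (\<mu> x - \<mu>\<^sub>F)) *\<^sub>R \<psi> x)"
    by (simp only: div_dist_mu_times[OF \<psi>])
next
  let ?T = "\<lambda>x. (2 * (\<mu> x - \<mu>\<^sub>F)) *\<^sub>R strain U \<phi> x"
  fix i assume i: "i \<in> {1..M}"
  have ext: "has_normal_trace \<Omega>\<^sub>F (\<Sigma> i) ?T (\<lambda>\<psi>. 0)"
    by (rule has_normal_trace_local[OF has_normal_trace_zero open_fluid open_fluid open_UNIV subset_UNIV refl])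
      (auto simp: mu_fluid intro!: AE_I2)
  have "has_normal_trace (B i) (\<Sigma> i) (\<lambda>x. (2 * (\<mu>\<^sub>B i - \<mu>\<^sub>F)) *\<^sub>R strain U \<phi> x + 0 *\<^sub>R strain U \<phi> x)
      (\<lambda>\<psi>. (2 * (\<mu>\<^sub>B i - \<mu>\<^sub>F)) * \<tau> i \<psi> + 0 * \<tau> i \<psi>)"
    by (rule has_normal_trace_lincomb[OF open_ball \<tau>[OF i] \<tau>[OF i]])
  then have int: "has_normal_trace (B i) (\<Sigma> i) ?T (\<lambda>\<psi>. (2 * (\<mu>\<^sub>B i - \<mu>\<^sub>F)) * \<tau> i \<psi> + 0 * \<tau> i \<psi>)"
    by (rule has_normal_trace_local[OF _ open_ball open_ball open_UNIV subset_UNIV refl])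
      (use mu_droplet[OF i] in \<open>auto intro!: AE_I2\<close>)
  show "normal_jump \<Omega>\<^sub>F (B i) (\<Sigma> i) ?T (\<lambda>\<psi>. 2 * (\<mu>\<^sub>F - \<mu>\<^sub>B i) * \<tau> i \<psi>)"
    unfolding normal_jump_def
    by (intro exI[of _ "\<lambda>\<psi>. 0"] exI[of _ "\<lambda>\<psi>. (2 * (\<mu>\<^sub>B i - \<mu>\<^sub>F)) * \<tau> i \<psi> + 0 * \<tau> i \<psi>"] exI[of _ UNIV])
      (use ext int in \<open>simp add: algebra_simps\<close>)
qed

text \<open>By the divergence theorem this is an integral over the sphere, on which the test
  function vanishes.\<close>

lemma integral_divergence_off_sphere:
  assumes i: "i \<in> {1..M}" and \<psi>: "\<psi> \<in> test_functions A" and A: "A \<inter> \<Sigma> i = {}"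
  shows "(\<integral>x. mat 1 \<bullet> grad \<psi> x \<partial>lebesgue_on (B i)) = 0"
proof -
  obtain K where K: "compact K" "K \<subseteq> A" "\<And>x. x \<notin> K \<Longrightarrow> \<psi> x = 0" "\<And>x. x \<notin> K \<Longrightarrow> grad \<psi> x = 0"
    using grad_support[OF \<psi>] by blast
  let ?h = "\<lambda>y. ((1 / r i) *\<^sub>R (y - c i)) \<bullet> \<psi> y"
  have zero: "?h (c i + r i *\<^sub>R sgn (x - c i)) = 0" for x
  proof (cases "x = c i")
    case False
    then have "c i + r i *\<^sub>R sgn (x - c i) \<in> \<Sigma> i"
      using radii[OF i] by (simp add: dist_norm norm_sgn)
    then have "c i + r i *\<^sub>R sgn (x - c i) \<notin> K" using A K(2) by blast
    then show ?thesis using K(3) by simp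
  qed simp
  have meas: "?h \<in> borel_measurable borel"
    by (intro borel_measurable_continuous_onI continuous_intros test_functions_continuous[OF \<psi>])
  show ?thesis
    unfolding divergence_theorem_ball[OF \<psi> radii[OF i]] integral_sphere_measure[OF radii[OF i] meas] zero
    by simp
qed

text \<open>Being constant in each droplet, such a pressure exerts no force on \<open>U\<close>;
  by the divergence theorem its normal jump is minus the surface tension functional. In the
  stress, pressures enter with the opposite sign.\<close>

lemma droplet_pressure_balanced:
  "balanced (\<lambda>x. (\<Sum>i=1..M. a i * indicator (B i) x) *\<^sub>R mat 1) (\<lambda>\<psi>. 0)
    (\<lambda>i \<psi>. - a i * (\<integral>y. ((1 / r i) *\<^sub>R (y - c i)) \<bullet> \<psi> y \<partial>sphere_measure (c i) (r i)))"
proof -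
  let ?P = "\<lambda>x. (\<Sum>i=1..M. a i * indicator (B i) x)"
  let ?T = "\<lambda>x. ?P x *\<^sub>R (mat 1 :: real^'n^'n)"
  have const: "(\<lambda>x. mat 1 :: real^'n^'n) \<in> L2 V" if "V \<in> lmeasurable" for V
    by (rule bounded_const_L2[OF that])
  have L2: "?T \<in> L2 U"
  proof -
    have "(\<lambda>x. \<Sum>i=1..M. indicator (B i) x *\<^sub>R (a i *\<^sub>R (mat 1 :: real^'n^'n))) \<in> L2 U"
      by (intro L2_sum L2_indicator bounded_const_L2 lmeasurable_U) simp
    then show ?thesis by (simp only: scaleR_sum_left scaleR_scaleR mult.commute)
  qed
  have inB: "?P x = a i" if "i \<in> {1..M}" "x \<in> B i" for i x
  proof -
    have "x \<in> U" using B_subset_U[OF that(1)] that(2) by blast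
    have "?P x = (\<Sum>k=1..M. if k = i then a i else 0)"
    proof (intro sum.cong refl)
      fix k assume k: "k \<in> {1..M}"
      have "x \<notin> B k" if "k \<noteq> i"
        using B_disjoint[of i k] k \<open>i \<in> {1..M}\<close> \<open>x \<in> B i\<close> ball_subset_cball[of "c k" "r k"] that by blast
      then show "a k * indicator (B k) x = (if k = i then a i else 0)"
        using that(2) by (cases "k = i") simp_all
    qed
    then show ?thesis using that(1) by simp
  qed
  have outB: "?P x = 0" if "x \<in> \<Omega>\<^sub>F" for x
  proof (intro sum.neutral ballI)
    fix k assume "k \<in> {1..M}"
    then have "x \<notin> B k" using that fluid_disjoint_cball ball_subset_cball by blast
    then show "a k * indicator (B k) x = 0" by simp
  qed
  show ?thesis
    unfolding balanced_def
  proof (intro conjI ballI L2)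
    fix \<psi> :: "real^'n \<Rightarrow> real^'n" assume \<psi>: "\<psi> \<in> test_functions U"
    have "div_dist U ?T \<psi> = (\<Sum>i=1..M. a i * div_dist (B i) (\<lambda>x. mat 1) \<psi>)"
      by (rule div_dist_droplet_sum[OF const[OF lmeasurable_U] _ \<psi>]) simp
    also have "\<dots> = 0"
      using integral_divergence_off_sphere[OF _ \<psi> U_minus_B(3)] by (simp add: div_dist_def)
    finally show "- div_dist U ?T \<psi> = 0" by simp
  next
    fix i assume i: "i \<in> {1..M}"
    have ext: "has_normal_trace \<Omega>\<^sub>F (\<Sigma> i) ?T (\<lambda>\<psi>. 0)"
    proof (rule has_normal_trace_local[OF has_normal_trace_zero open_fluid open_fluid open_UNIV subset_UNIV refl], rule AE_I2)
      fix x assume "x \<in> space (lebesgue_on (\<Omega>\<^sub>F \<inter> UNIV))"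
      then have "x \<in> \<Omega>\<^sub>F" by simp
      then show "0 = ?T x" by (simp only: outB scaleR_zero_left)
    qed
    have "has_normal_trace (B i) (\<Sigma> i) (\<lambda>x. a i *\<^sub>R mat 1 :: real^'n^'n)
        (\<lambda>\<psi>. \<integral>x. (a i *\<^sub>R mat 1) \<bullet> grad \<psi> x \<partial>lebesgue_on (B i))"
      unfolding has_normal_trace_def
    proof (intro exI[of _ UNIV] exI[of _ "\<lambda>x. 0"] conjI ballI L2_zero)
      show "(\<lambda>x. a i *\<^sub>R mat 1 :: real^'n^'n) \<in> L2 (B i \<inter> UNIV)"
        by (intro bounded_const_L2) simp
      fix \<psi> :: "real^'n \<Rightarrow> real^'n" assume \<psi>: "\<psi> \<in> test_functions (B i \<inter> UNIV)"
      then show "div_dist (B i \<inter> UNIV) (\<lambda>x. a i *\<^sub>R mat 1) \<psi> = (\<integral>x. 0 \<bullet> \<psi> x \<partial>lebesgue_on (B i \<inter> UNIV))"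
        using integral_divergence_off_sphere[OF i \<psi>] by (simp add: div_dist_def disjoint_iff)
    qed simp_all
    then have int: "has_normal_trace (B i) (\<Sigma> i) ?T (\<lambda>\<psi>. \<integral>x. (a i *\<^sub>R mat 1) \<bullet> grad \<psi> x \<partial>lebesgue_on (B i))"
    proof (rule has_normal_trace_local[OF _ open_ball open_ball open_UNIV subset_UNIV refl], intro AE_I2)
      fix x assume "x \<in> space (lebesgue_on (B i \<inter> UNIV))"
      then have "x \<in> B i" by simp
      then show "a i *\<^sub>R mat 1 = ?T x" by (simp only: inB[OF i])
    qed
    show "normal_jump \<Omega>\<^sub>F (B i) (\<Sigma> i) ?T
        (\<lambda>\<psi>. - a i * (\<integral>y. ((1 / r i) *\<^sub>R (y - c i)) \<bullet> \<psi> y \<partial>sphere_measure (c i) (r i)))"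
      unfolding normal_jump_def
    proof (intro exI conjI ballI)
      show "has_normal_trace \<Omega>\<^sub>F (\<Sigma> i) ?T (\<lambda>\<psi>. 0)" by (rule ext)
      show "has_normal_trace (B i) (\<Sigma> i) ?T (\<lambda>\<psi>. \<integral>x. (a i *\<^sub>R mat 1) \<bullet> grad \<psi> x \<partial>lebesgue_on (B i))" by (rule int)
      fix \<psi> :: "real^'n \<Rightarrow> real^'n" assume \<psi>: "\<psi> \<in> test_functions UNIV"
      show "- 0 - (\<integral>x. (a i *\<^sub>R mat 1) \<bullet> grad \<psi> x \<partial>lebesgue_on (B i))
          = - a i * (\<integral>y. ((1 / r i) *\<^sub>R (y - c i)) \<bullet> \<psi> y \<partial>sphere_measure (c i) (r i))"
        unfolding divergence_theorem_ball[OF \<psi> radii[OF i], symmetric] by simp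
    qed auto
  qed
qed


lemma boundary_flow_kinematic:
  assumes "W \<in> H1 \<Omega>" "divergence_free \<Omega> W"
    and "\<And>i. i \<in> {1..M} \<Longrightarrow> trace_jump \<Omega>\<^sub>F (B i) (\<Sigma> i) W (\<lambda>x. 0)"
  shows "kinematic W"
  unfolding kinematic_def
  using assms H1_subset(1)[OF _ U_subset open_domain open_U] divergence_free_subset[OF _ U_subset open_domain open_U]
  by blast

context
  fixes i \<phi> v q
  assumes i: "i \<in> {1..M}" and sol: "droplet_solution \<mu>\<^sub>F (\<mu>\<^sub>B i) (c i) (r i) \<phi> v q"
begin

lemma droplet_flow:
  "v \<in> H1_bdd (- \<Sigma> i)" "q \<in> L2_bdd UNIV" "continuous_on (ext i) v"
  "\<And>\<psi>. \<psi> \<in> test_functions (B i) \<Longrightarrow>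
     - div_dist (B i) (stress (- \<Sigma> i) (\<lambda>x. \<mu>\<^sub>B i) v q) \<psi> = 2 * (\<mu>\<^sub>B i - \<mu>\<^sub>F) * div_dist (B i) (strain (B i) \<phi>) \<psi>"
  "\<And>\<psi>. \<psi> \<in> test_functions (ext i) \<Longrightarrow> - div_dist (ext i) (stress (- \<Sigma> i) (\<lambda>x. \<mu>\<^sub>F) v q) \<psi> = 0"
  "divergence_free (- \<Sigma> i) v" "trace_jump (ext i) (B i) (\<Sigma> i) v (\<lambda>x. 0)"
  using sol unfolding droplet_solution_def Let_def by blast+

lemma U_subset_complement: "U \<subseteq> - \<Sigma> i" "open (- \<Sigma> i)"
  using U_minus_B(3)[OF i] by (blast, simp add: open_Compl)

lemma nbhd_subset: "k \<in> {1..M} \<Longrightarrow> k \<noteq> i \<Longrightarrow> nbhd k \<subseteq> (ext i)" "k \<in> {1..M} \<Longrightarrow> k \<noteq> i \<Longrightarrow> nbhd k \<subseteq> - \<Sigma> i"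
  using nbhd_properties(8)[of k i] i sphere_cball[of "c i" "r i"] by blast+

lemma droplet_flow_H1:
  "v \<in> H1 U" "AE x in lebesgue_on U. weak_grad U v x = weak_grad (- \<Sigma> i) v x"
  using H1_bdd_subset[OF droplet_flow(1) U_subset_complement open_U bounded_U] by auto

lemma droplet_pressure_L2: "A \<in> sets lebesgue \<Longrightarrow> bounded A \<Longrightarrow> q \<in> L2 A"
proof -
  assume A: "A \<in> sets lebesgue" "bounded A"
  obtain R where "A \<subseteq> ball 0 R"
    using A(2) by (metis bounded_subset_ballD)
  moreover have "q \<in> L2 (UNIV \<inter> ball 0 R)"
    using droplet_flow(2) unfolding L2_bdd_def by blast
  ultimately show "q \<in> L2 A"
    using A(1) by (auto intro: L2_subset)
qed

lemma droplet_flow_kinematic: "kinematic v"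
  unfolding kinematic_def
proof (intro conjI ballI droplet_flow_H1(1))
  show "divergence_free U v"
    by (rule divergence_free_subset[OF droplet_flow(6) U_subset_complement open_U])
  fix k assume k: "k \<in> {1..M}"
  show "trace_jump \<Omega>\<^sub>F (B k) (\<Sigma> k) v (\<lambda>x. 0)"
  proof (cases "k = i")
    case True
    have "- cball (c i) (r i) \<inter> nbhd i = \<Omega>\<^sub>F \<inter> nbhd i" using nbhd_properties(6)[OF i] by blast
    then show ?thesis
      using trace_jump_local[OF droplet_flow(7) nbhd_properties(1)[OF i] nbhd_properties(4)[OF i]] True by simp
  next
    case False
    have "continuous_on (nbhd k) v"
      by (rule continuous_on_subset[OF droplet_flow(3) nbhd_subset(1)[OF k False]])
    then show ?thesis
      using nbhd_properties(1,4)[OF k] dim open_fluid by (intro trace_jump_continuous[of _ _ "nbhd k"]) auto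
  qed
qed

lemma droplet_stress_L2:
  assumes A: "open A" "bounded A" "A \<subseteq> - \<Sigma> i"
  shows "(droplet_stress i v q) \<in> L2 A"
proof -
  have A': "A \<in> sets lebesgue" using A(1) by simp
  have e: "strain (- \<Sigma> i) v \<in> L2 A"
    by (rule strain_L2[OF H1_bdd_subset(3)[OF droplet_flow(1) A(3) U_subset_complement(2) A(1,2)]])
  have "(\<lambda>x. (2 * \<mu>\<^sub>F) *\<^sub>R strain (- \<Sigma> i) v x
      + (2 * (\<mu>\<^sub>B i - \<mu>\<^sub>F)) *\<^sub>R (indicator (B i) x *\<^sub>R strain (- \<Sigma> i) v x)) \<in> L2 A"
    by (intro L2_lincomb e L2_indicator) simp
  from L2_lincomb[OF this L2_times_const[OF droplet_pressure_L2[OF A' A(2)]], of 1 "-1" "mat 1"]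
  show ?thesis
    by (rule L2_cong_AE[OF _ A']) (simp add: stress_def algebra_simps)
qed

text \<open>Outside its own droplet the flow solves the homogeneous equations with the viscosity
  of the surrounding fluid, in particular across the other droplets.\<close>

lemma droplet_stress_exterior:
  assumes A: "A \<in> sets lebesgue" "A \<subseteq> (ext i)" and \<psi>: "\<psi> \<in> test_functions A"
  shows "div_dist A (droplet_stress i v q) \<psi> = 0"
proof -
  have "\<psi> \<in> test_functions (ext i)" using \<psi> test_functions_mono[OF A(2)] by blast
  have "div_dist A (droplet_stress i v q) \<psi> = div_dist A (stress (- \<Sigma> i) (\<lambda>x. \<mu>\<^sub>F) v q) \<psi>"
  proof (rule div_dist_cong)
    fix x assume "x \<in> A"
    then have "x \<notin> B i" using A(2) ball_subset_cball by blast
    then show "(droplet_stress i v q) x \<bullet> grad \<psi> x = stress (- \<Sigma> i) (\<lambda>x. \<mu>\<^sub>F) v q x \<bullet> grad \<psi> x"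
      by (simp add: stress_def)
  qed
  also have "\<dots> = div_dist (ext i) (stress (- \<Sigma> i) (\<lambda>x. \<mu>\<^sub>F) v q) \<psi>"
    by (rule div_dist_subset[OF \<psi> A(2) _ A(1)]) simp
  finally show ?thesis
    using droplet_flow(5)[OF \<open>\<psi> \<in> test_functions (ext i)\<close>] by simp
qed

text \<open>On its own interface the prescribed jump is carried over to
  \<open>\<Omega>\<^sub>F\<close> by locality; on all others there is none, by
  \<open>normal_jump_interior\<close>.\<close>

lemma droplet_flow_balanced:
  assumes jump: "normal_jump (ext i) (B i) (\<Sigma> i) (droplet_stress i v q) (\<lambda>\<psi>. - 2 * (\<mu>\<^sub>F - \<mu>\<^sub>B i) * \<tau> \<psi>)"
  shows "balanced (droplet_stress i v q) (\<lambda>\<psi>. 2 * (\<mu>\<^sub>B i - \<mu>\<^sub>F) * div_dist (B i) (strain (B i) \<phi>) \<psi>)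
    (\<lambda>k \<psi>. if k = i then - 2 * (\<mu>\<^sub>F - \<mu>\<^sub>B i) * \<tau> \<psi> else 0)"
  unfolding balanced_def
proof (intro conjI ballI)
  show L2: "(droplet_stress i v q) \<in> L2 U"
    by (rule droplet_stress_L2[OF open_U bounded_U U_subset_complement(1)])
  fix \<psi> :: "real^'n \<Rightarrow> real^'n" assume \<psi>: "\<psi> \<in> test_functions U"
  \<comment> \<open>cut the test function into its parts inside and outside the droplet\<close>
  let ?\<psi>1 = "\<lambda>x. indicator (B i) x *\<^sub>R \<psi> x" and ?\<psi>2 = "\<lambda>x. indicator (ext i) x *\<^sub>R \<psi> x"
  have parts: "?\<psi>1 \<in> test_functions (B i)" "?\<psi>2 \<in> test_functions (U \<inter> (ext i))"
    using test_functions_indicator[OF \<psi> U_frontier_B(1)[OF i]] test_functions_indicator[OF \<psi> U_frontier_B(2)[OF i]]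
    by (simp_all only: U_minus_B(2)[OF i])
  have U: "U = B i \<union> (U \<inter> (ext i))"
    using U_minus_B(1)[OF i] B_subset_U[OF i] by blast
  have disj: "B i \<inter> (U \<inter> (ext i)) = {}" using ball_subset_cball by blast
  have meas: "U \<inter> (ext i) \<in> sets lebesgue"
    by (intro sets.Int U_meas) simp
  have "(droplet_stress i v q) \<in> L2 (B i \<union> (U \<inter> (ext i)))"
    using L2 by (simp only: U[symmetric])
  from div_dist_Un[OF this _ meas disj \<psi>]
  have "div_dist U (droplet_stress i v q) \<psi> = div_dist (B i) (droplet_stress i v q) \<psi> + div_dist (U \<inter> (ext i)) (droplet_stress i v q) \<psi>"
    unfolding U[symmetric] by simp
  also have "div_dist (B i) (droplet_stress i v q) \<psi> = div_dist (B i) (stress (- \<Sigma> i) (\<lambda>x. \<mu>\<^sub>B i) v q) \<psi>"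
    by (rule div_dist_cong) (simp add: stress_def)
  also have "\<dots> = div_dist (B i) (stress (- \<Sigma> i) (\<lambda>x. \<mu>\<^sub>B i) v q) ?\<psi>1"
    by (rule div_dist_indicator[OF \<psi> U_frontier_B(1)[OF i] subset_refl, symmetric])
  also have "\<dots> = - (2 * (\<mu>\<^sub>B i - \<mu>\<^sub>F) * div_dist (B i) (strain (B i) \<phi>) ?\<psi>1)"
    using droplet_flow(4)[OF parts(1)] by simp
  also have "div_dist (B i) (strain (B i) \<phi>) ?\<psi>1 = div_dist (B i) (strain (B i) \<phi>) \<psi>"
    by (rule div_dist_indicator[OF \<psi> U_frontier_B(1)[OF i] subset_refl])
  also have "div_dist (U \<inter> (ext i)) (droplet_stress i v q) \<psi> = div_dist (U \<inter> (ext i)) (droplet_stress i v q) ?\<psi>2"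
    by (rule div_dist_indicator[OF \<psi> U_frontier_B(2)[OF i] Int_lower2, symmetric])
  also have "\<dots> = 0"
    by (rule droplet_stress_exterior[OF meas Int_lower2 parts(2)])
  finally show "- div_dist U (droplet_stress i v q) \<psi> = 2 * (\<mu>\<^sub>B i - \<mu>\<^sub>F) * div_dist (B i) (strain (B i) \<phi>) \<psi>"
    by simp
next
  fix k assume k: "k \<in> {1..M}"
  show "normal_jump \<Omega>\<^sub>F (B k) (\<Sigma> k) (droplet_stress i v q) (\<lambda>\<psi>. if k = i then - 2 * (\<mu>\<^sub>F - \<mu>\<^sub>B i) * \<tau> \<psi> else 0)"
  proof (cases "k = i")
    case True
    have "(ext i) \<inter> nbhd i = \<Omega>\<^sub>F \<inter> nbhd i" using nbhd_properties(6)[OF i] by blast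
    then have "normal_jump \<Omega>\<^sub>F (B i) (\<Sigma> i) (droplet_stress i v q) (\<lambda>\<psi>. - 2 * (\<mu>\<^sub>F - \<mu>\<^sub>B i) * \<tau> \<psi>)"
      by (intro normal_jump_local[OF jump _ open_fluid open_ball nbhd_properties(1)[OF i] nbhd_properties(4)[OF i]])
        (simp_all add: open_Compl)
    then show ?thesis using True by simp
  next
    case False
    have "normal_jump \<Omega>\<^sub>F (B k) (\<Sigma> k) (droplet_stress i v q) (\<lambda>\<psi>. 0)"
    proof (rule normal_jump_interior[OF nbhd_properties(1)[OF k] nbhd_properties(4)[OF k] open_fluid open_ball _ nbhd_properties(7)[OF k]])
      show "\<Omega>\<^sub>F \<inter> B k = {}" using fluid_disjoint_cball[OF k] ball_subset_cball by blast
      show "(droplet_stress i v q) \<in> L2 (nbhd k)"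
        by (rule droplet_stress_L2[OF nbhd_properties(1,2)[OF k] nbhd_subset(2)[OF k False]])
      show "div_dist (nbhd k) (droplet_stress i v q) \<psi> = 0" if "\<psi> \<in> test_functions (nbhd k)" for \<psi>
        by (rule droplet_stress_exterior[OF _ nbhd_subset(1)[OF k False] that]) (use nbhd_properties(1)[OF k] in simp)
    qed
    then show ?thesis using False by simp
  qed
qed

end

section \<open>The field \<open>\<phi>\<close> and the stress of a correction\<close>

text \<open>Reordered by the flows rather than by the droplets, so that each flow is cut off just
  once.\<close>

lemma phi_half_eq:
  "phi_half M c r V W k x = (\<Sum>i=1..M. indicator (others i) x *\<^sub>R V k i x) + W k x"
proof -
  have "(\<Sum>i=1..M. \<Sum>i'\<in>{1..M} - {i}. indicator (B i) x *\<^sub>R V k i' x)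
      = (\<Sum>i=1..M. \<Sum>i'\<in>{i'\<in>{1..M}. i \<noteq> i'}. indicator (B i) x *\<^sub>R V k i' x)"
    by (intro sum.cong refl) auto
  also have "\<dots> = (\<Sum>i'=1..M. \<Sum>i\<in>{i\<in>{1..M}. i \<noteq> i'}. indicator (B i) x *\<^sub>R V k i' x)"
    by (rule sum.swap_restrict) simp_all
  also have "\<dots> = (\<Sum>i'=1..M. indicator (others i') x *\<^sub>R V k i' x)"
    unfolding indicator_others scaleR_sum_left by (intro sum.cong refl) auto
  finally show ?thesis by (simp only: phi_half_def)
qed

lemma indicator_others_droplet:
  assumes "k \<in> {1..M}" "x \<in> B k" "i \<in> {1..M}"
  shows "indicator (others i) x = (if i = k then 0 else 1 :: real)"
proof -
  have "x \<notin> B i'" if "i' \<in> {1..M}" "i' \<noteq> k" for i'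
    using B_disjoint[OF that(1) assms(1) that(2)] assms(2) ball_subset_cball by blast
  then show ?thesis
    using assms unfolding others_def indicator_def by fastforce
qed

lemma indicator_others_fluid: "x \<in> \<Omega>\<^sub>F \<Longrightarrow> indicator (others i) x = (0 :: real)"
  unfolding others_def using fluid_disjoint_cball ball_subset_cball by (fastforce simp: indicator_def)

text \<open>In droplet \<open>k\<close>, the field \<open>\<phi>\<close> is the input of the next
  droplet problem: everything but the droplet's own last flow.\<close>

lemma phi_half_droplet:
  assumes k: "k \<in> {1..M}" "x \<in> B k"
  shows "phi_half M c r V W j x = (\<Sum>i=1..M. V j i x) + W j x - V j k x"
proof -
  have "(\<Sum>i=1..M. indicator (others i) x *\<^sub>R V j i x) = (\<Sum>i=1..M. if i = k then 0 else V j i x)"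
    by (intro sum.cong refl) (simp add: indicator_others_droplet[OF k])
  also have "\<dots> = (\<Sum>i\<in>{1..M} - {k}. V j i x)"
    using k(1) by (subst sum.remove[of _ k]) auto
  also have "\<dots> = (\<Sum>i=1..M. V j i x) - V j k x"
    using k(1) by (simp add: sum_diff1)
  finally show ?thesis by (simp add: phi_half_eq)
qed

lemma phi_half_H1:
  assumes V: "\<And>i. i \<in> {1..M} \<Longrightarrow> V k i \<in> H1 U" and W: "W k \<in> H1 U"
  shows "phi_half M c r V W k \<in> H1 U"
    and "AE x in lebesgue_on U. strain U (phi_half M c r V W k) x
      = (\<Sum>i=1..M. indicator (others i) x *\<^sub>R strain U (V k i) x) + strain U (W k) x"
proof -
  let ?X = "\<lambda>i x. indicator (others i) x *\<^sub>R V k i x"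
  have others: "others i \<in> sets lebesgue" for i
    by (rule open_lebesgue[OF open_others])
  have X: "?X i \<in> H1 U" "AE x in lebesgue_on U. strain U (?X i) x = indicator (others i) x *\<^sub>R strain U (V k i) x"
    if "i \<in> {1..M}" for i
    by (rule H1_indicator(1)[OF V[OF that] open_U others U_frontier_others[OF that]])
      (rule strain_indicator[OF V[OF that] open_U others U_frontier_others[OF that]])
  have sum: "(\<lambda>x. \<Sum>i=1..M. ?X i x) \<in> H1 U"
    using H1_sum[OF open_U, of "{1..M}" ?X] X(1) by blast
  have eq: "phi_half M c r V W k = (\<lambda>x. 1 *\<^sub>R (\<Sum>i=1..M. ?X i x) + 1 *\<^sub>R W k x)"
    by (simp only: fun_eq_iff phi_half_eq scaleR_one simp_thms)
  show "phi_half M c r V W k \<in> H1 U"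
    unfolding eq by (rule H1_lincomb(1)[OF open_U sum W])
  have "AE x in lebesgue_on U. \<forall>i\<in>{1..M}. strain U (?X i) x = indicator (others i) x *\<^sub>R strain U (V k i) x"
    by (intro AE_finite_allI X(2)) auto
  moreover have "AE x in lebesgue_on U. strain U (\<lambda>x. \<Sum>i=1..M. ?X i x) x = (\<Sum>i=1..M. strain U (?X i) x)"
    by (rule strain_sum[OF open_U X(1)])
  moreover have "AE x in lebesgue_on U. strain U (phi_half M c r V W k) x
      = 1 *\<^sub>R strain U (\<lambda>x. \<Sum>i=1..M. ?X i x) x + 1 *\<^sub>R strain U (W k) x"
    unfolding eq by (rule strain_lincomb[OF open_U sum W])
  ultimately show "AE x in lebesgue_on U. strain U (phi_half M c r V W k) x
      = (\<Sum>i=1..M. indicator (others i) x *\<^sub>R strain U (V k i) x) + strain U (W k) x"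
  proof eventually_elim
    case (elim x)
    have "(\<Sum>i=1..M. strain U (?X i) x) = (\<Sum>i=1..M. indicator (others i) x *\<^sub>R strain U (V k i) x)"
      by (rule sum.cong[OF refl]) (rule bspec[OF elim(1)])
    then show ?case by (simp only: elim(2,3) scaleR_one)
  qed
qed

lemma strain_phi_half_droplet:
  assumes \<phi>: "phi_half M c r V W k \<in> H1 U" and i: "i \<in> {1..M}"
  shows "AE x in lebesgue_on (B i). strain (B i) (\<lambda>x. (\<Sum>i=1..M. V k i x) + W k x - V k i x) x
    = strain U (phi_half M c r V W k) x"
proof -
  note sub = H1_subset[OF \<phi> B_subset_U[OF i] open_U open_ball]
  have "AE x in lebesgue_on (B i). weak_grad (B i) (\<lambda>x. (\<Sum>i=1..M. V k i x) + W k x - V k i x) x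
      = weak_grad (B i) (phi_half M c r V W k) x"
    by (rule H1_cong(2)[OF sub(1) phi_half_droplet[OF i] open_ball])
  with sub(2) show ?thesis
    by eventually_elim (auto intro: strain_cong)
qed

text \<open>The key identity: the stress of a correction, with the true viscosity, consists of the
  stresses of the solved problems and the excess stress of the field that the next droplet solves
  will see. In droplet \<open>k\<close>, the flow of droplet \<open>k\<close> itself was computed
  with the true viscosity, all the others with the viscosity of the surrounding fluid.\<close>

lemma stress_decomposition:
  assumes V: "\<And>i. i \<in> {1..M} \<Longrightarrow> V k i \<in> H1 U"
    and V': "\<And>i. i \<in> {1..M} \<Longrightarrow> AE x in lebesgue_on U. weak_grad U (V k i) x = weak_grad (- \<Sigma> i) (V k i) x"
    and W: "W k \<in> H1 \<Omega>"
  shows "AE x in lebesgue_on U. stress U \<mu> (\<lambda>x. (\<Sum>i=1..M. V k i x) + W k x) (\<lambda>x. (\<Sum>i=1..M. Q i x) + s x) x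
    = (\<Sum>i=1..M. stress (- \<Sigma> i) (\<mu>1 i) (V k i) (Q i) x)
      + (stress \<Omega> (\<lambda>x. \<mu>\<^sub>F) (W k) s x + (2 * (\<mu> x - \<mu>\<^sub>F)) *\<^sub>R strain U (phi_half M c r V W k) x)"
proof -
  note WU = H1_subset[OF W U_subset open_domain open_U]
  have sum: "(\<lambda>x. \<Sum>i=1..M. V k i x) \<in> H1 U"
    using H1_sum[OF open_U, of "{1..M}" "V k"] V by blast
  have "AE x in lebesgue_on U. \<forall>i\<in>{1..M}. weak_grad U (V k i) x = weak_grad (- \<Sigma> i) (V k i) x"
    by (intro AE_finite_allI V') auto
  moreover have "AE x in lebesgue_on U. strain U (\<lambda>x. \<Sum>i=1..M. V k i x) x = (\<Sum>i=1..M. strain U (V k i) x)"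
    by (rule strain_sum[OF open_U V])
  moreover have "AE x in lebesgue_on U. strain U (\<lambda>x. 1 *\<^sub>R (\<Sum>i=1..M. V k i x) + 1 *\<^sub>R W k x) x
      = 1 *\<^sub>R strain U (\<lambda>x. \<Sum>i=1..M. V k i x) x + 1 *\<^sub>R strain U (W k) x"
    by (rule strain_lincomb[OF open_U sum WU(1)])
  moreover have "AE x in lebesgue_on U. strain U (phi_half M c r V W k) x
      = (\<Sum>i=1..M. indicator (others i) x *\<^sub>R strain U (V k i) x) + strain U (W k) x"
    by (rule phi_half_H1(2)[of V k W, OF V WU(1)])
  moreover have "AE x in lebesgue_on U. x \<in> U"
    by (intro AE_I2) simp
  ultimately show ?thesis
    using WU(2)
  proof eventually_elim
    case (elim x)
    let ?e = "\<lambda>i. strain U (V k i) x" and ?E = "\<Sum>i=1..M. strain U (V k i) x"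
    have e: "strain (- \<Sigma> i) (V k i) x = ?e i" if "i \<in> {1..M}" for i
      using strain_cong[of U "V k i" x "- \<Sigma> i" "V k i"] elim(1) that by simp
    have eW: "strain \<Omega> (W k) x = strain U (W k) x"
      by (rule strain_cong[symmetric, OF elim(6)])
    \<comment> \<open>the true viscosity differs from that of droplet problem \<open>i\<close> just in the other droplets\<close>
    have coeff: "\<mu> x = \<mu>1 i x + (\<mu> x - \<mu>\<^sub>F) * indicator (others i) x" if i: "i \<in> {1..M}" for i
      using elim(5)
    proof (cases rule: U_cases)
      case fluid
      then show ?thesis using i by (simp add: mu_fluid indicator_others_fluid)
    next
      case (droplet l)
      then show ?thesis
        using droplet(3)[OF i] i indicator_others_droplet[OF droplet(1,2) i] mu_droplet[OF droplet(1,2)]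
        by (cases "i = l") simp_all
    qed
    have "(2 * \<mu> x) *\<^sub>R ?E = (\<Sum>i=1..M. (2 * \<mu>1 i x) *\<^sub>R ?e i + (2 * (\<mu> x - \<mu>\<^sub>F)) *\<^sub>R (indicator (others i) x *\<^sub>R ?e i))"
      unfolding scaleR_sum_right
    proof (intro sum.cong refl)
      fix i assume "i \<in> {1..M}"
      from arg_cong[OF coeff[OF this], where f = "\<lambda>t. (2 * t) *\<^sub>R ?e i"]
      show "(2 * \<mu> x) *\<^sub>R ?e i = (2 * \<mu>1 i x) *\<^sub>R ?e i + (2 * (\<mu> x - \<mu>\<^sub>F)) *\<^sub>R (indicator (others i) x *\<^sub>R ?e i)"
        by (simp only: distrib_left scaleR_add_left scaleR_scaleR mult.assoc)
    qed
    then have key: "(2 * \<mu> x) *\<^sub>R ?E = (\<Sum>i=1..M. (2 * \<mu>1 i x) *\<^sub>R ?e i)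
        + (2 * (\<mu> x - \<mu>\<^sub>F)) *\<^sub>R (\<Sum>i=1..M. indicator (others i) x *\<^sub>R ?e i)"
      by (simp only: sum.distrib scaleR_sum_right)
    have T: "(\<Sum>i=1..M. stress (- \<Sigma> i) (\<mu>1 i) (V k i) (Q i) x)
        = (\<Sum>i=1..M. (2 * \<mu>1 i x) *\<^sub>R ?e i) - (\<Sum>i=1..M. Q i x) *\<^sub>R mat 1"
      unfolding scaleR_sum_left sum_subtractf[symmetric]
      by (intro sum.cong refl) (simp only: stress_def e)
    have lhs: "stress U \<mu> (\<lambda>x. (\<Sum>i=1..M. V k i x) + W k x) (\<lambda>x. (\<Sum>i=1..M. Q i x) + s x) x
        = (2 * \<mu> x) *\<^sub>R ?E + (2 * \<mu> x) *\<^sub>R strain U (W k) x - ((\<Sum>i=1..M. Q i x) + s x) *\<^sub>R mat 1"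
      using elim(2,3) by (simp only: stress_def scaleR_one scaleR_add_right)
    have TW: "stress \<Omega> (\<lambda>x. \<mu>\<^sub>F) (W k) s x = (2 * \<mu>\<^sub>F) *\<^sub>R strain U (W k) x - s x *\<^sub>R mat 1"
      by (simp only: stress_def eW)
    have alg: "(A + m *\<^sub>R E) + a *\<^sub>R w - (q + t) *\<^sub>R J = (A - q *\<^sub>R J) + ((b *\<^sub>R w - t *\<^sub>R J) + m *\<^sub>R (E + w))"
      if "a = b + m" for A E w J :: "real^'n^'n" and a b m q t :: real
      by (simp add: that algebra_simps)
    show ?case
      unfolding lhs T TW key elim(4) by (rule alg) simp
  qed
qed

section \<open>Superposition for the interface problem\<close>

lemma interface_solution_iff:
  "interface_solution \<Omega> \<Gamma>\<^sub>D \<Gamma>\<^sub>N M c r \<mu> f G g\<^sub>D g\<^sub>N u p \<longleftrightarrow>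
    kinematic u \<and> p \<in> L2 \<Omega> \<and> balanced (stress U \<mu> u p) f G \<and>
    has_trace \<Omega> \<Gamma>\<^sub>D u g\<^sub>D \<and> has_normal_trace \<Omega> \<Gamma>\<^sub>N (stress U \<mu> u p) g\<^sub>N"
  unfolding interface_solution_def Let_def kinematic_def balanced_def
  using stress_L2[of u p] L2_domain_U[of p] by blast

text \<open>The outer boundary keeps away from the droplets, so the null sets may be those of
  \<open>U\<close>.\<close>

lemma outer_normal_trace_cong:
  assumes "has_normal_trace \<Omega> \<Gamma> T g" "\<Gamma> \<subseteq> frontier \<Omega>" "AE x in lebesgue_on U. T x = T' x"
  shows "has_normal_trace \<Omega> \<Gamma> T' g"
proof (rule has_normal_trace_local[OF assms(1) open_domain open_domain outer_nbhd(1) _ refl])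
  show "\<Gamma> \<subseteq> - closure (droplets M c r)" using assms(2) outer_nbhd(2) by blast
  show "AE x in lebesgue_on (\<Omega> \<inter> - closure (droplets M c r)). T x = T' x"
    unfolding outer_nbhd(3) by (rule AE_lebesgue_on_subset[OF assms(3) _ U_meas]) (auto simp: open_fluid)
qed

lemma interface_solution_diff:
  assumes N: "\<Gamma>\<^sub>N \<subseteq> frontier \<Omega>"
    and 1: "interface_solution \<Omega> \<Gamma>\<^sub>D \<Gamma>\<^sub>N M c r \<mu> f G g\<^sub>D g\<^sub>N u p"
    and 2: "interface_solution \<Omega> \<Gamma>\<^sub>D \<Gamma>\<^sub>N M c r \<mu> f' G' g\<^sub>D' g\<^sub>N' u' p'"
  shows "interface_solution \<Omega> \<Gamma>\<^sub>D \<Gamma>\<^sub>N M c r \<mu> (\<lambda>\<psi>. f \<psi> - f' \<psi>) (\<lambda>i \<psi>. G i \<psi> - G' i \<psi>)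
    (\<lambda>x. g\<^sub>D x - g\<^sub>D' x) (\<lambda>\<psi>. g\<^sub>N \<psi> - g\<^sub>N' \<psi>) (\<lambda>x. u x - u' x) (\<lambda>x. p x - p' x)"
proof -
  note 1 = 1[unfolded interface_solution_iff] and 2 = 2[unfolded interface_solution_iff]
  have H1: "u \<in> H1 U" "u' \<in> H1 U" using 1 2 by (auto simp: kinematic_def)
  have "AE x in lebesgue_on U. stress U \<mu> (\<lambda>x. 1 *\<^sub>R u x + (-1) *\<^sub>R u' x) (\<lambda>x. 1 * p x + (-1) * p' x) x
      = 1 *\<^sub>R stress U \<mu> u p x + (-1) *\<^sub>R stress U \<mu> u' p' x"
    by (rule stress_lincomb[OF open_U H1])
  then have AE: "AE x in lebesgue_on U. 1 *\<^sub>R stress U \<mu> u p x + (-1) *\<^sub>R stress U \<mu> u' p' x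
      = stress U \<mu> (\<lambda>x. u x - u' x) (\<lambda>x. p x - p' x) x"
    by eventually_elim simp
  have "balanced (\<lambda>x. 1 *\<^sub>R stress U \<mu> u p x + (-1) *\<^sub>R stress U \<mu> u' p' x)
      (\<lambda>\<psi>. 1 * f \<psi> + (-1) * f' \<psi>) (\<lambda>i \<psi>. 1 * G i \<psi> + (-1) * G' i \<psi>)"
    using 1 2 by (intro balanced_lincomb) auto
  then have "balanced (stress U \<mu> (\<lambda>x. u x - u' x) (\<lambda>x. p x - p' x)) (\<lambda>\<psi>. f \<psi> - f' \<psi>) (\<lambda>i \<psi>. G i \<psi> - G' i \<psi>)"
    by (rule balanced_cong_AE[OF _ AE]) simp_all
  moreover have "has_normal_trace \<Omega> \<Gamma>\<^sub>N (stress U \<mu> (\<lambda>x. u x - u' x) (\<lambda>x. p x - p' x)) (\<lambda>\<psi>. 1 * g\<^sub>N \<psi> + (-1) * g\<^sub>N' \<psi>)"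
    by (rule outer_normal_trace_cong[OF has_normal_trace_lincomb N AE]) (use 1 2 open_domain in auto)
  moreover have "has_trace \<Omega> \<Gamma>\<^sub>D (\<lambda>x. 1 *\<^sub>R u x + (-1) *\<^sub>R u' x) (\<lambda>x. 1 *\<^sub>R g\<^sub>D x + (-1) *\<^sub>R g\<^sub>D' x)"
    using 1 2 open_domain by (intro has_trace_lincomb) auto
  moreover have "kinematic (\<lambda>x. 1 *\<^sub>R u x + (-1) *\<^sub>R u' x)"
    using 1 2 by (intro kinematic_lincomb) auto
  moreover have "(\<lambda>x. 1 *\<^sub>R p x + (-1) *\<^sub>R p' x) \<in> L2 \<Omega>"
    using 1 2 by (intro L2_lincomb) auto
  ultimately show ?thesis
    by (simp add: interface_solution_iff)
qed

section \<open>The corrections\<close>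

text \<open>The divergence of the excess stress \<open>2 (\<mu> - \<mu>\<^sub>F)
  \<epsilon>(\<phi>)\<close>, with the factor moved to the test function.\<close>

abbreviation excess_force where
  "excess_force \<phi> \<psi> \<equiv> div_dist U (strain U \<phi>) (\<lambda>x. (2 * (\<mu> x - \<mu>\<^sub>F)) *\<^sub>R \<psi> x)"

text \<open>The factor \<open>\<mu> - \<mu>\<^sub>F\<close> vanishes outside the droplets, and in
  droplet \<open>i\<close> the field \<open>\<phi>\<close> is the input of its next
  problem.\<close>

lemma excess_force_droplet_sum:
  assumes \<phi>: "phi_half M c r V W k \<in> H1 U" and \<psi>: "\<psi> \<in> test_functions U"
  shows "excess_force (phi_half M c r V W k) \<psi> = (\<Sum>i=1..M. 2 * (\<mu>\<^sub>B i - \<mu>\<^sub>F) *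
    div_dist (B i) (strain (B i) (\<lambda>x. (\<Sum>i=1..M. V k i x) + W k x - V k i x)) \<psi>)"
proof -
  have e: "strain U (phi_half M c r V W k) \<in> L2 U"
    by (rule strain_L2[OF H1_weak_grad(2)[OF open_U \<phi>]])
  have "excess_force (phi_half M c r V W k) \<psi>
      = div_dist U (\<lambda>x. (2 * (\<mu> x - \<mu>\<^sub>F)) *\<^sub>R strain U (phi_half M c r V W k) x) \<psi>"
    by (rule div_dist_mu_times[OF \<psi>])
  also have "\<dots> = (\<Sum>i=1..M. 2 * (\<mu>\<^sub>B i - \<mu>\<^sub>F) * div_dist (B i) (strain U (phi_half M c r V W k)) \<psi>)"
  proof (rule div_dist_droplet_sum[OF e _ \<psi>])
    fix x assume "x \<in> U"
    from mu_eq[OF this] show "2 * (\<mu> x - \<mu>\<^sub>F) = (\<Sum>i=1..M. 2 * (\<mu>\<^sub>B i - \<mu>\<^sub>F) * indicator (B i) x)"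
      by (simp only: sum_distrib_left mult.assoc add_diff_cancel_left')
  qed
  also have "\<dots> = (\<Sum>i=1..M. 2 * (\<mu>\<^sub>B i - \<mu>\<^sub>F) *
      div_dist (B i) (strain (B i) (\<lambda>x. (\<Sum>i=1..M. V k i x) + W k x - V k i x)) \<psi>)"
  proof (intro sum.cong refl arg_cong2[where f = "(*)"])
    fix i assume i: "i \<in> {1..M}"
    have "strain U (phi_half M c r V W k) \<in> L2 (B i)"
      by (rule L2_subset[OF e B_subset_U[OF i] U_meas]) simp
    moreover have "AE x in lebesgue_on (B i). strain U (phi_half M c r V W k) x
        = strain (B i) (\<lambda>x. (\<Sum>i=1..M. V k i x) + W k x - V k i x) x"
      using strain_phi_half_droplet[OF \<phi> i] by eventually_elim simp
    ultimately show "div_dist (B i) (strain U (phi_half M c r V W k)) \<psi>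
        = div_dist (B i) (strain (B i) (\<lambda>x. (\<Sum>i=1..M. V k i x) + W k x - V k i x)) \<psi>"
      using div_dist_cong_AE[OF _ _ \<psi>] by simp
  qed
  finally show ?thesis .
qed

text \<open>The first approximation solves the interface problem up to the excess stress of its
  own flow: the pressure update has already accounted for the surface tension.\<close>

lemma initial_approximation:
  assumes N: "\<Gamma>\<^sub>N \<subseteq> frontier \<Omega>"
    and bs: "boundary_solution \<Omega> \<Gamma>\<^sub>D \<Gamma>\<^sub>N \<mu>\<^sub>F f g\<^sub>D g\<^sub>N W S"
    and jumps: "\<And>i. i \<in> {1..M} \<Longrightarrow> trace_jump \<Omega>\<^sub>F (B i) (\<Sigma> i) W (\<lambda>x. 0)"
      "\<And>i. i \<in> {1..M} \<Longrightarrow> normal_jump \<Omega>\<^sub>F (B i) (\<Sigma> i) (stress \<Omega> (\<lambda>x. \<mu>\<^sub>F) W S) (\<lambda>\<psi>. 0)"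
    and \<tau>: "\<And>i. i \<in> {1..M} \<Longrightarrow> has_normal_trace (B i) (\<Sigma> i) (strain U W) (\<tau> i)"
  shows "interface_solution \<Omega> \<Gamma>\<^sub>D \<Gamma>\<^sub>N M c r \<mu> (\<lambda>\<psi>. f \<psi> - excess_force W \<psi>)
    (\<lambda>i \<psi>. 2 * (\<mu>\<^sub>F - \<mu>\<^sub>B i) * \<tau> i \<psi>
      + a i * (\<integral>y. ((1 / r i) *\<^sub>R (y - c i)) \<bullet> \<psi> y \<partial>sphere_measure (c i) (r i)))
    g\<^sub>D g\<^sub>N W (\<lambda>x. S x + (\<Sum>i=1..M. a i * indicator (B i) x))"
proof -
  let ?T = "stress \<Omega> (\<lambda>x. \<mu>\<^sub>F) W S" and ?X = "\<lambda>x. (2 * (\<mu> x - \<mu>\<^sub>F)) *\<^sub>R strain U W x"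
  let ?P = "\<lambda>x. \<Sum>i=1..M. a i * indicator (B i) x"
  let ?s = "stress U \<mu> W (\<lambda>x. S x + ?P x)"
  have W: "W \<in> H1 \<Omega>" "S \<in> L2 \<Omega>" "divergence_free \<Omega> W" "has_trace \<Omega> \<Gamma>\<^sub>D W g\<^sub>D" "has_normal_trace \<Omega> \<Gamma>\<^sub>N ?T g\<^sub>N"
    and pde: "\<And>\<psi>. \<psi> \<in> test_functions \<Omega> \<Longrightarrow> - div_dist \<Omega> ?T \<psi> = f \<psi>"
    using bs unfolding boundary_solution_def Let_def by blast+
  note WU = H1_subset[OF W(1) U_subset open_domain open_U]
  have decomposition: "AE x in lebesgue_on U. 1 *\<^sub>R (1 *\<^sub>R ?T x + 1 *\<^sub>R ?X x) + (-1) *\<^sub>R (?P x *\<^sub>R mat 1) = ?s x"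
    using WU(2)
  proof eventually_elim
    case (elim x)
    have "strain \<Omega> W x = strain U W x" by (rule strain_cong[OF elim[symmetric]])
    then show ?case by (simp add: stress_def scaleR_add_left algebra_simps del: sum_mult_indicator)
  qed
  have "balanced (\<lambda>x. 1 *\<^sub>R (1 *\<^sub>R ?T x + 1 *\<^sub>R ?X x) + (-1) *\<^sub>R (?P x *\<^sub>R mat 1))
      (\<lambda>\<psi>. 1 * (1 * f \<psi> + 1 * (- excess_force W \<psi>)) + (-1) * 0)
      (\<lambda>i \<psi>. 1 * (1 * 0 + 1 * (2 * (\<mu>\<^sub>F - \<mu>\<^sub>B i) * \<tau> i \<psi>))
        + (-1) * (- a i * (\<integral>y. ((1 / r i) *\<^sub>R (y - c i)) \<bullet> \<psi> y \<partial>sphere_measure (c i) (r i))))"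
    by (intro balanced_lincomb boundary_flow_balanced[OF W(1,2) pde jumps(2)]
        excess_stress_balanced[OF WU(1) \<tau>] droplet_pressure_balanced)
  then have "balanced ?s (\<lambda>\<psi>. f \<psi> - excess_force W \<psi>)
      (\<lambda>i \<psi>. 2 * (\<mu>\<^sub>F - \<mu>\<^sub>B i) * \<tau> i \<psi>
        + a i * (\<integral>y. ((1 / r i) *\<^sub>R (y - c i)) \<bullet> \<psi> y \<partial>sphere_measure (c i) (r i)))"
    by (rule balanced_cong_AE[OF _ decomposition]) simp_all
  moreover have "has_normal_trace \<Omega> \<Gamma>\<^sub>N ?s g\<^sub>N"
  proof (rule has_normal_trace_local[OF W(5) open_domain open_domain outer_nbhd(1) _ refl])
    show "\<Gamma>\<^sub>N \<subseteq> - closure (droplets M c r)" using N outer_nbhd(2) by blast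
    have "AE x in lebesgue_on \<Omega>\<^sub>F. 1 *\<^sub>R (1 *\<^sub>R ?T x + 1 *\<^sub>R ?X x) + (-1) *\<^sub>R (?P x *\<^sub>R mat 1) = ?s x"
      by (rule AE_lebesgue_on_subset[OF decomposition _ U_meas]) (auto simp: open_fluid)
    moreover have "AE x in lebesgue_on \<Omega>\<^sub>F. x \<in> \<Omega>\<^sub>F" by (intro AE_I2) simp
    ultimately show "AE x in lebesgue_on (\<Omega> \<inter> - closure (droplets M c r)). ?T x = ?s x"
      unfolding outer_nbhd(3)
    proof eventually_elim
      case (elim x)
      have "?P x = 0"
        using fluid_disjoint_cball elim(2) by (intro sum.neutral ballI) (force simp: indicator_def)
      then have "1 *\<^sub>R (1 *\<^sub>R ?T x + 1 *\<^sub>R ?X x) + (-1) *\<^sub>R (?P x *\<^sub>R (mat 1 :: real^'n^'n)) = ?T x"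
        by (simp only: mu_fluid[OF elim(2)]) simp
      then show ?case using elim(1) by (simp only:)
    qed
  qed
  moreover have "(\<lambda>x. 1 *\<^sub>R S x + 1 *\<^sub>R ?P x) \<in> L2 \<Omega>"
  proof (intro L2_lincomb W)
    have "(\<lambda>x. \<Sum>i=1..M. indicator (B i) x *\<^sub>R a i) \<in> L2 \<Omega>"
      by (intro L2_sum L2_indicator bounded_const_L2 lmeasurable_domain) simp
    then show "?P \<in> L2 \<Omega>" by (simp only: real_scaleR_def mult.commute)
  qed
  moreover have "kinematic W"
    by (rule boundary_flow_kinematic[OF W(1,3) jumps(1)])
  ultimately show ?thesis
    unfolding interface_solution_iff using W(4) by (simp only: scaleR_one simp_thms)
qed

text \<open>The droplet problems supply the excess force and jump of the previous
  \<open>\<phi>\<close>, and the boundary problem cancels the boundary data of the droplet flows.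
  The excess stress of the next \<open>\<phi>\<close> is what \<open>stress_decomposition\<close>
  leaves over.\<close>

lemma correction_step:
  assumes N: "\<Gamma>\<^sub>N \<subseteq> frontier \<Omega>"
    and \<phi>: "phi_half M c r V W k \<in> H1 U"
    and drop: "\<And>i. i \<in> {1..M} \<Longrightarrow> droplet_solution \<mu>\<^sub>F (\<mu>\<^sub>B i) (c i) (r i)
        (\<lambda>x. (\<Sum>i=1..M. V k i x) + W k x - V k i x) (V (Suc k) i) (Q i)"
    and \<tau>: "\<And>i. i \<in> {1..M} \<Longrightarrow> normal_jump (ext i) (B i) (\<Sigma> i) (droplet_stress i (V (Suc k) i) (Q i))
        (\<lambda>\<psi>. - 2 * (\<mu>\<^sub>F - \<mu>\<^sub>B i) * \<tau> i \<psi>)"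
    and b: "has_trace \<Omega> \<Gamma>\<^sub>D (\<lambda>x. \<Sum>i=1..M. V (Suc k) i x) b"
    and t: "has_normal_trace \<Omega> \<Gamma>\<^sub>N (stress U \<mu> (\<lambda>x. \<Sum>i=1..M. V (Suc k) i x) (\<lambda>x. \<Sum>i=1..M. Q i x)) t"
    and bs: "boundary_solution \<Omega> \<Gamma>\<^sub>D \<Gamma>\<^sub>N \<mu>\<^sub>F (\<lambda>\<psi>. 0) (\<lambda>x. - b x) (\<lambda>\<psi>. - t \<psi>) (W (Suc k)) S"
    and jumps: "\<And>i. i \<in> {1..M} \<Longrightarrow> trace_jump \<Omega>\<^sub>F (B i) (\<Sigma> i) (W (Suc k)) (\<lambda>x. 0)"
      "\<And>i. i \<in> {1..M} \<Longrightarrow> normal_jump \<Omega>\<^sub>F (B i) (\<Sigma> i) (stress \<Omega> (\<lambda>x. \<mu>\<^sub>F) (W (Suc k)) S) (\<lambda>\<psi>. 0)"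
    and \<tau>': "\<And>i. i \<in> {1..M} \<Longrightarrow> has_normal_trace (B i) (\<Sigma> i) (strain U (phi_half M c r V W (Suc k))) (\<tau>' i)"
  shows "interface_solution \<Omega> \<Gamma>\<^sub>D \<Gamma>\<^sub>N M c r \<mu>
    (\<lambda>\<psi>. excess_force (phi_half M c r V W k) \<psi> - excess_force (phi_half M c r V W (Suc k)) \<psi>)
    (\<lambda>i \<psi>. - 2 * (\<mu>\<^sub>F - \<mu>\<^sub>B i) * \<tau> i \<psi> + 2 * (\<mu>\<^sub>F - \<mu>\<^sub>B i) * \<tau>' i \<psi>)
    (\<lambda>x. 0) (\<lambda>\<psi>. 0)
    (\<lambda>x. (\<Sum>i=1..M. V (Suc k) i x) + W (Suc k) x) (\<lambda>x. (\<Sum>i=1..M. Q i x) + S x)"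
proof -
  let ?V = "\<lambda>x. \<Sum>i=1..M. V (Suc k) i x" and ?Q = "\<lambda>x. \<Sum>i=1..M. Q i x"
  let ?T = "stress \<Omega> (\<lambda>x. \<mu>\<^sub>F) (W (Suc k)) S"
  let ?\<phi> = "phi_half M c r V W (Suc k)"
  let ?X = "\<lambda>x. (2 * (\<mu> x - \<mu>\<^sub>F)) *\<^sub>R strain U ?\<phi> x"
  let ?s = "stress U \<mu> (\<lambda>x. ?V x + W (Suc k) x) (\<lambda>x. ?Q x + S x)"
  let ?D = "\<lambda>x. \<Sum>i=1..M. droplet_stress i (V (Suc k) i) (Q i) x"
  have W: "W (Suc k) \<in> H1 \<Omega>" "S \<in> L2 \<Omega>" "divergence_free \<Omega> (W (Suc k))"
    "has_trace \<Omega> \<Gamma>\<^sub>D (W (Suc k)) (\<lambda>x. - b x)" "has_normal_trace \<Omega> \<Gamma>\<^sub>N ?T (\<lambda>\<psi>. - t \<psi>)"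
    and pde: "\<And>\<psi>. \<psi> \<in> test_functions \<Omega> \<Longrightarrow> - div_dist \<Omega> ?T \<psi> = 0"
    using bs unfolding boundary_solution_def Let_def by blast+
  note WU = H1_subset[OF W(1) U_subset open_domain open_U]
  have VU: "V (Suc k) i \<in> H1 U"
    "AE x in lebesgue_on U. weak_grad U (V (Suc k) i) x = weak_grad (- \<Sigma> i) (V (Suc k) i) x"
    if "i \<in> {1..M}" for i
    by (rule droplet_flow_H1[OF that drop[OF that]])+
  have \<phi>': "?\<phi> \<in> H1 U"
    by (rule phi_half_H1(1)[of V "Suc k" W, OF VU(1) WU(1)])
  have VH: "?V \<in> H1 U"
    using H1_sum[OF open_U, of "{1..M}" "V (Suc k)"] VU(1) by blast
  have decomposition: "AE x in lebesgue_on U. ?s x = ?D x + (?T x + ?X x)"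
    by (rule stress_decomposition[of V "Suc k" W, OF VU W(1)])
  have AE: "AE x in lebesgue_on U. 1 *\<^sub>R ?D x + 1 *\<^sub>R (1 *\<^sub>R ?T x + 1 *\<^sub>R ?X x) = ?s x"
    using decomposition by eventually_elim (simp only: scaleR_one)
  have sum: "balanced (\<lambda>x. 1 *\<^sub>R ?D x + 1 *\<^sub>R (1 *\<^sub>R ?T x + 1 *\<^sub>R ?X x))
      (\<lambda>\<psi>. 1 * (\<Sum>i=1..M. 2 * (\<mu>\<^sub>B i - \<mu>\<^sub>F) * div_dist (B i) (strain (B i) (\<lambda>x. (\<Sum>i=1..M. V k i x) + W k x - V k i x)) \<psi>)
        + 1 * (1 * 0 + 1 * (- excess_force ?\<phi> \<psi>)))
      (\<lambda>l \<psi>. 1 * (\<Sum>i=1..M. if l = i then - 2 * (\<mu>\<^sub>F - \<mu>\<^sub>B i) * \<tau> i \<psi> else 0)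
        + 1 * (1 * 0 + 1 * (2 * (\<mu>\<^sub>F - \<mu>\<^sub>B l) * \<tau>' l \<psi>)))"
    by (intro balanced_lincomb balanced_sum boundary_flow_balanced[OF W(1,2) pde jumps(2)]
        excess_stress_balanced[OF \<phi>' \<tau>'] droplet_flow_balanced[OF _ drop \<tau>])
  have "balanced ?s
      (\<lambda>\<psi>. excess_force (phi_half M c r V W k) \<psi> - excess_force ?\<phi> \<psi>)
      (\<lambda>i \<psi>. - 2 * (\<mu>\<^sub>F - \<mu>\<^sub>B i) * \<tau> i \<psi> + 2 * (\<mu>\<^sub>F - \<mu>\<^sub>B i) * \<tau>' i \<psi>)"
  proof (rule balanced_cong_AE[OF sum AE])
    fix \<psi> :: "real^'n \<Rightarrow> real^'n" assume "\<psi> \<in> test_functions U"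
    from excess_force_droplet_sum[OF \<phi> this]
    show "1 * (\<Sum>i=1..M. 2 * (\<mu>\<^sub>B i - \<mu>\<^sub>F) * div_dist (B i) (strain (B i) (\<lambda>x. (\<Sum>i=1..M. V k i x) + W k x - V k i x)) \<psi>)
        + 1 * (1 * 0 + 1 * (- excess_force ?\<phi> \<psi>))
        = excess_force (phi_half M c r V W k) \<psi> - excess_force ?\<phi> \<psi>"
      by (simp only:) simp
  qed simp
  moreover have "has_normal_trace \<Omega> \<Gamma>\<^sub>N ?s (\<lambda>\<psi>. 1 * t \<psi> + 1 * (- t \<psi>))"
  proof (rule has_normal_trace_local[OF has_normal_trace_lincomb[OF open_domain t W(5)] open_domain open_domain outer_nbhd(1) _ refl])
    show "\<Gamma>\<^sub>N \<subseteq> - closure (droplets M c r)" using N outer_nbhd(2) by blast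
    have "AE x in lebesgue_on U. strain U (\<lambda>x. 1 *\<^sub>R ?V x + 1 *\<^sub>R W (Suc k) x) x
        = 1 *\<^sub>R strain U ?V x + 1 *\<^sub>R strain U (W (Suc k)) x"
      by (rule strain_lincomb[OF open_U VH WU(1)])
    then have "AE x in lebesgue_on U. x \<in> \<Omega>\<^sub>F \<longrightarrow> 1 *\<^sub>R stress U \<mu> ?V ?Q x + 1 *\<^sub>R ?T x = ?s x"
      using WU(2)
    proof eventually_elim
      case (elim x)
      have "strain \<Omega> (W (Suc k)) x = strain U (W (Suc k)) x" by (rule strain_cong[OF elim(2)[symmetric]])
      then show ?case
        using elim(1) by (simp add: stress_def mu_fluid algebra_simps)
    qed
    then have "AE x in lebesgue_on \<Omega>\<^sub>F. x \<in> \<Omega>\<^sub>F \<longrightarrow> 1 *\<^sub>R stress U \<mu> ?V ?Q x + 1 *\<^sub>R ?T x = ?s x"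
      by (rule AE_lebesgue_on_subset[OF _ _ U_meas]) (auto simp: open_fluid)
    moreover have "AE x in lebesgue_on \<Omega>\<^sub>F. x \<in> \<Omega>\<^sub>F" by (intro AE_I2) simp
    ultimately show "AE x in lebesgue_on (\<Omega> \<inter> - closure (droplets M c r)). 1 *\<^sub>R stress U \<mu> ?V ?Q x + 1 *\<^sub>R ?T x = ?s x"
      unfolding outer_nbhd(3) by eventually_elim blast
  qed
  moreover have "(\<lambda>x. 1 *\<^sub>R ?Q x + 1 *\<^sub>R S x) \<in> L2 \<Omega>"
    using bounded_domain open_domain
    by (intro L2_lincomb L2_sum W(2) droplet_pressure_L2[OF _ drop]) simp_all
  moreover have "has_trace \<Omega> \<Gamma>\<^sub>D (\<lambda>x. 1 *\<^sub>R ?V x + 1 *\<^sub>R W (Suc k) x) (\<lambda>x. 1 *\<^sub>R b x + 1 *\<^sub>R (- b x))"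
    by (rule has_trace_lincomb[OF open_lebesgue[OF open_domain] b W(4)])
  moreover have "kinematic (\<lambda>x. 1 *\<^sub>R ?V x + 1 *\<^sub>R W (Suc k) x)"
    by (intro kinematic_lincomb kinematic_sum droplet_flow_kinematic[OF _ drop]
        boundary_flow_kinematic[OF W(1,3) jumps(1)])
  ultimately show ?thesis
    unfolding interface_solution_iff by simp
qed

end

section \<open>The error equations\<close>

theorem proposition3p2:
  fixes \<Omega> \<Gamma>\<^sub>D \<Gamma>\<^sub>N \<Omega>\<^sub>B \<Omega>\<^sub>F :: "(real^'n) set"
    and M :: nat and c :: "nat \<Rightarrow> real^'n" and r :: "nat \<Rightarrow> real"
    and \<mu> :: "real^'n \<Rightarrow> real" and \<mu>\<^sub>F :: real and \<mu>\<^sub>B \<gamma> :: "nat \<Rightarrow> real"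
    and f g\<^sub>N :: "(real^'n \<Rightarrow> real^'n) \<Rightarrow> real" and g\<^sub>D :: "real^'n \<Rightarrow> real^'n"
    and u :: "real^'n \<Rightarrow> real^'n" and p :: "real^'n \<Rightarrow> real"
    and V :: "nat \<Rightarrow> nat \<Rightarrow> real^'n \<Rightarrow> real^'n" and Q :: "nat \<Rightarrow> nat \<Rightarrow> real^'n \<Rightarrow> real"
    and W us :: "nat \<Rightarrow> real^'n \<Rightarrow> real^'n" and S ps :: "nat \<Rightarrow> real^'n \<Rightarrow> real"
    and j :: nat
  assumes dim: "CARD('n) = 2 \<or> CARD('n) = 3"
    and Omega: "bounded_Lipschitz_domain \<Omega>"
    and M: "M \<ge> 1"
    and radii: "\<forall>i\<in>{1..M}. r i > 0"
    and inside: "\<forall>i\<in>{1..M}. cball (c i) (r i) \<subseteq> \<Omega>"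
    and disjoint: "\<forall>i\<in>{1..M}. \<forall>i'\<in>{1..M}. i \<noteq> i' \<longrightarrow> cball (c i) (r i) \<inter> cball (c i') (r i') = {}"
    and Omega_B: "\<Omega>\<^sub>B = droplets M c r"
    and Omega_F: "\<Omega>\<^sub>F = fluid \<Omega> M c r"
    and Gamma: "\<Gamma>\<^sub>D \<subseteq> frontier \<Omega>" "\<Gamma>\<^sub>N = frontier \<Omega> - \<Gamma>\<^sub>D"
    and mu_pos: "\<mu>\<^sub>F > 0" "\<forall>i\<in>{1..M}. \<mu>\<^sub>B i > 0"
    and mu: "\<forall>x\<in>\<Omega>\<^sub>F. \<mu> x = \<mu>\<^sub>F" "\<forall>i\<in>{1..M}. \<forall>x\<in>ball (c i) (r i). \<mu> x = \<mu>\<^sub>B i"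
    and data: "f \<in> H_minus_1 \<Omega>" "g\<^sub>D \<in> H_half \<Omega> \<Gamma>\<^sub>D" "g\<^sub>N \<in> H_minus_half \<Omega> \<Gamma>\<^sub>N"
    \<comment> \<open>the interface problem, with jump \<open>\<gamma> \<kappa> n\<close> where \<open>\<kappa> = 1 / r i\<close> and \<open>n = (y - c i) / r i\<close>\<close>
    and exact: "interface_solution \<Omega> \<Gamma>\<^sub>D \<Gamma>\<^sub>N M c r \<mu> f
        (\<lambda>i \<psi>. \<integral>y. (\<gamma> i * (1 / r i)) *\<^sub>R ((1 / r i) *\<^sub>R (y - c i)) \<bullet> \<psi> y \<partial>sphere_measure (c i) (r i))
        g\<^sub>D g\<^sub>N u p"
    and algorithm: "alternating_correction \<Omega> \<Gamma>\<^sub>D \<Gamma>\<^sub>N M c r \<mu> \<mu>\<^sub>F \<mu>\<^sub>B \<gamma> f g\<^sub>D g\<^sub>N V Q W S us ps"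
    \<comment> \<open>standing fact on the results of the boundary solver\<close>
    and boundary_solver_no_jumps: "\<forall>k. \<forall>i\<in>{1..M}.
        trace_jump \<Omega>\<^sub>F (ball (c i) (r i)) (sphere (c i) (r i)) (W k) (\<lambda>x. 0) \<and>
        normal_jump \<Omega>\<^sub>F (ball (c i) (r i)) (sphere (c i) (r i))
          (stress \<Omega> (\<lambda>x. \<mu>\<^sub>F) (W k) (S k)) (\<lambda>\<psi>. 0)"
  shows "\<exists>\<tau>. (\<forall>i\<in>{1..M}. has_normal_trace (ball (c i) (r i)) (sphere (c i) (r i))
                 (strain (\<Omega>\<^sub>B \<union> \<Omega>\<^sub>F) (phi_half M c r V W j)) (\<tau> i)) \<and>
      interface_solution \<Omega> \<Gamma>\<^sub>D \<Gamma>\<^sub>N M c r \<mu>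
        (\<lambda>\<psi>. div_dist (\<Omega>\<^sub>B \<union> \<Omega>\<^sub>F) (strain (\<Omega>\<^sub>B \<union> \<Omega>\<^sub>F) (phi_half M c r V W j))
                (\<lambda>x. (2 * (\<mu> x - \<mu>\<^sub>F)) *\<^sub>R \<psi> x))
        (\<lambda>i \<psi>. - 2 * (\<mu>\<^sub>F - \<mu>\<^sub>B i) * \<tau> i \<psi>)
        (\<lambda>x. 0) (\<lambda>\<psi>. 0)
        (\<lambda>x. u x - us j x) (\<lambda>x. p x - ps j x)"
proof -
  interpret two_phase_geometry \<Omega> M c r \<mu> \<mu>\<^sub>F \<mu>\<^sub>B
    using dim Omega radii inside disjoint mu Omega_F
    by unfold_locales (auto simp: bounded_Lipschitz_domain_def)
  note algorithm = algorithm[unfolded alternating_correction_def Let_def]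
  have N: "\<Gamma>\<^sub>N \<subseteq> frontier \<Omega>" using Gamma by blast
  let ?\<phi> = "phi_half M c r V W"
  let ?\<phi>' = "\<lambda>k i x. (\<Sum>i=1..M. V k i x) + W k x - V k i x"
  have drop: "droplet_solution \<mu>\<^sub>F (\<mu>\<^sub>B i) (c i) (r i) (?\<phi>' k i) (V (Suc k) i) (Q (Suc k) i)" if "i \<in> {1..M}" for k i
    using algorithm that by blast
  \<comment> \<open>the normal traces that come with the droplet problems of the following step\<close>
  define \<tau> where "\<tau> k i = (SOME t. has_normal_trace (B i) (\<Sigma> i) (strain (B i) (?\<phi>' k i)) t \<and>
      normal_jump (ext i) (B i) (\<Sigma> i) (droplet_stress i (V (Suc k) i) (Q (Suc k) i))
        (\<lambda>\<psi>. - 2 * (\<mu>\<^sub>F - \<mu>\<^sub>B i) * t \<psi>))" for k i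
  have \<tau>: "has_normal_trace (B i) (\<Sigma> i) (strain (B i) (?\<phi>' k i)) (\<tau> k i)"
    "normal_jump (ext i) (B i) (\<Sigma> i) (droplet_stress i (V (Suc k) i) (Q (Suc k) i))
      (\<lambda>\<psi>. - 2 * (\<mu>\<^sub>F - \<mu>\<^sub>B i) * \<tau> k i \<psi>)" if "i \<in> {1..M}" for k i
  proof -
    have "\<exists>t. has_normal_trace (B i) (\<Sigma> i) (strain (B i) (?\<phi>' k i)) t \<and>
      normal_jump (ext i) (B i) (\<Sigma> i) (droplet_stress i (V (Suc k) i) (Q (Suc k) i))
        (\<lambda>\<psi>. - 2 * (\<mu>\<^sub>F - \<mu>\<^sub>B i) * t \<psi>)"
      using drop[OF that, of k] unfolding droplet_solution_def Let_def by blast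
    from someI_ex[OF this]
    show "has_normal_trace (B i) (\<Sigma> i) (strain (B i) (?\<phi>' k i)) (\<tau> k i)"
      "normal_jump (ext i) (B i) (\<Sigma> i) (droplet_stress i (V (Suc k) i) (Q (Suc k) i))
        (\<lambda>\<psi>. - 2 * (\<mu>\<^sub>F - \<mu>\<^sub>B i) * \<tau> k i \<psi>)"
      unfolding \<tau>_def by blast+
  qed
  have V: "V k i \<in> H1 U" if i: "i \<in> {1..M}" for k i
  proof (cases k)
    case 0
    then have "V k i = (\<lambda>x. 0)" using algorithm i by blast
    then show ?thesis using H1_zero(1)[OF open_U] by simp
  next
    case (Suc m)
    then show ?thesis using droplet_flow_H1(1)[OF i drop[OF i]] by simp
  qed
  have W: "W k \<in> H1 U" for k
  proof -
    have "W k \<in> H1 \<Omega>"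
      using algorithm by (cases k) (auto simp: boundary_solution_def Let_def)
    then show ?thesis by (rule H1_subset(1)[OF _ U_subset open_domain open_U])
  qed
  have \<phi>: "?\<phi> k \<in> H1 U" for k
    by (rule phi_half_H1(1)[OF V W])
  \<comment> \<open>in each droplet, the strain of \<open>\<phi>\<close> is that of the input of the next droplet problem\<close>
  have \<tau>U: "has_normal_trace (B i) (\<Sigma> i) (strain U (?\<phi> k)) (\<tau> k i)" if i: "i \<in> {1..M}" for k i
  proof (rule has_normal_trace_local[OF \<tau>(1)[OF i] open_ball open_ball open_UNIV subset_UNIV refl])
    show "AE x in lebesgue_on (B i \<inter> UNIV). strain (B i) (?\<phi>' k i) x = strain U (?\<phi> k) x"
      unfolding Int_UNIV_right by (rule strain_phi_half_droplet[OF \<phi> i])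
  qed
  have jumps: "trace_jump (fluid \<Omega> M c r) (B i) (\<Sigma> i) (W k) (\<lambda>x. 0)"
    "normal_jump (fluid \<Omega> M c r) (B i) (\<Sigma> i) (stress \<Omega> (\<lambda>x. \<mu>\<^sub>F) (W k) (S k)) (\<lambda>\<psi>. 0)" if "i \<in> {1..M}" for k i
    using boundary_solver_no_jumps that unfolding Omega_F by blast+
  have "interface_solution \<Omega> \<Gamma>\<^sub>D \<Gamma>\<^sub>N M c r \<mu> (excess_force (?\<phi> j))
      (\<lambda>i \<psi>. - 2 * (\<mu>\<^sub>F - \<mu>\<^sub>B i) * \<tau> j i \<psi>) (\<lambda>x. 0) (\<lambda>\<psi>. 0)
      (\<lambda>x. u x - us j x) (\<lambda>x. p x - ps j x)"
  proof (induction j)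
    case 0
    have us0: "us 0 = W 0" and ps0: "ps 0 = (\<lambda>x. S 0 x + (\<Sum>i=1..M. \<gamma> i / r i * indicator (B i) x))"
      and bs: "boundary_solution \<Omega> \<Gamma>\<^sub>D \<Gamma>\<^sub>N \<mu>\<^sub>F f g\<^sub>D g\<^sub>N (W 0) (S 0)"
      and V0: "\<forall>i\<in>{1..M}. V 0 i = (\<lambda>x. 0)"
      using algorithm by blast+
    \<comment> \<open>before the first droplet problems, \<open>\<phi>\<close> is the flow of the boundary problem alone\<close>
    have \<phi>0: "?\<phi> 0 = W 0"
      using V0 by (simp add: fun_eq_iff phi_half_eq)
    have "has_normal_trace (B i) (\<Sigma> i) (strain U (W 0)) (\<tau> 0 i)" if "i \<in> {1..M}" for i
      using \<tau>U[OF that, of 0] by (simp only: \<phi>0)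
    note start = initial_approximation[OF N bs jumps this, of "\<lambda>i. \<gamma> i / r i"]
    \<comment> \<open>the surface tension cancels against the jump of the pressure update\<close>
    let ?n = "\<lambda>i \<psi>. \<integral>y. ((1 / r i) *\<^sub>R (y - c i)) \<bullet> \<psi> y \<partial>sphere_measure (c i) (r i)"
    have "(\<integral>y. (\<gamma> i * (1 / r i)) *\<^sub>R ((1 / r i) *\<^sub>R (y - c i)) \<bullet> \<psi> y \<partial>sphere_measure (c i) (r i))
        = \<gamma> i / r i * ?n i \<psi>" for i \<psi>
      by (simp only: inner_scaleR_left integral_mult_right_zero times_divide_eq_right mult_1_right)
    moreover have "C - (2 * m * t + C) = - 2 * m * t" "a - (a - b) = b" for C m t a b :: real
      by simp_all
    ultimately show ?case
      using interface_solution_diff[OF N exact start] by (simp only: us0 ps0 \<phi>0 diff_self)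
  next
    case (Suc k)
    obtain b t where
      b: "has_trace \<Omega> \<Gamma>\<^sub>D (\<lambda>x. \<Sum>i=1..M. V (Suc k) i x) b" and
      t: "has_normal_trace \<Omega> \<Gamma>\<^sub>N (stress U \<mu> (\<lambda>x. \<Sum>i=1..M. V (Suc k) i x) (\<lambda>x. \<Sum>i=1..M. Q (Suc k) i x)) t" and
      bs: "boundary_solution \<Omega> \<Gamma>\<^sub>D \<Gamma>\<^sub>N \<mu>\<^sub>F (\<lambda>\<psi>. 0) (\<lambda>x. - b x) (\<lambda>\<psi>. - t \<psi>) (W (Suc k)) (S (Suc k))"
      using algorithm by blast
    have us: "us (Suc k) = (\<lambda>x. us k x + (\<Sum>i=1..M. V (Suc k) i x) + W (Suc k) x)"
      and ps: "ps (Suc k) = (\<lambda>x. ps k x + (\<Sum>i=1..M. Q (Suc k) i x) + S (Suc k) x)"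
      using algorithm by blast+
    from interface_solution_diff[OF N Suc.IH correction_step[OF N \<phi> drop \<tau>(2) b t bs jumps \<tau>U]]
    show ?case
      by (simp add: us ps algebra_simps)
  qed
  with \<tau>U show ?thesis
    unfolding Omega_B Omega_F by blast
qed

end
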